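(* Let $W$ be a reflexive Banach space with a scaling (with exponent $s>0$), let $A_s,B_s$ be scaled operators on $W$ with potentials $I_s,J_s$ (normalized by $I_s(0)=J_s(0)=0$), and assume: (a) $A_s(u)u>0$ for all $u\in W\setminus\{0\}$; (b) every sequence $(u_j)$ in $W$ such that $u_j\rightharpoonup u$ and $A_s(u_j)(u_j-u)\to 0$ has a subsequence that converges strongly to $u$; (c) $B_s(u)u>0$ for all $u\in W\setminus\{0\}$; (d) if $u_j\rightharpoonup u$ in $W$, then $B_s(u_j)\to B_s(u)$ in $W^*$; (e) $I_s(u)\to\infty$ as $\|u\|\to\infty$; (f) for each $u\in W\setminus\{0\}$ the equation $I_s(tu)=1$ has a unique positive solution $t$; (g) whenever $\lambda\in\mathbb R$ and $u\in W$ satisfy $A_s(u)=\lambda B_s(u)$ in $W^*$, one has $I_s(u)=\lambda J_s(u)$. Let $\sigma(A_s,B_s)$ be the set of eigenvalues, let $\lambda_k$ ($k\ge1$) be the minimax eigenvalues, let $\Phi_\lambda=I_s-\lambda J_s$ and let $\widetilde\Psi^\lambda=\{u\in\mathcal M_s:\widetilde\Psi(u)\le\lambda\}$, all as defined in the context. Let $\lambda\in\mathbb R\setminus\sigma(A_s,B_s)$. (i) If $\lambda<\lambda_1$, then $C^l(\Phi_\lambda,0)\cong\delta_{l0}\,\mathbb Z_2$ for all $l\ge 0$, where $\delta$ is the Kronecker delta. (ii) If $\lambda>\lambda_1$, then $C^l(\Phi_\lambda,0)\cong\widetilde H^{l-1}(\widetilde\Psi^\lambda)$ for all $l\ge0$;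 in particular, $C^0(\Phi_\lambda,0)=0$. (iii) If $\lambda_k<\lambda<\lambda_{k+1}$ for some $k\ge1$, then $C^k(\Phi_\lambda,0)\neq0$. In particular, $C^l(\Phi_\lambda,0)$ is nontrivial for some $l$.
   Context: A scaling on a reflexive (real) Banach space $W$ is a continuous map $W\times[0,\infty)\to W$, $(u,t)\mapsto u_t$, such that: $(u_{t_1})_{t_2}=u_{t_1t_2}$ for all $u\in W$, $t_1,t_2\ge0$; $(\tau u)_t=\tau u_t$ for all $u\in W$, $\tau\in\mathbb R$, $t\ge0$; $u_0=0$ and $u_1=u$ for all $u\in W$; $u_t$ is bounded on bounded sets in $W\times[0,\infty)$; and there is $s>0$ (fixed from now on) with $\|u_t\|=O(t^s)$ as $t\to\infty$, uniformly in $u$ on bounded sets. $W^*$ is the dual of $W$. A map $q\in C(W,W^* )$ is a potential operator if $q=Q'$ for some $Q\in C^1(W,\mathbb R)$ (a potential of $q$), normalized by $Q(0)=0$. A scaled operator is an odd potential operator $q\in C(W,W^* )$ that maps bounded sets into bounded sets and satisfies $q(u_t)v_t=t^s q(u)v$ for all $u,v\in W$, $t\ge0$. $\lambda\in\mathbb R$ is an eigenvalue if there is $u\in W\setminus\{0\}$ with $A_s(u)=\lambda B_s(u)$ in $W^*$; $\sigma(A_s,B_s)$ denotes the set of all eigenvalues. $\mathcal M_s=\{u\in W: I_s(u)=1\}$ and $\widetilde\Psi(u)=1/J_s(u)$ for $u\in\mathcal M_s$. Cohomological index (Fadell–Rabinowitz): for a symmetric set $A\subset W\setminus\{0\}$ (i.e.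 $-A=A$), let $\overline A=A/\mathbb Z_2$ be the quotient identifying $u$ and $-u$, let $f:\overline A\to\mathbb{RP}^\infty$ be its classifying map and $f^*:H^*(\mathbb{RP}^\infty)\to H^*(\overline A)$ the induced homomorphism of Alexander–Spanier cohomology rings with $\mathbb Z_2$ coefficients. Then $i(\emptyset)=0$ and, for $A\ne\emptyset$, $i(A)=\sup\{m\ge1: f^*(\omega^{m-1})\ne0\}$, where $\omega\in H^1(\mathbb{RP}^\infty)$ is the generator of $H^*(\mathbb{RP}^\infty)=\mathbb Z_2[\omega]$. Minimax eigenvalues: $\lambda_k=\inf_{M\in\mathcal F_k}\sup_{u\in M}\widetilde\Psi(u)$, where $\mathcal F_k$ is the class of symmetric subsets $M$ of $\mathcal M_s$ with $i(M)\ge k$. Critical groups at the origin: $C^l(\Phi_\lambda,0)=H^l(\Phi_\lambda^0,\Phi_\lambda^0\setminus\{0\})$, $l\ge0$, where $\Phi_\lambda^0=\{u\in W:\Phi_\lambda(u)\le0\}$. Here $H^*$ is (Alexander–Spanier) cohomology with $\mathbb Z_2$ coefficients and $\widetilde H^*$ is the corresponding reduced cohomology. *)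

theory Defs
  imports "HOL-Analysis.Analysis" "HOL-Homology.Homology" "HOL-Library.Z2"
    "HOL-Library.Extended_Nat" "HOL-Library.Extended_Real"
begin

section \<open>Alexander--Spanier cohomology with coefficients in the field of two elements\<close>

text \<open>
  A cochain of degree \<open>p\<close> on \<open>X\<close> is an arbitrary function on the \<open>(p + 1)\<close>-tuples of points of
  \<open>X\<close>; tuples are nonempty lists, and a cochain is extended by \<open>0\<close> to all other lists.  The degree
  is an integer (as for the singular groups of HOL-Homology), and everything vanishes in negative
  degrees.
\<close>

definition as_cochains :: "int \<Rightarrow> 'a topology \<Rightarrow> ('a list \<Rightarrow> bit) set" where
  "as_cochains p X =
     {\<phi>. \<forall>xs. \<phi> xs \<noteq> 0 \<longrightarrow> xs \<noteq> [] \<and> int (length xs) = p + 1 \<and> set xs \<subseteq> topspace X}"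

text \<open>In characteristic two the signs in the coboundary disappear.\<close>

definition as_coboundary :: "'a topology \<Rightarrow> ('a list \<Rightarrow> bit) \<Rightarrow> 'a list \<Rightarrow> bit" where
  "as_coboundary X \<phi> xs =
     (if set xs \<subseteq> topspace X then (\<Sum>i<length xs. \<phi> (take i xs @ drop (Suc i) xs)) else 0)"

text \<open>
  \<open>\<phi>\<close> is locally zero on \<open>Y\<close> if it vanishes on all tuples lying in a single member of some open
  cover of \<open>Y\<close>.  It is applied both to a space and to a subspace; in the latter case it says that
  the restriction of \<open>\<phi>\<close> to the subspace is locally zero.
\<close>

definition as_locally_zero :: "'a topology \<Rightarrow> ('a list \<Rightarrow> bit) \<Rightarrow> bool" where
  "as_locally_zero Y \<phi> \<longleftrightarrow>
     (\<exists>\<U>. (\<forall>U\<in>\<U>. openin Y U) \<and> \<Union>\<U> = topspace Y \<and> (\<forall>U\<in>\<U>. \<forall>xs\<in>lists U. \<phi> xs = 0))"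

text \<open>
  The Alexander--Spanier complex of the pair \<open>(X, S)\<close> is \<open>C(X, S) / C\<^sub>0(X)\<close>, where \<open>C(X, S)\<close> consists
  of the cochains on \<open>X\<close> that are locally zero on \<open>S\<close>, and \<open>C\<^sub>0(X)\<close> of those locally zero on \<open>X\<close>.
  Cocycles and coboundaries of this quotient complex are represented by their preimages in
  \<open>C(X, S)\<close>.
\<close>

definition as_relcochains :: "int \<Rightarrow> 'a topology \<Rightarrow> 'a set \<Rightarrow> ('a list \<Rightarrow> bit) set" where
  "as_relcochains p X S = {\<phi> \<in> as_cochains p X. as_locally_zero (subtopology X S) \<phi>}"

definition as_relcocycles :: "int \<Rightarrow> 'a topology \<Rightarrow> 'a set \<Rightarrow> ('a list \<Rightarrow> bit) set" where
  "as_relcocycles p X S = {\<phi> \<in> as_relcochains p X S. as_locally_zero X (as_coboundary X \<phi>)}"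

definition as_relboundaries :: "int \<Rightarrow> 'a topology \<Rightarrow> 'a set \<Rightarrow> ('a list \<Rightarrow> bit) set" where
  "as_relboundaries p X S =
     {\<phi> \<in> as_cochains p X. \<exists>\<psi> \<in> as_relcochains (p - 1) X S.
        as_locally_zero X (\<lambda>xs. \<phi> xs - as_coboundary X \<psi> xs)}"

definition as_cocycle_group :: "int \<Rightarrow> 'a topology \<Rightarrow> 'a set \<Rightarrow> ('a list \<Rightarrow> bit) monoid" where
  "as_cocycle_group p X S =
     \<lparr>carrier = as_relcocycles p X S, monoid.mult = (\<lambda>\<phi> \<psi> xs. \<phi> xs + \<psi> xs), one = (\<lambda>xs. 0)\<rparr>"

definition as_rel_cohomology :: "int \<Rightarrow> 'a topology \<Rightarrow> 'a set \<Rightarrow> ('a list \<Rightarrow> bit) set monoid" where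
  "as_rel_cohomology p X S = as_cocycle_group p X S Mod as_relboundaries p X S"

abbreviation as_cohomology :: "int \<Rightarrow> 'a topology \<Rightarrow> ('a list \<Rightarrow> bit) set monoid" where
  "as_cohomology p X \<equiv> as_rel_cohomology p X {}"

definition as_class :: "int \<Rightarrow> 'a topology \<Rightarrow> ('a list \<Rightarrow> bit) \<Rightarrow> ('a list \<Rightarrow> bit) set" where
  "as_class p X \<phi> = as_relboundaries p X {} #>\<^bsub>as_cocycle_group p X {}\<^esub> \<phi>"


subsection \<open>Induced maps and reduced cohomology\<close>

definition as_pullback :: "'a topology \<Rightarrow> ('a \<Rightarrow> 'b) \<Rightarrow> ('b list \<Rightarrow> bit) \<Rightarrow> 'a list \<Rightarrow> bit" where
  "as_pullback X f \<phi> xs = (if set xs \<subseteq> topspace X then \<phi> (map f xs) else 0)"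

definition as_induced ::
    "int \<Rightarrow> 'a topology \<Rightarrow> ('a \<Rightarrow> 'b) \<Rightarrow> ('b list \<Rightarrow> bit) set \<Rightarrow> ('a list \<Rightarrow> bit) set" where
  "as_induced p X f a = (\<Union>\<phi>\<in>a. as_class p X (as_pullback X f \<phi>))"

text \<open>
  Reduced cohomology is the cokernel of the map induced by \<open>X \<rightarrow> pt\<close>.  This is the standard notion
  for nonempty \<open>X\<close>; in particular it is trivial in degree \<open>-1\<close>.
\<close>

definition as_reduced_cohomology ::
    "int \<Rightarrow> 'a topology \<Rightarrow> ('a list \<Rightarrow> bit) set set monoid" where
  "as_reduced_cohomology p X =
     as_cohomology p X Mod
       (as_induced p X (\<lambda>x. ()) ` carrier (as_cohomology p (discrete_topology {()})))"


subsection \<open>Cup product\<close>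

text \<open>
  \<open>(\<phi> \<union> \<psi>)(x\<^sub>0, \<dots>, x\<^bsub>p+q\<^esub>) = \<phi>(x\<^sub>0, \<dots>, x\<^sub>p) \<psi>(x\<^sub>p, \<dots>, x\<^bsub>p+q\<^esub>)\<close>, where \<open>p\<close> is the degree of \<open>\<phi>\<close>.
  The degree \<open>q\<close> of \<open>\<psi>\<close> need not be given, since cochains vanish on lists of the wrong length.
\<close>

definition as_cup_cochain ::
    "nat \<Rightarrow> ('a list \<Rightarrow> bit) \<Rightarrow> ('a list \<Rightarrow> bit) \<Rightarrow> 'a list \<Rightarrow> bit" where
  "as_cup_cochain p \<phi> \<psi> xs = \<phi> (take (Suc p) xs) * \<psi> (drop p xs)"

definition as_cup ::
    "nat \<Rightarrow> nat \<Rightarrow> 'a topology \<Rightarrow> ('a list \<Rightarrow> bit) set \<Rightarrow> ('a list \<Rightarrow> bit) set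
       \<Rightarrow> ('a list \<Rightarrow> bit) set" where
  "as_cup p q X a b = (\<Union>\<phi>\<in>a. \<Union>\<psi>\<in>b. as_class (int (p + q)) X (as_cup_cochain p \<phi> \<psi>))"

definition as_unit :: "'a topology \<Rightarrow> ('a list \<Rightarrow> bit) set" where
  "as_unit X = as_class 0 X (\<lambda>xs. if length xs = 1 \<and> set xs \<subseteq> topspace X then 1 else 0)"

text \<open>The \<open>n\<close>-th cup power of a class of degree one.\<close>

primrec as_power :: "'a topology \<Rightarrow> ('a list \<Rightarrow> bit) set \<Rightarrow> nat \<Rightarrow> ('a list \<Rightarrow> bit) set" where
  "as_power X w 0 = as_unit X"
| "as_power X w (Suc n) = as_cup n 1 X (as_power X w n) w"


section \<open>The infinite real projective space\<close>

text \<open>The quotient of a symmetric space by the antipodal action; its points are the orbits.\<close>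

definition antipodal_quotient :: "'a::uminus topology \<Rightarrow> 'a set topology" where
  "antipodal_quotient X =
     topology (\<lambda>V. V \<subseteq> (\<lambda>x. {x, - x}) ` topspace X \<and> openin X {x \<in> topspace X. {x, - x} \<in> V})"

lemma openin_antipodal_quotient:
  "openin (antipodal_quotient X) V \<longleftrightarrow>
     V \<subseteq> (\<lambda>x. {x, - x}) ` topspace X \<and> openin X {x \<in> topspace X. {x, - x} \<in> V}"
proof -
  have "istopology (\<lambda>V. V \<subseteq> (\<lambda>x. {x, - x}) ` topspace X \<and>
                        openin X {x \<in> topspace X. {x, - x} \<in> V})"
    unfolding istopology_def
  proof (intro conjI allI impI)
    fix S T
    assume S: "S \<subseteq> (\<lambda>x. {x, - x}) ` topspace X \<and> openin X {x \<in> topspace X. {x, - x} \<in> S}"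
      and T: "T \<subseteq> (\<lambda>x. {x, - x}) ` topspace X \<and> openin X {x \<in> topspace X. {x, - x} \<in> T}"
    show "S \<inter> T \<subseteq> (\<lambda>x. {x, - x}) ` topspace X" using S by blast
    have "{x \<in> topspace X. {x, - x} \<in> S \<inter> T} =
            {x \<in> topspace X. {x, - x} \<in> S} \<inter> {x \<in> topspace X. {x, - x} \<in> T}" by blast
    then show "openin X {x \<in> topspace X. {x, - x} \<in> S \<inter> T}" using S T by auto
  next
    fix \<K>
    assume K: "\<forall>K\<in>\<K>. K \<subseteq> (\<lambda>x. {x, - x}) ` topspace X \<and> openin X {x \<in> topspace X. {x, - x} \<in> K}"
    show "\<Union>\<K> \<subseteq> (\<lambda>x. {x, - x}) ` topspace X" using K by blast
    have "{x \<in> topspace X. {x, - x} \<in> \<Union>\<K>} = (\<Union>K\<in>\<K>. {x \<in> topspace X. {x, - x} \<in> K})" by blast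
    then show "openin X {x \<in> topspace X. {x, - x} \<in> \<Union>\<K>}" using K by auto
  qed
  then show ?thesis by (simp add: antipodal_quotient_def)
qed

text \<open>
  The infinite sphere is the union of the spheres \<open>nsphere n\<close> (whose points are the unit vectors
  \<open>x :: nat \<Rightarrow> real\<close> with \<open>x i = 0\<close> for \<open>i > n\<close>), with the weak topology.
\<close>

definition infinite_sphere :: "(nat \<Rightarrow> real) topology" where
  "infinite_sphere =
     topology (\<lambda>U. U \<subseteq> (\<Union>n. topspace (nsphere n)) \<and>
                   (\<forall>n. openin (nsphere n) (U \<inter> topspace (nsphere n))))"

lemma openin_infinite_sphere:
  "openin infinite_sphere U \<longleftrightarrow>
     U \<subseteq> (\<Union>n. topspace (nsphere n)) \<and> (\<forall>n. openin (nsphere n) (U \<inter> topspace (nsphere n)))"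
proof -
  have "istopology (\<lambda>U. U \<subseteq> (\<Union>n. topspace (nsphere n)) \<and>
                        (\<forall>n. openin (nsphere n) (U \<inter> topspace (nsphere n))))"
    unfolding istopology_def
  proof (intro conjI allI impI)
    fix S T :: "(nat \<Rightarrow> real) set" and n
    assume S: "S \<subseteq> (\<Union>n. topspace (nsphere n)) \<and>
                 (\<forall>n. openin (nsphere n) (S \<inter> topspace (nsphere n)))"
      and T: "T \<subseteq> (\<Union>n. topspace (nsphere n)) \<and>
                 (\<forall>n. openin (nsphere n) (T \<inter> topspace (nsphere n)))"
    show "S \<inter> T \<subseteq> (\<Union>n. topspace (nsphere n))" using S by blast
    have "S \<inter> T \<inter> topspace (nsphere n) =
            (S \<inter> topspace (nsphere n)) \<inter> (T \<inter> topspace (nsphere n))" by blast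
    then show "openin (nsphere n) (S \<inter> T \<inter> topspace (nsphere n))"
      using S T by (metis openin_Int)
  next
    fix \<K> :: "(nat \<Rightarrow> real) set set" and n
    assume K: "\<forall>K\<in>\<K>. K \<subseteq> (\<Union>n. topspace (nsphere n)) \<and>
                 (\<forall>n. openin (nsphere n) (K \<inter> topspace (nsphere n)))"
    show "\<Union>\<K> \<subseteq> (\<Union>n. topspace (nsphere n))" using K by blast
    have "\<Union>\<K> \<inter> topspace (nsphere n) = (\<Union>K\<in>\<K>. K \<inter> topspace (nsphere n))" by blast
    moreover have "openin (nsphere n) (\<Union>K\<in>\<K>. K \<inter> topspace (nsphere n))"
      using K by (intro openin_Union) blast
    ultimately show "openin (nsphere n) (\<Union>\<K> \<inter> topspace (nsphere n))" by (simp only:)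
  qed
  then show ?thesis by (simp add: infinite_sphere_def)
qed

definition RP_infinity :: "(nat \<Rightarrow> real) set topology" where
  "RP_infinity = antipodal_quotient infinite_sphere"

text \<open>The generator of the cohomology ring: the only nonzero element of degree one.\<close>

definition RP_generator :: "((nat \<Rightarrow> real) set list \<Rightarrow> bit) set" where
  "RP_generator = (THE w. w \<in> carrier (as_cohomology 1 RP_infinity) \<and>
                          w \<noteq> \<one>\<^bsub>as_cohomology 1 RP_infinity\<^esub>)"


section \<open>The cohomological index of Fadell and Rabinowitz\<close>

definition symmetric_set :: "'a::uminus set \<Rightarrow> bool" where
  "symmetric_set A \<longleftrightarrow> uminus ` A = A"

text \<open>
  A classifying map of the double covering \<open>A \<rightarrow> A / \<int>\<^sub>2\<close> is a map of the quotients that is covered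
  by an equivariant map into the infinite sphere.  It is unique up to homotopy only, so that the
  choice in the definition of the index does not matter.
\<close>

definition classifying_map ::
    "'a::real_normed_vector set \<Rightarrow> ('a set \<Rightarrow> (nat \<Rightarrow> real) set) \<Rightarrow> bool" where
  "classifying_map A f \<longleftrightarrow>
     continuous_map (antipodal_quotient (top_of_set A)) RP_infinity f \<and>
     (\<exists>g. continuous_map (top_of_set A) infinite_sphere g \<and>
          (\<forall>u\<in>A. g (- u) = - g u \<and> f {u, - u} = {g u, - g u}))"

definition coh_index :: "'a::real_normed_vector set \<Rightarrow> enat" where
  "coh_index A =
     (if A = {} then 0
      else let f = (SOME f. classifying_map A f); Q = antipodal_quotient (top_of_set A) in
        Sup {enat m | m. m \<ge> 1 \<and>
               as_induced (int (m - 1)) Q f (as_power RP_infinity RP_generator (m - 1))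
                 \<noteq> \<one>\<^bsub>as_cohomology (int (m - 1)) Q\<^esub>})"


section \<open>Scalings and scaled operators\<close>

type_synonym 'a dual = "'a \<Rightarrow>\<^sub>L real"

definition reflexive_space :: "'a::real_normed_vector itself \<Rightarrow> bool" where
  "reflexive_space _ \<longleftrightarrow>
     (\<forall>F :: 'a dual dual. \<exists>x::'a. \<forall>f. blinfun_apply F f = blinfun_apply f x)"

definition weakly_converges :: "(nat \<Rightarrow> 'a::real_normed_vector) \<Rightarrow> 'a \<Rightarrow> bool" where
  "weakly_converges X x \<longleftrightarrow>
     (\<forall>f :: 'a dual. (\<lambda>n. blinfun_apply f (X n)) \<longlonglongrightarrow> blinfun_apply f x)"

text \<open>\<open>sc u t\<close> is the scaled element \<open>u\<^sub>t\<close>; only the values for \<open>t \<ge> 0\<close> are relevant.\<close>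

definition scaling :: "real \<Rightarrow> ('a::real_normed_vector \<Rightarrow> real \<Rightarrow> 'a) \<Rightarrow> bool" where
  "scaling s sc \<longleftrightarrow>
     continuous_on (UNIV \<times> {0..}) (\<lambda>(u, t). sc u t) \<and>
     (\<forall>u. \<forall>t1\<ge>0. \<forall>t2\<ge>0. sc (sc u t1) t2 = sc u (t1 * t2)) \<and>
     (\<forall>u \<tau>. \<forall>t\<ge>0. sc (\<tau> *\<^sub>R u) t = \<tau> *\<^sub>R sc u t) \<and>
     (\<forall>u. sc u 0 = 0 \<and> sc u 1 = u) \<and>
     (\<forall>S \<subseteq> UNIV \<times> {0..}. bounded S \<longrightarrow> bounded ((\<lambda>(u, t). sc u t) ` S)) \<and>
     s > 0 \<and>
     (\<forall>B. bounded B \<longrightarrow> (\<exists>C T. \<forall>u\<in>B. \<forall>t\<ge>T. norm (sc u t) \<le> C * t powr s))"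

text \<open>\<open>Q\<close> is the normalized potential of \<open>q\<close>; it is \<open>C\<^sup>1\<close> as soon as \<open>q\<close> is continuous.\<close>

definition potential_of ::
    "('a::real_normed_vector \<Rightarrow> 'a dual) \<Rightarrow> ('a \<Rightarrow> real) \<Rightarrow> bool" where
  "potential_of q Q \<longleftrightarrow> (\<forall>u. (Q has_derivative blinfun_apply (q u)) (at u)) \<and> Q 0 = 0"

definition potential_operator :: "('a::real_normed_vector \<Rightarrow> 'a dual) \<Rightarrow> bool" where
  "potential_operator q \<longleftrightarrow> continuous_on UNIV q \<and> (\<exists>Q. potential_of q Q)"

definition scaled_operator ::
    "real \<Rightarrow> ('a::real_normed_vector \<Rightarrow> real \<Rightarrow> 'a) \<Rightarrow> ('a \<Rightarrow> 'a dual) \<Rightarrow> bool" where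
  "scaled_operator s sc q \<longleftrightarrow>
     potential_operator q \<and>
     (\<forall>u. q (- u) = - q u) \<and>
     (\<forall>S. bounded S \<longrightarrow> bounded (q ` S)) \<and>
     (\<forall>u v. \<forall>t\<ge>0. blinfun_apply (q (sc u t)) (sc v t) = t powr s * blinfun_apply (q u) v)"


section \<open>Eigenvalues and critical groups\<close>

definition eigenvalues ::
    "('a::real_normed_vector \<Rightarrow> 'a dual) \<Rightarrow> ('a \<Rightarrow> 'a dual) \<Rightarrow> real set" where
  "eigenvalues A B = {lam. \<exists>u. u \<noteq> 0 \<and> A u = lam *\<^sub>R B u}"

definition level_manifold :: "('a \<Rightarrow> real) \<Rightarrow> 'a set" where
  "level_manifold I = {u. I u = 1}"

definition Psi_tilde :: "('a \<Rightarrow> real) \<Rightarrow> 'a \<Rightarrow> real" where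
  "Psi_tilde J u = 1 / J u"

definition Psi_sublevel :: "('a \<Rightarrow> real) \<Rightarrow> ('a \<Rightarrow> real) \<Rightarrow> real \<Rightarrow> 'a set" where
  "Psi_sublevel I J lam = {u \<in> level_manifold I. Psi_tilde J u \<le> lam}"

definition index_class :: "('a::real_normed_vector \<Rightarrow> real) \<Rightarrow> nat \<Rightarrow> 'a set set" where
  "index_class I k = {M. M \<subseteq> level_manifold I \<and> symmetric_set M \<and> enat k \<le> coh_index M}"

text \<open>
  Extended real values: \<open>\<lambda>\<^sub>k = \<infinity>\<close> if there is no set of index at least \<open>k\<close> (which happens for
  \<open>k > dim W\<close>), and the supremum over a single set may be infinite.
\<close>

definition minimax_eigenvalue ::
    "('a::real_normed_vector \<Rightarrow> real) \<Rightarrow> ('a \<Rightarrow> real) \<Rightarrow> nat \<Rightarrow> ereal" where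
  "minimax_eigenvalue I J k = (INF M\<in>index_class I k. SUP u\<in>M. ereal (Psi_tilde J u))"

definition critical_group ::
    "('a::real_normed_vector \<Rightarrow> real) \<Rightarrow> nat \<Rightarrow> ('a list \<Rightarrow> bit) set monoid" where
  "critical_group \<Phi> l =
     as_rel_cohomology (int l) (top_of_set {u. \<Phi> u \<le> 0}) ({u. \<Phi> u \<le> 0} - {0})"

end

theory Submission
  imports Defs
begin

text \<open>
  Write \<open>T\<close> for the sublevel set \<open>\<Psi>\<^sup>\<lambda>\<close> on the level manifold.  The potentials satisfy
  \<open>I(u\<^sub>t) = t\<^sup>s I(u)\<close> and \<open>J(u\<^sub>t) = t\<^sup>s J(u)\<close>, so the set \<open>X\<close> where \<open>I - \<lambda>J \<le> 0\<close> is a cone for the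
  scaling: it contracts to \<open>0\<close> along \<open>u\<^sub>1\<^sub>-\<^sub>t\<close>, and \<open>S = X - {0}\<close> is deformed onto \<open>T\<close> by rescaling each
  \<open>u\<close> to the level \<open>I = 1\<close>.  If \<open>T\<close> is empty then \<open>X = {0}\<close> and the critical groups are the
  cohomology of a point (\<open>critical_group_iso_point\<close>).  Otherwise the long exact sequence of \<open>(X, S)\<close>
  gives \<open>H\<^sup>l(X, S) \<cong> \<H>\<^sup>l\<^sup>-\<^sup>1(T)\<close> with reduced cohomology \<open>\<H>\<close> on the right
  (\<open>rel_cohomology_contractible\<close>, \<open>critical_group_iso_reduced\<close>).  Only the part of the sequence at
  the connecting homomorphism is needed; it is written out on cochains.  The topological input is
  homotopy invariance of Alexander--Spanier cohomology, proved here for metric spaces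
  (\<open>homotopic_cocycles\<close>).

  The index enters through the characteristic class \<open>w\<close> of the double covering \<open>T \<rightarrow> T/\<int>\<^sub>2\<close>.  A
  degree one cochain represents it if its pullback to \<open>T\<close> is locally the coboundary of a function
  that changes by \<open>1\<close> under the antipodal map; this property determines the class and is preserved
  by odd maps (\<open>sheet_cochain_unique\<close>, \<open>sheet_cochain_pullback\<close>).  On \<open>RP\<^sup>\<infinity>\<close> such a cochain
  represents the generator (\<open>RP_generator_eq\<close>), because the infinite sphere is connected and has no
  cohomology in degree one.  Hence the index of \<open>T\<close> is at least \<open>k\<close> exactly if \<open>w\<^sup>k\<^sup>-\<^sup>1 \<noteq> 0\<close>
  (\<open>coh_index_sheet_cochain\<close>), whichever classifying map is used.

  Two facts about \<open>w\<close> finish the proof.  If \<open>w\<^sup>k\<^sup>-\<^sup>1 \<noteq> 0\<close> but \<open>w\<^sup>k = 0\<close>, then \<open>\<H>\<^sup>k\<^sup>-\<^sup>1(T) \<noteq> 0\<close>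
  (\<open>transfer_nontrivial\<close>, the exactness of the Gysin sequence of the covering at one place).  For
  \<open>\<lambda>\<^sub>k < \<lambda> < \<lambda>\<^sub>k\<^sub>+\<^sub>1\<close> the index of \<open>T\<close> is \<open>k\<close> by monotonicity and the definition of the minimax values,
  which is the assertion about gaps between minimax values.  And if \<open>T\<close> is covered by the nonzero sets of \<open>n\<close> odd functions, then \<open>w\<^sup>n = 0\<close>
  (\<open>odd_functions_cup_power_null\<close>, a Lusternik--Schnirelmann argument).  Finitely many of the
  functionals \<open>B(v)\<close> have this covering property, since \<open>T\<close> is bounded and \<open>J\<close> has a
  positive lower bound on it, while \<open>J\<close> tends to \<open>0\<close> along weakly null sequences (\<open>finitely_many_functionals\<close>).  So
  the index of \<open>T\<close> is finite for every \<open>\<lambda>\<close>, and some critical group is nontrivial.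
\<close>

section \<open>Cochain algebra in characteristic two\<close>

text \<open>
  Sums and products in the field of two elements are kept as ring operations; by default the
  simplifier rewrites them to bitwise ones.
\<close>

declare add_bit_eq_xor [simp del] mult_bit_eq_and [simp del]

lemma bit_add_self [simp]: "(a::bit) + a = 0"
  by (cases a) simp_all

lemma bit_add_left_cancel_self [simp]: "(a::bit) + (a + b) = b"
  by (cases a; cases b) simp_all

lemma bit_eq_add_iff: "(a::bit) + b = 0 \<longleftrightarrow> a = b"
  by (cases a; cases b) simp_all

text \<open>
  The coboundary of a cochain on the set of all points, by recursion on the list.  In this form
  \<open>\<delta>\<delta> = 0\<close>, the Leibniz rule and the prism formula become inductions on lists in which no index
  has to be manipulated.
\<close>

primrec cobd :: "('a list \<Rightarrow> bit) \<Rightarrow> 'a list \<Rightarrow> bit" where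
  "cobd \<phi> [] = 0"
| "cobd \<phi> (x # xs) = \<phi> xs + cobd (\<lambda>ys. \<phi> (x # ys)) xs"

declare cobd.simps(2) [simp del]
lemmas cobd_Cons = cobd.simps(2)

lemma cobd_eq_sum: "cobd \<phi> xs = (\<Sum>i<length xs. \<phi> (take i xs @ drop (Suc i) xs))"
proof (induction xs arbitrary: \<phi>)
  case (Cons x xs)
  have "(\<Sum>i<length (x # xs). \<phi> (take i (x # xs) @ drop (Suc i) (x # xs)))
      = \<phi> xs + (\<Sum>i<length xs. \<phi> (x # take i xs @ drop (Suc i) xs))"
    by (simp only: length_Cons sum.lessThan_Suc_shift) simp
  then show ?case by (simp only: cobd_Cons Cons.IH)
qed simp

lemma as_coboundary_eq: "as_coboundary X \<phi> xs = (if set xs \<subseteq> topspace X then cobd \<phi> xs else 0)"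
  by (simp add: as_coboundary_def cobd_eq_sum)

lemma cobd_zero [simp]: "cobd (\<lambda>xs. 0) = (\<lambda>xs. 0)"
proof
  show "cobd (\<lambda>xs. 0) xs = 0" for xs :: "'a list"
    by (induction xs) (auto simp: cobd_Cons)
qed

lemma cobd_add: "cobd (\<lambda>xs. \<phi> xs + \<psi> xs) = (\<lambda>xs. cobd \<phi> xs + cobd \<psi> xs)"
proof
  show "cobd (\<lambda>xs. \<phi> xs + \<psi> xs) xs = cobd \<phi> xs + cobd \<psi> xs" for xs
    by (induction xs arbitrary: \<phi> \<psi>) (simp_all add: cobd_Cons ac_simps)
qed

lemma cobd_cobd [simp]: "cobd (cobd \<phi>) = (\<lambda>xs. 0)"
proof
  show "cobd (cobd \<phi>) xs = 0" for xs
    by (induction xs arbitrary: \<phi>) (simp_all add: cobd_Cons cobd_add)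
qed

lemma cobd_map: "cobd (\<lambda>xs. \<phi> (map f xs)) xs = cobd \<phi> (map f xs)"
  by (induction xs arbitrary: \<phi>) (simp_all add: cobd_Cons)

lemma cobd_cong:
  "(\<And>ys. set ys \<subseteq> set xs \<Longrightarrow> Suc (length ys) = length xs \<Longrightarrow> \<phi> ys = \<psi> ys) \<Longrightarrow> cobd \<phi> xs = cobd \<psi> xs"
proof (induction xs arbitrary: \<phi> \<psi>)
  case (Cons x xs)
  have "cobd (\<lambda>ys. \<phi> (x # ys)) xs = cobd (\<lambda>ys. \<psi> (x # ys)) xs"
    by (rule Cons.IH) (rule Cons.prems, auto)
  moreover have "\<phi> xs = \<psi> xs" by (rule Cons.prems) auto
  ultimately show ?case by (simp add: cobd_Cons)
qed simp

lemma cobd_eq_0: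
  "(\<And>ys. set ys \<subseteq> set xs \<Longrightarrow> Suc (length ys) = length xs \<Longrightarrow> \<phi> ys = 0) \<Longrightarrow> cobd \<phi> xs = 0"
  using cobd_cong[of xs \<phi> "\<lambda>_. 0"] by simp

lemma cobd_const: "cobd (\<lambda>ys. c) xs = (if odd (length xs) then c else 0)"
  by (induction xs) (auto simp: cobd_Cons)

subsection \<open>The Leibniz rule\<close>

lemma cobd_scale: "cobd (\<lambda>xs. c * \<phi> xs) xs = c * cobd \<phi> xs"
  by (induction xs arbitrary: \<phi>) (simp_all add: cobd_Cons algebra_simps)

text \<open>
  Below length \<open>p + 2\<close> the front face in \<open>\<delta>\<phi>\<close> would be cut off, hence the bound; both sides
  vanish there if \<open>\<phi>\<close> has degree \<open>p\<close> and \<open>\<psi> [] = 0\<close>.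
\<close>

lemma cobd_cup:
  "length xs \<ge> p + 2 \<Longrightarrow>
   cobd (as_cup_cochain p \<phi> \<psi>) xs
     = as_cup_cochain (Suc p) (cobd \<phi>) \<psi> xs + as_cup_cochain p \<phi> (cobd \<psi>) xs"
proof (induction p arbitrary: \<phi> xs)
  case 0
  then obtain x y zs where xs: "xs = x # y # zs"
    by (metis One_nat_def Suc_le_length_iff add_2_eq_Suc' numeral_2_eq_2)
  have "(\<lambda>ys. as_cup_cochain 0 \<phi> \<psi> (x # ys)) = (\<lambda>ys. \<phi> [x] * \<psi> (x # ys))"
    by (simp add: as_cup_cochain_def)
  then show ?case
    by (simp add: xs cobd_Cons[of _ x] cobd_scale as_cup_cochain_def cobd_Cons[of _ y "[]"] algebra_simps)
next
  case (Suc p)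
  then obtain x ys where xs: "xs = x # ys" and len: "length ys \<ge> p + 2"
    by (cases xs) auto
  have eq: "(\<lambda>zs. as_cup_cochain (Suc p) \<phi> \<psi> (x # zs)) = as_cup_cochain p (\<lambda>zs. \<phi> (x # zs)) \<psi>"
    by (auto simp: as_cup_cochain_def)
  show ?case
    unfolding xs cobd_Cons[of _ x] eq Suc.IH[OF len]
    by (simp add: as_cup_cochain_def cobd_Cons algebra_simps)
qed

subsection \<open>Prism operators\<close>

text \<open>
  The usual sum over the simplices \<open>(f x\<^sub>0, \<dots>, f x\<^sub>j, g x\<^sub>j, \<dots>, g x\<^sub>p)\<close> that triangulate a prism.
\<close>

primrec prism :: "('a \<Rightarrow> 'b) \<Rightarrow> ('a \<Rightarrow> 'b) \<Rightarrow> ('b list \<Rightarrow> bit) \<Rightarrow> 'a list \<Rightarrow> bit" where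
  "prism f g \<phi> [] = 0"
| "prism f g \<phi> (x # xs) = \<phi> (f x # g x # map g xs) + prism f g (\<lambda>ys. \<phi> (f x # ys)) xs"

lemma prism_add: "prism f g (\<lambda>ys. \<phi> ys + \<psi> ys) xs = prism f g \<phi> xs + prism f g \<psi> xs"
  by (induction xs arbitrary: \<phi> \<psi>) (simp_all add: ac_simps)

lemma prism_homotopy:
  "cobd (prism f g \<phi>) xs + prism f g (cobd \<phi>) xs = \<phi> (map f xs) + \<phi> (map g xs)"
proof (induction xs arbitrary: \<phi>)
  case (Cons x xs)
  have IH: "cobd (prism f g (\<lambda>ys. \<phi> (f x # ys))) xs + prism f g (cobd (\<lambda>ys. \<phi> (f x # ys))) xs
      = \<phi> (f x # map f xs) + \<phi> (f x # map g xs)"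
    by (rule Cons.IH)
  then have IH': "cobd (prism f g (\<lambda>ys. \<phi> (f x # ys))) xs =
      prism f g (cobd (\<lambda>ys. \<phi> (f x # ys))) xs + (\<phi> (f x # map f xs) + \<phi> (f x # map g xs))"
    by (metis bit_add_left_cancel_self add.commute)
  have "cobd (\<lambda>ys. \<phi> (f x # g x # map g ys)) xs = cobd (\<lambda>ys. \<phi> (f x # g x # ys)) (map g xs)"
    using cobd_map[of "\<lambda>ys. \<phi> (f x # g x # ys)" g xs] by simp
  then show ?case
    by (simp add: cobd_Cons cobd_add prism_add IH' ac_simps)
qed simp

lemma prism_eq_0:
  "(\<And>ys. set ys \<subseteq> f ` set xs \<union> g ` set xs \<Longrightarrow> length ys = Suc (length xs) \<Longrightarrow> \<phi> ys = 0)
    \<Longrightarrow> prism f g \<phi> xs = 0"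
proof (induction xs arbitrary: \<phi>)
  case (Cons x xs)
  have "prism f g (\<lambda>ys. \<phi> (f x # ys)) xs = 0"
    by (rule Cons.IH) (rule Cons.prems, auto)
  moreover have "\<phi> (f x # g x # map g xs) = 0" by (rule Cons.prems) auto
  ultimately show ?case by simp
qed simp

lemma prism_cong:
  "(\<And>x. x \<in> set xs \<Longrightarrow> f x = f' x \<and> g x = g' x) \<Longrightarrow> prism f g \<phi> xs = prism f' g' \<phi> xs"
proof (induction xs arbitrary: \<phi>)
  case (Cons x xs)
  have "map g xs = map g' xs" "f x = f' x" "g x = g' x" using Cons.prems by auto
  moreover have "prism f g (\<lambda>ys. \<phi> (f' x # ys)) xs = prism f' g' (\<lambda>ys. \<phi> (f' x # ys)) xs"
    by (rule Cons.IH) (use Cons.prems in auto)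
  ultimately show ?case by (simp only: prism.simps)
qed simp

section \<open>Locally zero cochains\<close>

lemma as_locally_zero_iff:
  "as_locally_zero X \<phi> \<longleftrightarrow>
     (\<forall>x\<in>topspace X. \<exists>U. openin X U \<and> x \<in> U \<and> (\<forall>xs. set xs \<subseteq> U \<longrightarrow> \<phi> xs = 0))"
proof -
  have lz: "as_locally_zero X \<phi> \<longleftrightarrow>
      (\<exists>\<U>. (\<forall>U\<in>\<U>. openin X U \<and> (\<forall>xs. set xs \<subseteq> U \<longrightarrow> \<phi> xs = 0)) \<and> \<Union>\<U> = topspace X)"
    unfolding as_locally_zero_def lists_eq_set by (intro ex_cong1) auto
  show ?thesis
  proof
    assume "as_locally_zero X \<phi>"
    then show "\<forall>x\<in>topspace X. \<exists>U. openin X U \<and> x \<in> U \<and> (\<forall>xs. set xs \<subseteq> U \<longrightarrow> \<phi> xs = 0)"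
      unfolding lz by (metis UnionE)
  next
    assume R: "\<forall>x\<in>topspace X. \<exists>U. openin X U \<and> x \<in> U \<and> (\<forall>xs. set xs \<subseteq> U \<longrightarrow> \<phi> xs = 0)"
    let ?\<U> = "{U. openin X U \<and> (\<forall>xs. set xs \<subseteq> U \<longrightarrow> \<phi> xs = 0)}"
    have "\<Union>?\<U> = topspace X" using R openin_subset by fast
    then show "as_locally_zero X \<phi>" unfolding lz by (intro exI[of _ ?\<U>]) blast
  qed
qed

lemma as_locally_zeroE:
  assumes "as_locally_zero X \<phi>" "x \<in> topspace X"
  obtains U where "openin X U" "x \<in> U" "\<And>xs. set xs \<subseteq> U \<Longrightarrow> \<phi> xs = 0"
  using assms unfolding as_locally_zero_iff by blast

text \<open>
  The workhorse for transferring local vanishing: the covering stays the same, and only a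
  statement about a single member of it has to be checked.
\<close>

lemma as_locally_zero_mono:
  assumes "as_locally_zero X \<phi>"
    and "\<And>U xs. U \<subseteq> topspace X \<Longrightarrow> \<forall>ys. set ys \<subseteq> U \<longrightarrow> \<phi> ys = 0 \<Longrightarrow> set xs \<subseteq> U \<Longrightarrow> \<psi> xs = 0"
  shows "as_locally_zero X \<psi>"
  using assms unfolding as_locally_zero_iff by (meson openin_subset)

lemma as_locally_zero_cong:
  assumes "\<And>xs. set xs \<subseteq> topspace X \<Longrightarrow> \<phi> xs = \<psi> xs"
  shows "as_locally_zero X \<phi> = as_locally_zero X \<psi>"
proof -
  have "as_locally_zero X \<psi>" if "as_locally_zero X \<phi>"
      "\<And>xs. set xs \<subseteq> topspace X \<Longrightarrow> \<phi> xs = \<psi> xs" for \<phi> \<psi>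
    using that(1) by (rule as_locally_zero_mono) (metis that(2) subset_trans)
  from this[of \<phi> \<psi>] this[of \<psi> \<phi>] show ?thesis using assms by metis
qed

lemma as_locally_zero_0 [simp]: "as_locally_zero X (\<lambda>xs. 0)"
  unfolding as_locally_zero_iff by auto

lemma as_locally_zero_trivial_topology [simp]: "as_locally_zero trivial_topology \<phi>"
  unfolding as_locally_zero_iff by auto

lemma as_locally_zero_add:
  assumes "as_locally_zero X \<phi>" "as_locally_zero X \<psi>"
  shows "as_locally_zero X (\<lambda>xs. \<phi> xs + \<psi> xs)"
  unfolding as_locally_zero_iff
proof
  fix x assume x: "x \<in> topspace X"
  obtain U where "openin X U" "x \<in> U" "\<And>xs. set xs \<subseteq> U \<Longrightarrow> \<phi> xs = 0"
    using as_locally_zeroE[OF assms(1) x] by metis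
  moreover obtain V where "openin X V" "x \<in> V" "\<And>xs. set xs \<subseteq> V \<Longrightarrow> \<psi> xs = 0"
    using as_locally_zeroE[OF assms(2) x] by metis
  ultimately show "\<exists>U. openin X U \<and> x \<in> U \<and> (\<forall>xs. set xs \<subseteq> U \<longrightarrow> \<phi> xs + \<psi> xs = 0)"
    by (intro exI[of _ "U \<inter> V"]) auto
qed

lemma as_locally_zero_cobd: "as_locally_zero X \<phi> \<Longrightarrow> as_locally_zero X (cobd \<phi>)"
  by (rule as_locally_zero_mono, assumption) (rule cobd_eq_0, metis subset_trans)

lemma as_locally_zero_cup:
  assumes "as_locally_zero X \<phi> \<or> as_locally_zero X \<psi>"
  shows "as_locally_zero X (as_cup_cochain p \<phi> \<psi>)"
proof -
  have *: "set (take n xs) \<subseteq> U" "set (drop n xs) \<subseteq> U" if "set xs \<subseteq> U" for n U and xs :: "'a list"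
    using that set_take_subset set_drop_subset by fastforce+
  show ?thesis
    using assms
  proof
    assume "as_locally_zero X \<phi>"
    then show ?thesis
      by (rule as_locally_zero_mono) (use * in \<open>auto simp: as_cup_cochain_def\<close>)
  next
    assume "as_locally_zero X \<psi>"
    then show ?thesis
      by (rule as_locally_zero_mono) (use * in \<open>auto simp: as_cup_cochain_def\<close>)
  qed
qed

lemma as_locally_zero_map:
  assumes "as_locally_zero Y \<phi>" "continuous_map X Y f"
  shows "as_locally_zero X (\<lambda>xs. \<phi> (map f xs))"
  unfolding as_locally_zero_iff
proof
  fix x assume x: "x \<in> topspace X"
  then have "f x \<in> topspace Y" using assms(2) continuous_map_image_subset_topspace by blast
  then obtain V where V: "openin Y V" "f x \<in> V" "\<And>xs. set xs \<subseteq> V \<Longrightarrow> \<phi> xs = 0"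
    using as_locally_zeroE[OF assms(1)] by metis
  let ?U = "{x \<in> topspace X. f x \<in> V}"
  have "openin X ?U" using V assms(2) by (simp add: continuous_map)
  moreover have "\<phi> (map f xs) = 0" if "set xs \<subseteq> ?U" for xs
    by (rule V(3)) (use that in auto)
  ultimately show "\<exists>U. openin X U \<and> x \<in> U \<and> (\<forall>xs. set xs \<subseteq> U \<longrightarrow> \<phi> (map f xs) = 0)"
    using x V(2) by (intro exI[of _ ?U]) auto
qed

lemma as_locally_zero_subtopology:
  "as_locally_zero X \<phi> \<Longrightarrow> as_locally_zero (subtopology X S) \<phi>"
  using as_locally_zero_map[of X \<phi> "subtopology X S" id] by simp

section \<open>Cohomologically trivial cochains\<close>

text \<open>
  Being a coboundary modulo locally zero cochains does not depend on the degrees of the cochains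
  involved, nor on their values outside the space, so the two predicates below ignore both.  The
  value of a cochain at the empty list is that of an augmentation: allowing it to be nonzero makes
  the constant functions coboundaries, which is what passes to reduced cohomology.
\<close>

definition null_cochain :: "'a topology \<Rightarrow> ('a list \<Rightarrow> bit) \<Rightarrow> bool" where
  "null_cochain X \<phi> \<longleftrightarrow> (\<exists>\<psi>. \<psi> [] = 0 \<and> as_locally_zero X (\<lambda>xs. \<phi> xs + cobd \<psi> xs))"

definition reduced_null :: "'a topology \<Rightarrow> ('a list \<Rightarrow> bit) \<Rightarrow> bool" where
  "reduced_null X \<phi> \<longleftrightarrow> (\<exists>\<psi>. as_locally_zero X (\<lambda>xs. \<phi> xs + cobd \<psi> xs))"

lemma null_imp_reduced_null: "null_cochain X \<phi> \<Longrightarrow> reduced_null X \<phi>"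
  by (auto simp: null_cochain_def reduced_null_def)

lemma null_cochain_locally_zero: "as_locally_zero X \<phi> \<Longrightarrow> null_cochain X \<phi>"
  unfolding null_cochain_def by (rule exI[of _ "\<lambda>_. 0"]) simp

lemma null_cochain_cobd: "\<psi> [] = 0 \<Longrightarrow> null_cochain X (cobd \<psi>)"
  unfolding null_cochain_def by (rule exI[of _ \<psi>]) simp

lemma null_cochain_cong:
  assumes "\<And>xs. set xs \<subseteq> topspace X \<Longrightarrow> \<phi> xs = \<psi> xs"
  shows "null_cochain X \<phi> = null_cochain X \<psi>"
proof -
  have "as_locally_zero X (\<lambda>xs. \<phi> xs + cobd \<rho> xs) = as_locally_zero X (\<lambda>xs. \<psi> xs + cobd \<rho> xs)" for \<rho>
    by (rule as_locally_zero_cong) (simp add: assms)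
  then show ?thesis by (simp add: null_cochain_def)
qed

lemma null_cochain_add:
  assumes "null_cochain X \<phi>" "null_cochain X \<psi>"
  shows "null_cochain X (\<lambda>xs. \<phi> xs + \<psi> xs)"
proof -
  from assms obtain \<alpha> \<beta> where "\<alpha> [] = 0" "\<beta> [] = 0"
    "as_locally_zero X (\<lambda>xs. \<phi> xs + cobd \<alpha> xs)" "as_locally_zero X (\<lambda>xs. \<psi> xs + cobd \<beta> xs)"
    by (auto simp: null_cochain_def)
  then show ?thesis
    unfolding null_cochain_def
    by (intro exI[of _ "\<lambda>xs. \<alpha> xs + \<beta> xs"])
       (auto dest: as_locally_zero_add simp: cobd_add ac_simps)
qed

lemma null_cochain_add_cancel:
  assumes "null_cochain X (\<lambda>xs. \<phi> xs + \<psi> xs)"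
  shows "null_cochain X \<phi> \<longleftrightarrow> null_cochain X \<psi>"
  using null_cochain_add[OF assms, of \<phi>] null_cochain_add[OF assms, of \<psi>]
  by (auto simp: ac_simps)

lemma null_cochain_map:
  assumes "null_cochain Y \<phi>" "continuous_map X Y f"
  shows "null_cochain X (\<lambda>xs. \<phi> (map f xs))"
proof -
  from assms obtain \<alpha> where "\<alpha> [] = 0" "as_locally_zero Y (\<lambda>xs. \<phi> xs + cobd \<alpha> xs)"
    by (auto simp: null_cochain_def)
  then show ?thesis
    using as_locally_zero_map[OF _ assms(2)] unfolding null_cochain_def
    by (intro exI[of _ "\<lambda>xs. \<alpha> (map f xs)"]) (fastforce simp: cobd_map)
qed

lemma reduced_null_map:
  assumes "reduced_null Y \<phi>" "continuous_map X Y f"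
  shows "reduced_null X (\<lambda>xs. \<phi> (map f xs))"
proof -
  from assms obtain \<alpha> where "as_locally_zero Y (\<lambda>xs. \<phi> xs + cobd \<alpha> xs)"
    by (auto simp: reduced_null_def)
  then show ?thesis
    using as_locally_zero_map[OF _ assms(2)] unfolding reduced_null_def
    by (intro exI[of _ "\<lambda>xs. \<alpha> (map f xs)"]) (fastforce simp: cobd_map)
qed

lemma reduced_null_add_left:
  assumes "as_locally_zero X (\<lambda>xs. \<phi> xs + \<psi> xs)" "reduced_null X \<psi>"
  shows "reduced_null X \<phi>"
proof -
  from assms(2) obtain \<alpha> where "as_locally_zero X (\<lambda>xs. \<psi> xs + cobd \<alpha> xs)"
    by (auto simp: reduced_null_def)
  from as_locally_zero_add[OF assms(1) this] show ?thesis
    unfolding reduced_null_def by (intro exI[of _ \<alpha>]) (simp add: ac_simps)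
qed

text \<open>
  Brings a function into the prescribed degree and space, so that degree-free arguments yield
  honest cochains.
\<close>

definition truncate_cochain :: "int \<Rightarrow> 'a topology \<Rightarrow> ('a list \<Rightarrow> bit) \<Rightarrow> 'a list \<Rightarrow> bit" where
  "truncate_cochain p X \<psi> xs =
     (if xs \<noteq> [] \<and> int (length xs) = p + 1 \<and> set xs \<subseteq> topspace X then \<psi> xs else 0)"

lemma truncate_cochain_in: "truncate_cochain p X \<psi> \<in> as_cochains p X"
  by (auto simp: truncate_cochain_def as_cochains_def)

lemma truncate_cochain_Nil [simp]: "truncate_cochain p X \<psi> [] = 0"
  by (simp add: truncate_cochain_def)

lemma as_locally_zero_truncate:
  "as_locally_zero Y \<psi> \<Longrightarrow> as_locally_zero Y (truncate_cochain p X \<psi>)"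
  by (erule as_locally_zero_mono) (auto simp: truncate_cochain_def)

lemma as_cochains_wrong_length: "\<phi> \<in> as_cochains p X \<Longrightarrow> int (length xs) \<noteq> p + 1 \<Longrightarrow> \<phi> xs = 0"
  unfolding as_cochains_def by blast

lemma as_cochains_Nil: "\<phi> \<in> as_cochains p X \<Longrightarrow> \<phi> [] = 0"
  unfolding as_cochains_def by blast

lemma as_cochains_outside: "\<phi> \<in> as_cochains p X \<Longrightarrow> \<not> set xs \<subseteq> topspace X \<Longrightarrow> \<phi> xs = 0"
  unfolding as_cochains_def by blast

lemma as_cochains_add:
  "\<phi> \<in> as_cochains p X \<Longrightarrow> \<psi> \<in> as_cochains p X \<Longrightarrow> (\<lambda>xs. \<phi> xs + \<psi> xs) \<in> as_cochains p X"
  unfolding as_cochains_def mem_Collect_eq by (metis add.right_neutral)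

lemma as_cochains_0 [simp]: "(\<lambda>xs. 0) \<in> as_cochains p X"
  by (simp add: as_cochains_def)

lemma as_cochains_neg:
  assumes "p < 0" and p: "\<phi> \<in> as_cochains p X"
  shows "\<phi> = (\<lambda>xs. 0)"
proof
  fix xs :: "'a list"
  from assms(1) have "xs \<noteq> [] \<Longrightarrow> int (length xs) \<noteq> p + 1"
    by (cases xs) auto
  with p show "\<phi> xs = 0" unfolding as_cochains_def mem_Collect_eq by blast
qed

lemma cobd_truncate:
  assumes "set xs \<subseteq> topspace X" "\<psi> [] = 0"
  shows "cobd (truncate_cochain (p - 1) X \<psi>) xs = (if int (length xs) = p + 1 then cobd \<psi> xs else 0)"
proof (cases "int (length xs) = p + 1")
  case True
  have "cobd (truncate_cochain (p - 1) X \<psi>) xs = cobd \<psi> xs"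
  proof (rule cobd_cong)
    fix ys assume "set ys \<subseteq> set xs" "Suc (length ys) = length xs"
    then show "truncate_cochain (p - 1) X \<psi> ys = \<psi> ys"
      using True assms by (cases "ys = []") (auto simp: truncate_cochain_def)
  qed
  with True show ?thesis by simp
next
  case False
  then have "cobd (truncate_cochain (p - 1) X \<psi>) xs = 0"
    by (intro cobd_eq_0) (auto simp: truncate_cochain_def)
  with False show ?thesis by simp
qed

lemma as_locally_zero_add_cobd_truncate:
  assumes "\<phi> \<in> as_cochains p X" "\<psi> [] = 0" "as_locally_zero X (\<lambda>xs. \<phi> xs + cobd \<psi> xs)"
  shows "as_locally_zero X (\<lambda>xs. \<phi> xs + cobd (truncate_cochain (p - 1) X \<psi>) xs)"
  using assms(3)
proof (rule as_locally_zero_mono)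
  fix U xs assume U: "U \<subseteq> topspace X" "\<forall>ys. set ys \<subseteq> U \<longrightarrow> \<phi> ys + cobd \<psi> ys = 0" and xs: "set xs \<subseteq> U"
  then have "set xs \<subseteq> topspace X" by auto
  from cobd_truncate[of xs X \<psi> p, OF this assms(2)] U(2) xs assms(1)
  show "\<phi> xs + cobd (truncate_cochain (p - 1) X \<psi>) xs = 0"
    by (auto simp: as_cochains_wrong_length)
qed

section \<open>The cohomology groups\<close>

lemma as_locally_zero_coboundary [simp]:
  "as_locally_zero X (as_coboundary X \<phi>) = as_locally_zero X (cobd \<phi>)"
  by (rule as_locally_zero_cong) (simp add: as_coboundary_eq)

lemma as_coboundary_in_cochains: "\<phi> \<in> as_cochains p X \<Longrightarrow> as_coboundary X \<phi> \<in> as_cochains (p + 1) X"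
proof -
  assume p: "\<phi> \<in> as_cochains p X"
  show ?thesis
    unfolding as_cochains_def mem_Collect_eq
  proof (intro allI impI)
    fix xs assume n: "as_coboundary X \<phi> xs \<noteq> 0"
    then have s: "set xs \<subseteq> topspace X" and c: "cobd \<phi> xs \<noteq> 0" by (auto simp: as_coboundary_eq split: if_splits)
    from c have "xs \<noteq> []" by auto
    moreover have "int (length xs) = p + 1 + 1"
    proof (rule ccontr)
      assume "int (length xs) \<noteq> p + 1 + 1"
      then have "cobd \<phi> xs = 0"
        by (intro cobd_eq_0 as_cochains_wrong_length[OF p]) auto
      with c show False by simp
    qed
    ultimately show "xs \<noteq> [] \<and> int (length xs) = p + 1 + 1 \<and> set xs \<subseteq> topspace X" using s by blast
  qed
qed

lemma mem_as_relcocycles: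
  "\<phi> \<in> as_relcocycles p X S \<longleftrightarrow>
     \<phi> \<in> as_cochains p X \<and> as_locally_zero (subtopology X S) \<phi> \<and> as_locally_zero X (cobd \<phi>)"
  by (auto simp: as_relcocycles_def as_relcochains_def)

lemma mem_as_relcocycles_empty:
  "\<phi> \<in> as_relcocycles p X {} \<longleftrightarrow> \<phi> \<in> as_cochains p X \<and> as_locally_zero X (cobd \<phi>)"
  by (auto simp: mem_as_relcocycles as_locally_zero_iff)

text \<open>
  The degree condition on the cobounding cochain \<open>\<psi>\<close> costs nothing, because \<open>\<psi>\<close> can be truncated;
  only its value at the empty list matters.
\<close>

lemma mem_as_relboundaries:
  "\<phi> \<in> as_relboundaries p X S \<longleftrightarrow>
     \<phi> \<in> as_cochains p X \<and>
     (\<exists>\<psi>. \<psi> [] = 0 \<and> as_locally_zero (subtopology X S) \<psi> \<and> as_locally_zero X (\<lambda>xs. \<phi> xs + cobd \<psi> xs))"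
proof -
  have eq: "as_locally_zero X (\<lambda>xs. \<phi> xs - as_coboundary X \<psi> xs) = as_locally_zero X (\<lambda>xs. \<phi> xs + cobd \<psi> xs)" for \<psi>
    by (rule as_locally_zero_cong) (simp add: as_coboundary_eq)
  show ?thesis
    unfolding as_relboundaries_def mem_Collect_eq eq
  proof (intro conj_cong refl iffI)
    assume "\<exists>\<psi>\<in>as_relcochains (p - 1) X S. as_locally_zero X (\<lambda>xs. \<phi> xs + cobd \<psi> xs)"
    then show "\<exists>\<psi>. \<psi> [] = 0 \<and> as_locally_zero (subtopology X S) \<psi> \<and> as_locally_zero X (\<lambda>xs. \<phi> xs + cobd \<psi> xs)"
      using as_cochains_Nil unfolding as_relcochains_def by blast
  next
    assume \<phi>: "\<phi> \<in> as_cochains p X"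
    assume "\<exists>\<psi>. \<psi> [] = 0 \<and> as_locally_zero (subtopology X S) \<psi> \<and> as_locally_zero X (\<lambda>xs. \<phi> xs + cobd \<psi> xs)"
    then obtain \<psi> where \<psi>: "\<psi> [] = 0" "as_locally_zero (subtopology X S) \<psi>"
      "as_locally_zero X (\<lambda>xs. \<phi> xs + cobd \<psi> xs)" by blast
    show "\<exists>\<psi>\<in>as_relcochains (p - 1) X S. as_locally_zero X (\<lambda>xs. \<phi> xs + cobd \<psi> xs)"
    proof
      show "truncate_cochain (p - 1) X \<psi> \<in> as_relcochains (p - 1) X S"
        using \<psi>(2) by (simp add: as_relcochains_def truncate_cochain_in as_locally_zero_truncate)
    qed (rule as_locally_zero_add_cobd_truncate[OF \<phi> \<psi>(1,3)])
  qed
qed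

lemma mem_as_relboundaries_empty:
  "\<phi> \<in> as_relboundaries p X {} \<longleftrightarrow> \<phi> \<in> as_cochains p X \<and> null_cochain X \<phi>"
  unfolding mem_as_relboundaries null_cochain_def by simp

lemma as_cocycle_group_simps [simp]:
  "carrier (as_cocycle_group p X S) = as_relcocycles p X S"
  "\<phi> \<otimes>\<^bsub>as_cocycle_group p X S\<^esub> \<psi> = (\<lambda>xs. \<phi> xs + \<psi> xs)"
  "\<one>\<^bsub>as_cocycle_group p X S\<^esub> = (\<lambda>xs. 0)"
  by (simp_all add: as_cocycle_group_def)

lemma as_relcocycles_add:
  "\<phi> \<in> as_relcocycles p X S \<Longrightarrow> \<psi> \<in> as_relcocycles p X S \<Longrightarrow> (\<lambda>xs. \<phi> xs + \<psi> xs) \<in> as_relcocycles p X S"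
  by (auto simp: mem_as_relcocycles as_cochains_add as_locally_zero_add cobd_add)

lemma as_relcocycles_0: "(\<lambda>xs. 0) \<in> as_relcocycles p X S"
  by (simp add: mem_as_relcocycles)

lemma comm_group_as_cocycle_group: "comm_group (as_cocycle_group p X S)"
proof (rule comm_groupI)
  fix \<phi> assume "\<phi> \<in> carrier (as_cocycle_group p X S)"
  then show "\<exists>\<psi>\<in>carrier (as_cocycle_group p X S). \<psi> \<otimes>\<^bsub>as_cocycle_group p X S\<^esub> \<phi> = \<one>\<^bsub>as_cocycle_group p X S\<^esub>"
    by (intro bexI[of _ \<phi>]) auto
qed (auto simp: as_relcocycles_add as_relcocycles_0 ac_simps)

lemma inv_as_cocycle_group:
  "\<phi> \<in> as_relcocycles p X S \<Longrightarrow> inv\<^bsub>as_cocycle_group p X S\<^esub> \<phi> = \<phi>"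
  by (rule group.inv_equality) (auto simp: comm_group.axioms(2)[OF comm_group_as_cocycle_group])

lemma as_relboundaries_subset: "as_relboundaries p X S \<subseteq> as_relcocycles p X S"
proof
  fix \<phi> assume "\<phi> \<in> as_relboundaries p X S"
  then obtain \<psi> where p: "\<phi> \<in> as_cochains p X" and S: "as_locally_zero (subtopology X S) \<psi>"
    and lz: "as_locally_zero X (\<lambda>xs. \<phi> xs + cobd \<psi> xs)"
    by (auto simp: mem_as_relboundaries)
  from as_locally_zero_cobd[OF lz] have "as_locally_zero X (cobd \<phi>)" by (simp add: cobd_add)
  moreover from as_locally_zero_add[OF as_locally_zero_subtopology[OF lz] as_locally_zero_cobd[OF S]]
  have "as_locally_zero (subtopology X S) \<phi>" by (simp add: add.assoc)
  ultimately show "\<phi> \<in> as_relcocycles p X S" using p by (simp add: mem_as_relcocycles)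
qed

lemma as_relboundaries_add:
  assumes "\<phi> \<in> as_relboundaries p X S" "\<psi> \<in> as_relboundaries p X S"
  shows "(\<lambda>xs. \<phi> xs + \<psi> xs) \<in> as_relboundaries p X S"
proof -
  from assms obtain \<alpha> \<beta> where ab: "\<alpha> [] = 0" "\<beta> [] = 0"
    "as_locally_zero (subtopology X S) \<alpha>" "as_locally_zero (subtopology X S) \<beta>"
    "as_locally_zero X (\<lambda>xs. \<phi> xs + cobd \<alpha> xs)" "as_locally_zero X (\<lambda>xs. \<psi> xs + cobd \<beta> xs)"
    by (auto simp: mem_as_relboundaries)
  from as_locally_zero_add[OF ab(5,6)]
  have "as_locally_zero X (\<lambda>xs. \<phi> xs + \<psi> xs + cobd (\<lambda>xs. \<alpha> xs + \<beta> xs) xs)"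
    by (simp add: cobd_add ac_simps)
  with ab as_locally_zero_add[OF ab(3,4)] assms show ?thesis
    unfolding mem_as_relboundaries
    by (intro conjI exI[of _ "\<lambda>xs. \<alpha> xs + \<beta> xs"]) (auto simp: as_cochains_add)
qed

lemma normal_as_relboundaries: "as_relboundaries p X S \<lhd> as_cocycle_group p X S"
proof -
  interpret comm_group "as_cocycle_group p X S" by (rule comm_group_as_cocycle_group)
  have "subgroup (as_relboundaries p X S) (as_cocycle_group p X S)"
  proof (rule subgroupI)
    have "(\<lambda>xs. 0) \<in> as_relboundaries p X S"
      unfolding mem_as_relboundaries by (intro conjI exI[of _ "\<lambda>_. 0"]) auto
    then show "as_relboundaries p X S \<noteq> {}" by blast
    show "inv\<^bsub>as_cocycle_group p X S\<^esub> \<phi> \<in> as_relboundaries p X S" if "\<phi> \<in> as_relboundaries p X S" for \<phi>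
      using that inv_as_cocycle_group as_relboundaries_subset by (metis subsetD)
  qed (auto simp: as_relboundaries_add dest: subsetD[OF as_relboundaries_subset])
  then show ?thesis by (rule subgroup_imp_normal)
qed

definition rel_class :: "int \<Rightarrow> 'a topology \<Rightarrow> 'a set \<Rightarrow> ('a list \<Rightarrow> bit) \<Rightarrow> ('a list \<Rightarrow> bit) set" where
  "rel_class p X S \<phi> = as_relboundaries p X S #>\<^bsub>as_cocycle_group p X S\<^esub> \<phi>"

lemma as_class_eq: "as_class p X = rel_class p X {}"
  by (simp add: fun_eq_iff as_class_def rel_class_def)

lemma carrier_as_rel_cohomology:
  "carrier (as_rel_cohomology p X S) = rel_class p X S ` as_relcocycles p X S"
  by (simp add: as_rel_cohomology_def carrier_FactGroup rel_class_def[abs_def])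

lemma rel_class_hom: "rel_class p X S \<in> hom (as_cocycle_group p X S) (as_rel_cohomology p X S)"
  using normal.r_coset_hom_Mod[OF normal_as_relboundaries, of p X S]
  by (simp add: rel_class_def[abs_def] as_rel_cohomology_def)

lemma comm_group_as_rel_cohomology: "comm_group (as_rel_cohomology p X S)"
  unfolding as_rel_cohomology_def
  by (rule comm_group.abelian_FactGroup[OF comm_group_as_cocycle_group])
     (rule normal_imp_subgroup[OF normal_as_relboundaries])

lemma rel_class_eq_iff:
  assumes "\<phi> \<in> as_relcocycles p X S" "\<psi> \<in> as_relcocycles p X S"
  shows "rel_class p X S \<phi> = rel_class p X S \<psi> \<longleftrightarrow> (\<lambda>xs. \<phi> xs + \<psi> xs) \<in> as_relboundaries p X S"
proof -
  interpret normal "as_relboundaries p X S" "as_cocycle_group p X S" by (rule normal_as_relboundaries)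
  have "rel_class p X S \<phi> = rel_class p X S \<psi> \<longleftrightarrow> \<phi> \<in> rel_class p X S \<psi>"
    unfolding rel_class_def
    using assms repr_independence[OF _ _ is_subgroup] rcos_self[OF _ is_subgroup] by (metis as_cocycle_group_simps(1))
  also have "\<dots> \<longleftrightarrow> (\<lambda>xs. \<phi> xs + \<psi> xs) \<in> as_relboundaries p X S"
    unfolding rel_class_def
    using rcos_module[of \<psi> \<phi>] assms inv_as_cocycle_group[OF assms(2)] by (simp add: is_group)
  finally show ?thesis .
qed

lemma one_as_rel_cohomology: "\<one>\<^bsub>as_rel_cohomology p X S\<^esub> = as_relboundaries p X S"
  by (simp add: as_rel_cohomology_def)

lemma rel_class_eq_one_iff:
  assumes "\<phi> \<in> as_relcocycles p X S"
  shows "rel_class p X S \<phi> = \<one>\<^bsub>as_rel_cohomology p X S\<^esub> \<longleftrightarrow> \<phi> \<in> as_relboundaries p X S"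
proof -
  have "rel_class p X S (\<lambda>xs. 0) = \<one>\<^bsub>as_rel_cohomology p X S\<^esub>"
    using hom_one[OF rel_class_hom comm_group.axioms(2)[OF comm_group_as_cocycle_group]
      comm_group.axioms(2)[OF comm_group_as_rel_cohomology]] by simp
  then show ?thesis using rel_class_eq_iff[OF assms as_relcocycles_0] by simp
qed

lemma as_class_eq_iff:
  assumes "\<phi> \<in> as_relcocycles p X {}" "\<psi> \<in> as_relcocycles p X {}"
  shows "as_class p X \<phi> = as_class p X \<psi> \<longleftrightarrow> null_cochain X (\<lambda>xs. \<phi> xs + \<psi> xs)"
  using assms by (simp add: as_class_eq rel_class_eq_iff mem_as_relboundaries_empty as_cochains_add mem_as_relcocycles_empty)

lemma as_class_eq_one_iff:
  assumes "\<phi> \<in> as_relcocycles p X {}"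
  shows "as_class p X \<phi> = \<one>\<^bsub>as_cohomology p X\<^esub> \<longleftrightarrow> null_cochain X \<phi>"
  using assms by (simp add: as_class_eq rel_class_eq_one_iff mem_as_relboundaries_empty mem_as_relcocycles_empty)

lemma mem_as_class:
  "\<phi> \<in> as_relcocycles p X {} \<Longrightarrow> \<psi> \<in> as_class p X \<phi> \<longleftrightarrow> \<psi> \<in> as_relcocycles p X {} \<and> as_class p X \<psi> = as_class p X \<phi>"
proof -
  assume p: "\<phi> \<in> as_relcocycles p X {}"
  interpret normal "as_relboundaries p X {}" "as_cocycle_group p X {}" by (rule normal_as_relboundaries)
  show ?thesis
    unfolding as_class_def
  proof
    assume \<psi>: "\<psi> \<in> as_relboundaries p X {} #>\<^bsub>as_cocycle_group p X {}\<^esub> \<phi>"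
    have "\<psi> \<in> as_relcocycles p X {}"
      using elemrcos_carrier[OF is_group, of \<phi> \<psi>] \<psi> p by simp
    then show "\<psi> \<in> as_relcocycles p X {} \<and> as_relboundaries p X {} #>\<^bsub>as_cocycle_group p X {}\<^esub> \<psi> =
        as_relboundaries p X {} #>\<^bsub>as_cocycle_group p X {}\<^esub> \<phi>"
      using repr_independence[OF \<psi> _ is_subgroup] p by simp
  next
    assume "\<psi> \<in> as_relcocycles p X {} \<and> as_relboundaries p X {} #>\<^bsub>as_cocycle_group p X {}\<^esub> \<psi> =
        as_relboundaries p X {} #>\<^bsub>as_cocycle_group p X {}\<^esub> \<phi>"
    then show "\<psi> \<in> as_relboundaries p X {} #>\<^bsub>as_cocycle_group p X {}\<^esub> \<phi>"
      using rcos_self[OF _ is_subgroup, of \<psi>] by simp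
  qed
qed

subsection \<open>Induced maps\<close>

lemma as_pullback_eq: "set xs \<subseteq> topspace X \<Longrightarrow> as_pullback X f \<phi> xs = \<phi> (map f xs)"
  by (simp add: as_pullback_def)

lemma as_pullback_cochain:
  "\<phi> \<in> as_cochains p Y \<Longrightarrow> as_pullback X f \<phi> \<in> as_cochains p X"
  unfolding as_cochains_def as_pullback_def mem_Collect_eq by (metis length_map map_is_Nil_conv)

lemma cobd_as_pullback:
  "set xs \<subseteq> topspace X \<Longrightarrow> cobd (as_pullback X f \<phi>) xs = cobd \<phi> (map f xs)"
  by (subst cobd_map[symmetric]) (intro cobd_cong, auto simp: as_pullback_def)

lemma as_pullback_cocycle:
  assumes "\<phi> \<in> as_relcocycles p Y {}" "continuous_map X Y f"
  shows "as_pullback X f \<phi> \<in> as_relcocycles p X {}"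
proof -
  have "as_locally_zero X (cobd (as_pullback X f \<phi>)) = as_locally_zero X (\<lambda>xs. cobd \<phi> (map f xs))"
    by (rule as_locally_zero_cong) (rule cobd_as_pullback)
  with assms as_locally_zero_map[OF _ assms(2)] show ?thesis
    by (simp add: mem_as_relcocycles_empty as_pullback_cochain[of _ _ Y])
qed

lemma as_induced_as_class:
  assumes f: "continuous_map X Y f" and \<phi>: "\<phi> \<in> as_relcocycles p Y {}"
  shows "as_induced p X f (as_class p Y \<phi>) = as_class p X (as_pullback X f \<phi>)"
proof -
  have eq: "as_class p X (as_pullback X f \<psi>) = as_class p X (as_pullback X f \<phi>)" if "\<psi> \<in> as_class p Y \<phi>" for \<psi>
  proof -
    from that have \<psi>: "\<psi> \<in> as_relcocycles p Y {}" and "as_class p Y \<psi> = as_class p Y \<phi>"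
      using mem_as_class[OF \<phi>] by auto
    then have "null_cochain Y (\<lambda>xs. \<psi> xs + \<phi> xs)" using as_class_eq_iff \<phi> by blast
    from null_cochain_map[OF this f]
    have "null_cochain X (\<lambda>xs. as_pullback X f \<psi> xs + as_pullback X f \<phi> xs)"
      by (rule null_cochain_cong[THEN iffD1, rotated]) (simp add: as_pullback_def)
    then show ?thesis using as_class_eq_iff[OF as_pullback_cocycle[OF \<psi> f] as_pullback_cocycle[OF \<phi> f]] by blast
  qed
  moreover have "\<phi> \<in> as_class p Y \<phi>" using mem_as_class[OF \<phi>] \<phi> by blast
  ultimately show ?thesis unfolding as_induced_def by blast
qed

subsection \<open>Reduced cohomology\<close>

text \<open>
  The constant \<open>1\<close> on \<open>n\<close>-tuples is the coboundary of the constant \<open>1\<close> on \<open>(n - 1)\<close>-tuples when \<open>n\<close>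
  is odd.  For \<open>n = 1\<close> the latter is the augmentation.
\<close>

lemma constant_cocycle_reduced_null:
  fixes X :: "'a topology"
  assumes "odd n \<or> b = 0"
  shows "reduced_null X (\<lambda>xs. if length xs = n then b else 0)"
proof -
  have "(\<lambda>xs :: 'a list. (if length xs = n then b else 0) + cobd (\<lambda>ys. if Suc (length ys) = n then b else 0) xs)
      = (\<lambda>xs. (0::bit))"
  proof
    fix xs :: "'a list"
    have "cobd (\<lambda>ys. if Suc (length ys) = n then b else 0) xs = cobd (\<lambda>ys. if length xs = n then b else 0) xs"
      by (rule cobd_cong) auto
    also have "\<dots> = (if length xs = n then b else 0)" using assms by (auto simp: cobd_const)
    finally show "(if length xs = n then b else 0) + cobd (\<lambda>ys. if Suc (length ys) = n then b else 0) xs = (0::bit)"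
      by simp
  qed
  then show ?thesis
    unfolding reduced_null_def
    by (intro exI[of _ "\<lambda>ys. if Suc (length ys) = n then b else 0"]) (simp del: bit_not_zero_iff)
qed

text \<open>
  On tuples with all entries equal to \<open>c\<close>, a cocycle is a constant; the cocycle condition forces
  the constant to be \<open>0\<close> unless the number of entries is odd.
\<close>

lemma reduced_null_constant_map:
  assumes p: "\<phi> \<in> as_cochains p Y" and cocycle: "as_locally_zero Y (cobd \<phi>)" and c: "c \<in> topspace Y"
  shows "reduced_null X (\<lambda>xs. \<phi> (map (\<lambda>_. c) xs))"
proof (cases "p < 0")
  case True
  then show ?thesis
    using as_cochains_neg[OF True p] constant_cocycle_reduced_null[of 0 0 X] by simp
next
  case False
  define n where "n = nat (p + 1)"
  define b where "b = \<phi> (replicate n c)"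
  have eq: "\<phi> (map (\<lambda>_. c) xs) = (if length xs = n then b else 0)" for xs :: "'c list"
    using False as_cochains_wrong_length[OF p, of "map (\<lambda>_. c) xs"]
    by (auto simp: b_def n_def map_replicate_const)
  have "odd n \<or> b = 0"
  proof -
    obtain U where U: "c \<in> U" "\<And>xs. set xs \<subseteq> U \<Longrightarrow> cobd \<phi> xs = 0"
      using as_locally_zeroE[OF cocycle c] by metis
    have "cobd \<phi> (map (\<lambda>_. c) (replicate (Suc n) c)) = 0" by (rule U(2)) (use U(1) in auto)
    then have "cobd (\<lambda>xs. \<phi> (map (\<lambda>_. c) xs)) (replicate (Suc n) c) = 0" by (simp only: cobd_map)
    moreover have "cobd (\<lambda>xs. \<phi> (map (\<lambda>_. c) xs)) (replicate (Suc n) c) = cobd (\<lambda>us. b) (replicate (Suc n) c)"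
      by (rule cobd_cong) (auto simp: eq)
    ultimately show ?thesis by (auto simp: cobd_const simp del: replicate_Suc split: if_splits)
  qed
  then show ?thesis unfolding eq by (rule constant_cocycle_reduced_null)
qed

text \<open>
  This identifies the degree-free notion with the kernel of the projection to reduced
  cohomology.  The value \<open>\<psi> []\<close> of a cobounding function only contributes in degree \<open>0\<close>, where it
  is a constant coming from the point.
\<close>

lemma mem_induced_point_iff:
  assumes \<phi>: "\<phi> \<in> as_relcocycles p X {}"
  shows "as_class p X \<phi> \<in> as_induced p X (\<lambda>x. ()) ` carrier (as_cohomology p (discrete_topology {()}))
      \<longleftrightarrow> reduced_null X \<phi>"
proof -
  let ?P = "discrete_topology {()}"
  have cont: "continuous_map X ?P (\<lambda>x. ())" by (simp add: continuous_map)
  have im: "as_induced p X (\<lambda>x. ()) ` carrier (as_cohomology p ?P)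
      = (\<lambda>\<beta>. as_class p X (as_pullback X (\<lambda>x. ()) \<beta>)) ` as_relcocycles p ?P {}"
    unfolding carrier_as_rel_cohomology image_image as_class_eq[symmetric]
    by (intro image_cong refl as_induced_as_class cont)
  show ?thesis
    unfolding im
  proof
    assume "as_class p X \<phi> \<in> (\<lambda>\<beta>. as_class p X (as_pullback X (\<lambda>x. ()) \<beta>)) ` as_relcocycles p ?P {}"
    then obtain \<beta> where \<beta>: "\<beta> \<in> as_relcocycles p ?P {}"
      and eq: "as_class p X \<phi> = as_class p X (as_pullback X (\<lambda>x. ()) \<beta>)" by blast
    have R: "reduced_null X (\<lambda>xs. \<beta> (map (\<lambda>x. ()) xs))"
      using \<beta> by (intro reduced_null_constant_map[where Y = ?P and p = p]) (auto simp: mem_as_relcocycles_empty)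
    have "null_cochain X (\<lambda>xs. \<phi> xs + as_pullback X (\<lambda>x. ()) \<beta> xs)"
      using as_class_eq_iff[OF \<phi> as_pullback_cocycle[OF \<beta> cont]] eq by blast
    then obtain \<psi> where \<psi>: "as_locally_zero X (\<lambda>xs. \<phi> xs + as_pullback X (\<lambda>x. ()) \<beta> xs + cobd \<psi> xs)"
      by (auto simp: null_cochain_def)
    from R obtain \<rho> where \<rho>: "as_locally_zero X (\<lambda>xs. \<beta> (map (\<lambda>x. ()) xs) + cobd \<rho> xs)"
      by (auto simp: reduced_null_def)
    have "as_locally_zero X (\<lambda>xs. \<phi> xs + cobd (\<lambda>xs. \<psi> xs + \<rho> xs) xs)"
      using as_locally_zero_add[OF \<psi> \<rho>]
      by (rule as_locally_zero_cong[THEN iffD1, rotated])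
         (simp add: as_pullback_def cobd_add ac_simps)
    then show "reduced_null X \<phi>" by (auto simp: reduced_null_def)
  next
    assume "reduced_null X \<phi>"
    then obtain \<psi> where \<psi>: "as_locally_zero X (\<lambda>xs. \<phi> xs + cobd \<psi> xs)"
      by (auto simp: reduced_null_def)
    define \<psi>' where "\<psi>' = (\<lambda>xs. if xs = [] then 0 else \<psi> xs)"
    define \<beta> :: "unit list \<Rightarrow> bit" where "\<beta> = (\<lambda>xs. if length xs = 1 \<and> p = 0 then \<psi> [] else 0)"
    have cobd_\<beta>: "cobd \<beta> xs = 0" for xs
    proof (cases "length xs = 2 \<and> p = 0")
      case True
      then have "cobd \<beta> xs = cobd (\<lambda>_. \<psi> []) xs" by (intro cobd_cong) (auto simp: \<beta>_def)
      then show ?thesis using True by (auto simp: cobd_const)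
    qed (auto simp: \<beta>_def intro!: cobd_eq_0)
    have \<beta>: "\<beta> \<in> as_relcocycles p ?P {}"
      unfolding mem_as_relcocycles_empty cobd_\<beta>[THEN ext] by (auto simp: as_cochains_def \<beta>_def)
    have "null_cochain X (\<lambda>xs. \<phi> xs + as_pullback X (\<lambda>x. ()) \<beta> xs)"
      unfolding null_cochain_def
    proof (intro exI conjI)
      show "truncate_cochain (p - 1) X \<psi>' [] = 0" by simp
      show "as_locally_zero X (\<lambda>xs. \<phi> xs + as_pullback X (\<lambda>x. ()) \<beta> xs + cobd (truncate_cochain (p - 1) X \<psi>') xs)"
        using \<psi>
      proof (rule as_locally_zero_mono)
        fix U xs assume U: "U \<subseteq> topspace X" "\<forall>ys. set ys \<subseteq> U \<longrightarrow> \<phi> ys + cobd \<psi> ys = 0" and xs: "set xs \<subseteq> U"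
        then have sub: "set xs \<subseteq> topspace X" by auto
        have tr: "cobd (truncate_cochain (p - 1) X \<psi>') xs = (if int (length xs) = p + 1 then cobd \<psi>' xs else 0)"
          by (rule cobd_truncate[OF sub]) (simp add: \<psi>'_def)
        show "\<phi> xs + as_pullback X (\<lambda>x. ()) \<beta> xs + cobd (truncate_cochain (p - 1) X \<psi>') xs = 0"
        proof (cases "int (length xs) = p + 1")
          case True
          show ?thesis
          proof (cases "length xs = 1")
            case True
            then obtain x where [simp]: "xs = [x]" by (auto simp: length_Suc_conv)
            have "p = 0" using \<open>int (length xs) = p + 1\<close> by simp
            then show ?thesis
              using U(2)[rule_format, of "[x]"] xs sub tr by (auto simp: as_pullback_def \<beta>_def \<psi>'_def cobd_Cons)
          next
            case False
            then have "cobd \<psi>' xs = cobd \<psi> xs" by (intro cobd_cong) (auto simp: \<psi>'_def)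
            then show ?thesis
              using False U(2) xs sub tr \<open>int (length xs) = p + 1\<close> by (auto simp: as_pullback_def \<beta>_def)
          qed
        next
          case False
          then show ?thesis
            using tr \<phi> sub by (auto simp: as_pullback_def \<beta>_def mem_as_relcocycles_empty as_cochains_wrong_length)
        qed
      qed
    qed
    then have "as_class p X \<phi> = as_class p X (as_pullback X (\<lambda>x. ()) \<beta>)"
      using as_class_eq_iff[OF \<phi> as_pullback_cocycle[OF \<beta> cont]] by blast
    with \<beta> show "as_class p X \<phi> \<in> (\<lambda>\<beta>. as_class p X (as_pullback X (\<lambda>x. ()) \<beta>)) ` as_relcocycles p ?P {}"
      by blast
  qed
qed

section \<open>Homotopy invariance on metric spaces\<close>

text \<open>
  The chain homotopy for a path of maps \<open>h 0, \<dots>, h n\<close>, normalised by the prism over the constant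
  path at the final map \<open>h'\<close>.  With this correction the stages at which the path has already
  arrived contribute \<open>0\<close>, so \<open>n\<close> may depend on the simplex.
\<close>

definition small_step_prism ::
    "(nat \<Rightarrow> 'a \<Rightarrow> 'b) \<Rightarrow> ('a \<Rightarrow> 'b) \<Rightarrow> nat \<Rightarrow> ('b list \<Rightarrow> bit) \<Rightarrow> 'a list \<Rightarrow> bit" where
  "small_step_prism h h' n \<phi> xs =
     (\<Sum>i<n. prism (h i) (h (Suc i)) \<phi> xs + prism h' h' \<phi> xs)"

text \<open>
  A telescoping sum of prism formulas; the correction terms cancel because the prism over a
  constant path commutes with the coboundary.
\<close>

lemma small_step_prism_homotopy:
  "cobd (small_step_prism h h' n \<phi>) xs + small_step_prism h h' n (cobd \<phi>) xs
     = \<phi> (map (h 0) xs) + \<phi> (map (h n) xs)"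
proof (induction n)
  case 0
  then show ?case by (simp add: small_step_prism_def[abs_def])
next
  case (Suc n)
  have 1: "small_step_prism h h' (Suc n) \<psi> = (\<lambda>xs. small_step_prism h h' n \<psi> xs
      + (prism (h n) (h (Suc n)) \<psi> xs + prism h' h' \<psi> xs))" for \<psi>
    by (simp add: small_step_prism_def fun_eq_iff)
  have 2: "cobd (prism h' h' \<phi>) xs = prism h' h' (cobd \<phi>) xs"
    using prism_homotopy[of h' h' \<phi> xs] by (simp add: bit_eq_add_iff)
  have 3: "cobd (prism (h n) (h (Suc n)) \<phi>) xs
      = prism (h n) (h (Suc n)) (cobd \<phi>) xs + (\<phi> (map (h n) xs) + \<phi> (map (h (Suc n)) xs))"
    using prism_homotopy[of "h n" "h (Suc n)" \<phi> xs] by (metis bit_add_left_cancel_self add.commute)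
  have 4: "cobd (small_step_prism h h' n \<phi>) xs
      = small_step_prism h h' n (cobd \<phi>) xs + (\<phi> (map (h 0) xs) + \<phi> (map (h n) xs))"
    using Suc by (metis bit_add_left_cancel_self add.commute)
  show ?case
    unfolding 1 cobd_add 2 3 4 by (simp add: ac_simps)
qed

lemma small_step_prism_stable:
  assumes "\<And>x i. x \<in> set xs \<Longrightarrow> i \<ge> m \<Longrightarrow> h i x = h' x" "m \<le> n"
  shows "small_step_prism h h' n \<phi> xs = small_step_prism h h' m \<phi> xs"
  unfolding small_step_prism_def
proof (rule sum.mono_neutral_cong_right)
  show "\<forall>i\<in>{..<n} - {..<m}. prism (h i) (h (Suc i)) \<phi> xs + prism h' h' \<phi> xs = 0"
  proof
    fix i assume "i \<in> {..<n} - {..<m}"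
    then have "prism (h i) (h (Suc i)) \<phi> xs = prism h' h' \<phi> xs"
      by (intro prism_cong) (simp add: assms)
    then show "prism (h i) (h (Suc i)) \<phi> xs + prism h' h' \<phi> xs = 0" by simp
  qed
qed (use assms(2) in auto)

text \<open>
  A step size that is continuous in the point of \<open>S\<close>: half the supremum of the radii (capped at \<open>1\<close>) that
  work as Lebesgue numbers for the covering along the whole time interval.  It is positive by
  compactness of the interval, and it is Lipschitz, which is where the metric is used.
\<close>

lemma open_cover_homotopy_step:
  fixes S :: "'a::metric_space set" and F :: "real \<times> 'a \<Rightarrow> 'b"
  assumes F: "continuous_map (top_of_set ({0..1} \<times> S)) Y F"
    and cov: "\<And>y. y \<in> topspace Y \<Longrightarrow> \<exists>U\<in>\<U>. y \<in> U" and op: "\<And>U. U \<in> \<U> \<Longrightarrow> openin Y U"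
  obtains \<epsilon> where "continuous_on S \<epsilon>" "\<And>x. x \<in> S \<Longrightarrow> 0 < \<epsilon> x"
    "\<And>x t t'. x \<in> S \<Longrightarrow> t \<in> {0..1} \<Longrightarrow> t' \<in> {0..1} \<Longrightarrow> \<bar>t' - t\<bar> \<le> \<epsilon> x \<Longrightarrow> \<exists>U\<in>\<U>. F (t, x) \<in> U \<and> F (t', x) \<in> U"
proof -
  \<comment> \<open>The radii that work at \<open>x\<close> for all times at once.\<close>
  define L where "L x = {r. 0 < r \<and> r \<le> 1 \<and>
      (\<forall>t\<in>{0..1}. \<exists>U\<in>\<U>. \<forall>t'\<in>{0..1}. \<forall>y\<in>S. \<bar>t' - t\<bar> < r \<longrightarrow> dist x y < r \<longrightarrow> F (t', y) \<in> U)}" for x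
  have F': "\<exists>V. open V \<and> {p \<in> {0..1} \<times> S. F p \<in> U} = ({0..1} \<times> S) \<inter> V" if "U \<in> \<U>" for U
  proof -
    have "openin (top_of_set ({0..1} \<times> S)) {p \<in> {0..1} \<times> S. F p \<in> U}"
      using openin_continuous_map_preimage[OF F op[OF that]] by simp
    then show ?thesis unfolding openin_open .
  qed
  then have "\<forall>U\<in>\<U>. \<exists>V. open V \<and> {p \<in> {0..1} \<times> S. F p \<in> U} = ({0..1} \<times> S) \<inter> V" by blast
  from bchoice[OF this] obtain V where V: "\<And>U. U \<in> \<U> \<Longrightarrow> open (V U)"
      "\<And>U. U \<in> \<U> \<Longrightarrow> {p \<in> {0..1} \<times> S. F p \<in> U} = ({0..1} \<times> S) \<inter> V U" by blast
  have FY: "F (t, x) \<in> topspace Y" if "t \<in> {0..1}" "x \<in> S" for t x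
    using continuous_map_image_subset_topspace[OF F] that by auto
  have ne: "L x \<noteq> {}" if x: "x \<in> S" for x
  proof -
    have cmp: "compact ({0..1::real} \<times> {x})" by (intro compact_Times) auto
    have cover: "{0..1} \<times> {x} \<subseteq> \<Union>(V ` \<U>)"
    proof
      fix p assume "p \<in> {0..1::real} \<times> {x}"
      then obtain t where p: "p = (t, x)" "t \<in> {0..1}" by auto
      then obtain U where U: "U \<in> \<U>" "F p \<in> U" using cov FY x by blast
      then have "p \<in> V U" using V(2)[OF U(1)] p x by auto
      with U show "p \<in> \<Union>(V ` \<U>)" by blast
    qed
    obtain e where e: "0 < e" "\<And>p. p \<in> {0..1} \<times> {x} \<Longrightarrow> \<exists>G\<in>V ` \<U>. ball p e \<subseteq> G"
      using Heine_Borel_lemma[OF cmp cover] V(1) by blast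
    have "min 1 (e/2) \<in> L x"
      unfolding L_def
    proof (intro CollectI conjI ballI)
      fix t :: real assume t: "t \<in> {0..1}"
      then obtain U where U: "U \<in> \<U>" "ball (t, x) e \<subseteq> V U" using e(2)[of "(t,x)"] by auto
      show "\<exists>U\<in>\<U>. \<forall>t'\<in>{0..1}. \<forall>y\<in>S. \<bar>t' - t\<bar> < min 1 (e/2) \<longrightarrow> dist x y < min 1 (e/2) \<longrightarrow> F (t', y) \<in> U"
      proof (intro bexI[OF _ U(1)] ballI impI)
        fix t' y assume ty: "t' \<in> {0..1}" "y \<in> S" "\<bar>t' - t\<bar> < min 1 (e/2)" "dist x y < min 1 (e/2)"
        have "dist (t, x) (t', y) \<le> dist t t' + dist x y"
          by (simp add: dist_Pair_Pair sqrt_sum_squares_le_sum)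
        also have "\<dots> < e" using ty by (simp add: dist_real_def abs_minus_commute)
        finally have "(t', y) \<in> V U" using U(2) by auto
        then have "(t', y) \<in> ({0..1} \<times> S) \<inter> V U" using ty by auto
        then show "F (t', y) \<in> U" unfolding V(2)[OF U(1), symmetric] by simp
      qed
    qed (use e in auto)
    then show ?thesis by blast
  qed
  have bdd: "bdd_above (L x)" for x by (intro bdd_aboveI[of _ 1]) (auto simp: L_def)
  define \<epsilon> where "\<epsilon> x = Sup (L x) / 2" for x
  have pos: "0 < \<epsilon> x" if x: "x \<in> S" for x
  proof -
    obtain r where r: "r \<in> L x" using ne[OF x] by blast
    then have "0 < r" by (simp add: L_def)
    also have "r \<le> Sup (L x)" by (rule cSup_upper[OF r bdd])
    finally show ?thesis by (simp add: \<epsilon>_def)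
  qed
  have lip: "Sup (L x) \<le> Sup (L y) + dist x y" if x: "x \<in> S" and y: "y \<in> S" for x y
  proof (rule cSup_least[OF ne[OF x]])
    fix r assume r: "r \<in> L x"
    show "r \<le> Sup (L y) + dist x y"
    proof (cases "r \<le> dist x y")
      case True
      then show ?thesis using pos[OF y] by (simp add: \<epsilon>_def)
    next
      case False
      have "r - dist x y \<in> L y"
        unfolding L_def
      proof (intro CollectI conjI ballI)
        show "0 < r - dist x y" using False by simp
        show "r - dist x y \<le> 1" using r by (simp add: L_def add_increasing2 diff_le_eq)
        fix t :: real assume t: "t \<in> {0..1}"
        then obtain U where U: "U \<in> \<U>"
          "\<And>t' z. t' \<in> {0..1} \<Longrightarrow> z \<in> S \<Longrightarrow> \<bar>t' - t\<bar> < r \<Longrightarrow> dist x z < r \<Longrightarrow> F (t', z) \<in> U"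
          using r unfolding L_def by blast
        show "\<exists>U\<in>\<U>. \<forall>t'\<in>{0..1}. \<forall>z\<in>S. \<bar>t' - t\<bar> < r - dist x y \<longrightarrow> dist y z < r - dist x y \<longrightarrow> F (t', z) \<in> U"
        proof (intro bexI[OF _ U(1)] ballI impI)
          fix t' z assume tz: "t' \<in> {0..1}" "z \<in> S" "\<bar>t' - t\<bar> < r - dist x y" "dist y z < r - dist x y"
          have "dist x z \<le> dist x y + dist y z" by (rule dist_triangle)
          then show "F (t', z) \<in> U" using tz by (intro U(2)) (auto simp: less_diff_eq add_increasing2 intro: order.strict_trans1[rotated])
        qed
      qed
      from cSup_upper[OF this bdd] show ?thesis by simp
    qed
  qed
  have "continuous_on S (\<lambda>x. Sup (L x))"
    unfolding continuous_on_iff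
  proof (intro ballI allI impI)
    fix x e assume "x \<in> S" "0 < (e::real)"
    then show "\<exists>d>0. \<forall>x'\<in>S. dist x' x < d \<longrightarrow> dist (Sup (L x')) (Sup (L x)) < e"
    proof (intro exI[of _ e] conjI ballI impI)
      fix x' assume "x' \<in> S" "dist x' x < e"
      with lip[of x x'] lip[of x' x] \<open>x \<in> S\<close> show "dist (Sup (L x')) (Sup (L x)) < e"
        by (simp add: dist_real_def dist_commute abs_less_iff)
    qed simp
  qed
  then have "continuous_on S \<epsilon>" unfolding \<epsilon>_def[abs_def] by (intro continuous_intros) auto
  moreover have "\<exists>U\<in>\<U>. F (t, x) \<in> U \<and> F (t', x) \<in> U"
    if "x \<in> S" "t \<in> {0..1}" "t' \<in> {0..1}" "\<bar>t' - t\<bar> \<le> \<epsilon> x" for x t t'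
  proof -
    have "\<epsilon> x < Sup (L x)" using pos[OF that(1)] by (simp add: \<epsilon>_def)
    then have "\<exists>r\<in>L x. \<epsilon> x < r" using less_cSup_iff[OF ne[OF that(1)] bdd] by blast
    then obtain r where r: "r \<in> L x" "\<epsilon> x < r" by blast
    have "\<exists>U\<in>\<U>. \<forall>t'\<in>{0..1}. \<forall>y\<in>S. \<bar>t' - t\<bar> < r \<longrightarrow> dist x y < r \<longrightarrow> F (t', y) \<in> U"
      using that(2) r(1) unfolding L_def by blast
    then obtain U where "U \<in> \<U>"
      "\<And>t' y. t' \<in> {0..1} \<Longrightarrow> y \<in> S \<Longrightarrow> \<bar>t' - t\<bar> < r \<Longrightarrow> dist x y < r \<Longrightarrow> F (t', y) \<in> U"
      by blast
    moreover have "0 < r" using r by (simp add: L_def)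
    ultimately show ?thesis using that r(2) by (intro bexI[of _ U]) auto
  qed
  ultimately show ?thesis using that pos by blast
qed

text \<open>
  Move along the homotopy in steps of the size just constructed.  Near a given point finitely many
  steps suffice, and each of them stays in a member of the covering on which \<open>\<delta>\<phi>\<close> vanishes, so the
  prism terms of \<open>\<delta>\<phi>\<close> disappear locally.
\<close>

theorem homotopic_cocycles:
  fixes S :: "'a::metric_space set"
  assumes hom: "homotopic_with (\<lambda>h. True) (top_of_set S) Y f g"
    and cocycle: "as_locally_zero Y (cobd \<phi>)"
  shows "null_cochain (top_of_set S) (\<lambda>xs. \<phi> (map f xs) + \<phi> (map g xs))"
proof -
  from hom obtain F where "continuous_map (prod_topology (top_of_set {0..1::real}) (top_of_set S)) Y F"
    and F0: "\<And>x. F (0, x) = f x" and F1: "\<And>x. F (1, x) = g x"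
    unfolding homotopic_with_def by blast
  then have F: "continuous_map (top_of_set ({0..1} \<times> S)) Y F" by simp
  define \<U> where "\<U> = {U. openin Y U \<and> (\<forall>ys. set ys \<subseteq> U \<longrightarrow> cobd \<phi> ys = 0)}"
  obtain \<epsilon> where cont: "continuous_on S \<epsilon>" and pos: "\<And>x. x \<in> S \<Longrightarrow> 0 < \<epsilon> x"
    and step: "\<And>x t t'. x \<in> S \<Longrightarrow> t \<in> {0..1} \<Longrightarrow> t' \<in> {0..1} \<Longrightarrow> \<bar>t' - t\<bar> \<le> \<epsilon> x
      \<Longrightarrow> \<exists>U\<in>\<U>. F (t, x) \<in> U \<and> F (t', x) \<in> U"
  proof (rule open_cover_homotopy_step[OF F, of \<U>])
    show "\<exists>U\<in>\<U>. y \<in> U" if "y \<in> topspace Y" for y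
      using cocycle that unfolding \<U>_def as_locally_zero_iff by blast
  qed (auto simp: \<U>_def)
  \<comment> \<open>The cut-off at 1 makes the walk stop at the final map.\<close>
  define \<tau> where "\<tau> i x = min 1 (real i * \<epsilon> x)" for i x
  define h where "h i x = F (\<tau> i x, x)" for i x
  have \<tau>01: "\<tau> i x \<in> {0..1}" if "x \<in> S" for i x using pos[OF that] by (simp add: \<tau>_def)
  have h_cont: "continuous_map (top_of_set S) Y (h i)" for i
  proof -
    have "continuous_map (top_of_set S) (top_of_set ({0..1} \<times> S)) (\<lambda>x. (\<tau> i x, x))"
      unfolding \<tau>_def[abs_def]
      using cont \<tau>01[unfolded \<tau>_def] by (auto simp: continuous_map_in_subtopology intro!: continuous_intros)
    from continuous_map_compose[OF this F] show ?thesis by (simp add: h_def[abs_def] o_def)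
  qed
  have h0: "h 0 x = f x" for x by (simp add: h_def \<tau>_def F0)
  have late: "h i x = g x" if "x \<in> S" "i \<ge> n" "real n * \<epsilon> x \<ge> 1" for i n x
  proof -
    have "1 \<le> real i * \<epsilon> x" using that pos[OF that(1)] by (smt (verit) mult_right_mono of_nat_le_iff)
    then show ?thesis by (simp add: h_def \<tau>_def F1)
  qed
  define N where "N xs = (LEAST n. \<forall>x\<in>set xs. real n * \<epsilon> x \<ge> 1)" for xs
  define H where "H \<psi> xs = small_step_prism h g (N xs) \<psi> xs" for \<psi> xs
  have H_eq: "H \<psi> xs = small_step_prism h g n \<psi> xs" if "set xs \<subseteq> S" "\<forall>x\<in>set xs. real n * \<epsilon> x \<ge> 1" for \<psi> xs n
  proof -
    have 1: "\<forall>x\<in>set xs. real (N xs) * \<epsilon> x \<ge> 1" unfolding N_def by (rule LeastI) (rule that(2))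
    have 2: "N xs \<le> n" unfolding N_def by (rule Least_le) (rule that(2))
    show ?thesis
      unfolding H_def by (rule small_step_prism_stable[symmetric, OF _ 2]) (use that 1 late in blast)
  qed
  show ?thesis
    unfolding null_cochain_def
  proof (intro exI conjI)
    show "H \<phi> [] = 0" by (simp add: H_def small_step_prism_def)
    show "as_locally_zero (top_of_set S) (\<lambda>xs. \<phi> (map f xs) + \<phi> (map g xs) + cobd (H \<phi>) xs)"
      unfolding as_locally_zero_iff
    proof
      fix x assume "x \<in> topspace (top_of_set S)"
      then have x: "x \<in> S" by simp
      \<comment> \<open>The factor 1/2 leaves room for the step size to vary near \<open>x\<close>.\<close>
      obtain n :: nat where n: "real n * (\<epsilon> x / 2) \<ge> 1"
        using real_arch_simple[of "1 / (\<epsilon> x / 2)"] pos[OF x] by (auto simp: field_simps)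
      define V where "V = {y \<in> S. \<epsilon> x / 2 < \<epsilon> y}"
      have V: "openin (top_of_set S) V" "x \<in> V"
        using cont pos[OF x] x unfolding V_def
        by (auto intro: continuous_openin_preimage_gen[of _ _ "{\<epsilon> x / 2<..}", unfolded vimage_def Int_def, simplified])
      have Vn: "real n * \<epsilon> y \<ge> 1" if "y \<in> V" for y
      proof -
        have "real n * (\<epsilon> x / 2) \<le> real n * \<epsilon> y" using that by (intro mult_left_mono) (auto simp: V_def)
        with n show ?thesis by linarith
      qed
      have "\<exists>W. openin (top_of_set S) W \<and> x \<in> W \<and>
          (\<forall>xs. set xs \<subseteq> W \<longrightarrow> prism (h i) (h (Suc i)) (cobd \<phi>) xs = 0)" for i
      proof -
        have "\<bar>\<tau> (Suc i) x - \<tau> i x\<bar> \<le> \<epsilon> x" using pos[OF x] by (auto simp: \<tau>_def min_def algebra_simps)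
        then obtain U where U: "U \<in> \<U>" "h i x \<in> U" "h (Suc i) x \<in> U"
          using step[OF x \<tau>01[OF x] \<tau>01[OF x], of "Suc i" i] by (auto simp: h_def)
        have Uo: "openin Y U" "\<And>ys. set ys \<subseteq> U \<Longrightarrow> cobd \<phi> ys = 0" using U(1) by (auto simp: \<U>_def)
        let ?W = "{y \<in> topspace (top_of_set S). h i y \<in> U} \<inter> {y \<in> topspace (top_of_set S). h (Suc i) y \<in> U}"
        have "openin (top_of_set S) ?W"
          by (intro openin_Int openin_continuous_map_preimage[OF h_cont Uo(1)])
        moreover have "prism (h i) (h (Suc i)) (cobd \<phi>) xs = 0" if "set xs \<subseteq> ?W" for xs
          by (rule prism_eq_0, rule Uo(2)) (use that in blast)
        ultimately show ?thesis using U x by (intro exI[of _ ?W]) auto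
      qed
      then obtain W where W: "\<And>i. openin (top_of_set S) (W i)" "\<And>i. x \<in> W i"
        "\<And>i xs. set xs \<subseteq> W i \<Longrightarrow> prism (h i) (h (Suc i)) (cobd \<phi>) xs = 0" by metis
      have "\<exists>W. openin (top_of_set S) W \<and> x \<in> W \<and> (\<forall>xs. set xs \<subseteq> W \<longrightarrow> prism g g (cobd \<phi>) xs = 0)"
      proof -
        have "g x \<in> topspace Y" using late[OF x order_refl, of n] Vn[OF V(2)]
            continuous_map_image_subset_topspace[OF h_cont[of n]] x by auto
        then obtain U where U: "openin Y U" "g x \<in> U" "\<And>ys. set ys \<subseteq> U \<Longrightarrow> cobd \<phi> ys = 0"
          using as_locally_zeroE[OF cocycle] by metis
        let ?W = "{y \<in> topspace (top_of_set S). h n y \<in> U} \<inter> V"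
        have "openin (top_of_set S) ?W"
          by (intro openin_Int openin_continuous_map_preimage[OF h_cont U(1)] V)
        moreover have "prism g g (cobd \<phi>) xs = 0" if "set xs \<subseteq> ?W" for xs
        proof (rule prism_eq_0, rule U(3))
          have "h n y = g y" if "y \<in> V" for y using late[of y n n] Vn that by (auto simp: V_def)
          then have "g ` set xs \<subseteq> U" using \<open>set xs \<subseteq> ?W\<close> by force
          then show "set ys \<subseteq> U" if "set ys \<subseteq> g ` set xs \<union> g ` set xs" for ys using that by blast
        qed
        moreover have "x \<in> ?W" using V U x late[of x n n] Vn by auto
        ultimately show ?thesis by blast
      qed
      then obtain W' where W': "openin (top_of_set S) W'" "x \<in> W'"
        "\<And>xs. set xs \<subseteq> W' \<Longrightarrow> prism g g (cobd \<phi>) xs = 0" by metis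
      let ?G = "V \<inter> W' \<inter> (\<Inter>i\<in>insert 0 {..<n}. W i)"
      have Gopen: "openin (top_of_set S) ?G"
        by (intro openin_Int openin_INT2 V W' W) auto
      have "\<phi> (map f xs) + \<phi> (map g xs) + cobd (H \<phi>) xs = 0" if G: "set xs \<subseteq> ?G" for xs
      proof -
        have xsV: "set xs \<subseteq> S" "\<forall>y\<in>set xs. real n * \<epsilon> y \<ge> 1" using G Vn by (auto simp: V_def)
        have 1: "cobd (H \<phi>) xs = cobd (small_step_prism h g n \<phi>) xs"
          by (rule cobd_cong, rule H_eq) (use xsV in blast)+
        have 2: "small_step_prism h g n (cobd \<phi>) xs = 0"
          unfolding small_step_prism_def
        proof (intro sum.neutral ballI)
          fix i assume "i \<in> {..<n}"
          then have "set xs \<subseteq> W i" "set xs \<subseteq> W'" using G by blast+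
          then show "prism (h i) (h (Suc i)) (cobd \<phi>) xs + prism g g (cobd \<phi>) xs = 0"
            using W(3) W'(3) by simp
        qed
        have 3: "map (h 0) xs = map f xs" "map (h n) xs = map g xs"
          using h0 late[of _ n n] xsV by auto
        show ?thesis
          using small_step_prism_homotopy[of h g n \<phi> xs] unfolding 1 2 3 by simp
      qed
      moreover have "x \<in> ?G" using V W W' by auto
      ultimately show "\<exists>U. openin (top_of_set S) U \<and> x \<in> U \<and>
          (\<forall>xs. set xs \<subseteq> U \<longrightarrow> \<phi> (map f xs) + \<phi> (map g xs) + cobd (H \<phi>) xs = 0)"
        using Gopen by blast
    qed
  qed
qed

corollary nullhomotopic_reduced_null:
  fixes S :: "'a::metric_space set"
  assumes hom: "homotopic_with (\<lambda>h. True) (top_of_set S) Y f (\<lambda>x. c)" and c: "c \<in> topspace Y"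
    and \<phi>: "\<phi> \<in> as_cochains p Y" "as_locally_zero Y (cobd \<phi>)"
  shows "reduced_null (top_of_set S) (\<lambda>xs. \<phi> (map f xs))"
proof -
  obtain \<alpha> where \<alpha>: "as_locally_zero (top_of_set S) (\<lambda>xs. \<phi> (map f xs) + \<phi> (map (\<lambda>x. c) xs) + cobd \<alpha> xs)"
    using homotopic_cocycles[OF hom \<phi>(2)] by (auto simp: null_cochain_def)
  obtain \<beta> where \<beta>: "as_locally_zero (top_of_set S) (\<lambda>xs. \<phi> (map (\<lambda>x. c) xs) + cobd \<beta> xs)"
    using reduced_null_constant_map[OF \<phi> c, of "top_of_set S"] by (auto simp: reduced_null_def)
  from as_locally_zero_add[OF \<alpha> \<beta>] show ?thesis
    unfolding reduced_null_def by (intro exI[of _ "\<lambda>xs. \<alpha> xs + \<beta> xs"]) (simp add: cobd_add ac_simps)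
qed

section \<open>Relative cohomology of a contractible space\<close>

text \<open>
  Isomorphisms below come from two epimorphisms of a group of cocycles; this avoids choosing
  representatives of cosets of cosets.
\<close>

lemma isomorphic_if_same_kernel:
  assumes h: "group_hom G H h" "h ` carrier G = carrier H"
    and q: "group_hom G K q" "q ` carrier G = carrier K"
    and ker: "\<And>x. x \<in> carrier G \<Longrightarrow> h x = \<one>\<^bsub>H\<^esub> \<longleftrightarrow> q x = \<one>\<^bsub>K\<^esub>"
  shows "H \<cong> K"
proof -
  have "kernel G H h = kernel G K q" using ker by (auto simp: kernel_def)
  then have "G Mod kernel G H h \<cong> H" "G Mod kernel G H h \<cong> K"
    using group_hom.FactGroup_iso_set[OF h] group_hom.FactGroup_iso_set[OF q] by (auto intro: is_isoI)
  moreover have "group (G Mod kernel G H h)"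
    by (intro normal.factorgroup_is_group group_hom.normal_kernel h)
  ultimately show ?thesis using group.iso_sym iso_trans by blast
qed

lemma group_as_cohomology: "group (as_rel_cohomology p X S)"
  by (rule comm_group.axioms(2)[OF comm_group_as_rel_cohomology])

lemma group_as_cocycle_group: "group (as_cocycle_group p X S)"
  by (rule comm_group.axioms(2)[OF comm_group_as_cocycle_group])

lemma induced_point_image:
  "as_induced p X (\<lambda>x. ()) ` carrier (as_cohomology p (discrete_topology {()}))
     = as_class p X ` {\<phi> \<in> as_relcocycles p X {}. reduced_null X \<phi>}" (is "?C = _")
proof -
  have cont: "continuous_map X (discrete_topology {()}) (\<lambda>x. ())" by (simp add: continuous_map)
  have image_sub: "a \<in> C \<longleftrightarrow> (\<exists>z\<in>Z. a = k z \<and> k z \<in> C)" if "C \<subseteq> k ` Z"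
    for C :: "('a list \<Rightarrow> bit) set set" and k and Z :: "('a list \<Rightarrow> bit) set" and a
    using that by blast
  have sub: "?C \<subseteq> as_class p X ` as_relcocycles p X {}"
    unfolding carrier_as_rel_cohomology image_image as_class_eq[symmetric]
  proof (rule image_subsetI)
    fix \<phi> assume "\<phi> \<in> as_relcocycles p (discrete_topology {()}) {}"
    then show "as_induced p X (\<lambda>x. ()) (as_class p (discrete_topology {()}) \<phi>) \<in> as_class p X ` as_relcocycles p X {}"
      unfolding as_induced_as_class[OF cont \<open>\<phi> \<in> _\<close>] by (intro imageI as_pullback_cocycle[OF _ cont])
  qed
  note mem = image_sub[OF sub]
  show ?thesis
  proof (rule Set.set_eqI)
    fix a
    have "(\<exists>\<phi>\<in>as_relcocycles p X {}. a = as_class p X \<phi> \<and> as_class p X \<phi> \<in> ?C)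
        \<longleftrightarrow> (\<exists>\<phi>\<in>as_relcocycles p X {}. a = as_class p X \<phi> \<and> reduced_null X \<phi>)"
      by (intro bex_cong refl conj_cong mem_induced_point_iff)
    then show "a \<in> ?C \<longleftrightarrow> a \<in> as_class p X ` {\<phi> \<in> as_relcocycles p X {}. reduced_null X \<phi>}"
      by (simp only: mem[of a]) blast
  qed
qed

text \<open>
  Reduced cohomology as a quotient of the cocycles: the kernel is \<open>reduced_null\<close>.
\<close>

lemma reduced_class_hom:
  defines "C \<equiv> \<lambda>p X. as_induced p X (\<lambda>x. ()) ` carrier (as_cohomology p (discrete_topology {()}))"
  shows "group_hom (as_cocycle_group p X {}) (as_reduced_cohomology p X)
           (\<lambda>\<phi>. C p X #>\<^bsub>as_cohomology p X\<^esub> as_class p X \<phi>)"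
    and "(\<lambda>\<phi>. C p X #>\<^bsub>as_cohomology p X\<^esub> as_class p X \<phi>) ` as_relcocycles p X {} = carrier (as_reduced_cohomology p X)"
    and "\<phi> \<in> as_relcocycles p X {} \<Longrightarrow>
      C p X #>\<^bsub>as_cohomology p X\<^esub> as_class p X \<phi> = \<one>\<^bsub>as_reduced_cohomology p X\<^esub> \<longleftrightarrow> reduced_null X \<phi>"
proof -
  let ?H = "as_cohomology p X"
  interpret H: comm_group ?H by (rule comm_group_as_rel_cohomology)
  interpret c: group_hom "as_cocycle_group p X {}" ?H "as_class p X"
    unfolding group_hom_def group_hom_axioms_def as_class_eq
    using rel_class_hom group_as_cohomology group_as_cocycle_group by blast
  have C: "C p X = as_class p X ` {\<phi> \<in> as_relcocycles p X {}. reduced_null X \<phi>}"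
    by (simp add: C_def induced_point_image)
  have sub: "subgroup (C p X) ?H"
  proof (rule H.subgroupI)
    show "C p X \<subseteq> carrier ?H" unfolding C using c.hom_closed by auto
    have "reduced_null X (\<lambda>xs. 0)" by (rule null_imp_reduced_null) (simp add: null_cochain_locally_zero)
    then show "C p X \<noteq> {}" unfolding C using as_relcocycles_0 by blast
    show "inv\<^bsub>?H\<^esub> a \<in> C p X" if "a \<in> C p X" for a
    proof -
      from that obtain \<phi> where \<phi>: "a = as_class p X \<phi>" "\<phi> \<in> as_relcocycles p X {}" by (auto simp: C)
      then have "inv\<^bsub>?H\<^esub> a = a" using c.hom_inv[of \<phi>] by (simp add: inv_as_cocycle_group)
      with that show ?thesis by simp
    qed
    show "a \<otimes>\<^bsub>?H\<^esub> b \<in> C p X" if "a \<in> C p X" "b \<in> C p X" for a b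
    proof -
      from that obtain \<phi> \<psi> where ab: "a = as_class p X \<phi>" "\<phi> \<in> as_relcocycles p X {}" "reduced_null X \<phi>"
        "b = as_class p X \<psi>" "\<psi> \<in> as_relcocycles p X {}" "reduced_null X \<psi>" by (auto simp: C)
      have "a \<otimes>\<^bsub>?H\<^esub> b = as_class p X (\<lambda>xs. \<phi> xs + \<psi> xs)"
        using c.hom_mult[of \<phi> \<psi>] ab by simp
      moreover have "reduced_null X (\<lambda>xs. \<phi> xs + \<psi> xs)"
      proof -
        from ab obtain \<alpha> \<beta> where "as_locally_zero X (\<lambda>xs. \<phi> xs + cobd \<alpha> xs)"
          "as_locally_zero X (\<lambda>xs. \<psi> xs + cobd \<beta> xs)" by (auto simp: reduced_null_def)
        from as_locally_zero_add[OF this] show ?thesis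
          unfolding reduced_null_def by (intro exI[of _ "\<lambda>xs. \<alpha> xs + \<beta> xs"]) (simp add: cobd_add ac_simps)
      qed
      ultimately show ?thesis using ab as_relcocycles_add unfolding C by blast
    qed
  qed
  interpret N: normal "C p X" ?H by (rule H.subgroup_imp_normal[OF sub])
  have R: "as_reduced_cohomology p X = ?H Mod C p X"
    by (simp add: as_reduced_cohomology_def C_def)
  have "(\<lambda>a. C p X #>\<^bsub>?H\<^esub> a) \<circ> as_class p X \<in> hom (as_cocycle_group p X {}) (?H Mod C p X)"
    by (rule hom_compose[OF c.homh N.r_coset_hom_Mod])
  then show "group_hom (as_cocycle_group p X {}) (as_reduced_cohomology p X)
           (\<lambda>\<phi>. C p X #>\<^bsub>?H\<^esub> as_class p X \<phi>)"
    unfolding group_hom_def group_hom_axioms_def R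
    using N.factorgroup_is_group group_as_cocycle_group by (simp add: o_def)
  show "(\<lambda>\<phi>. C p X #>\<^bsub>?H\<^esub> as_class p X \<phi>) ` as_relcocycles p X {} = carrier (as_reduced_cohomology p X)"
    unfolding R carrier_FactGroup carrier_as_rel_cohomology as_class_eq by (simp add: image_image)
  show "C p X #>\<^bsub>?H\<^esub> as_class p X \<phi> = \<one>\<^bsub>as_reduced_cohomology p X\<^esub> \<longleftrightarrow> reduced_null X \<phi>"
    if "\<phi> \<in> as_relcocycles p X {}"
  proof -
    have "C p X #>\<^bsub>?H\<^esub> as_class p X \<phi> = C p X \<longleftrightarrow> as_class p X \<phi> \<in> C p X"
      using H.coset_join1[OF _ _ sub] H.coset_join2[OF _ sub] c.hom_closed that sub
      by (metis as_cocycle_group_simps(1) H.coset_join1 subgroup.subset)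
    then show ?thesis
      using mem_induced_point_iff[OF that] by (simp add: R C_def)
  qed
qed

lemma reduced_cohomology_nontrivial:
  assumes "\<phi> \<in> as_relcocycles p X {}" "\<not> reduced_null X \<phi>"
  shows "\<not> trivial_group (as_reduced_cohomology p X)"
proof
  interpret q: group_hom "as_cocycle_group p X {}" "as_reduced_cohomology p X"
    "\<lambda>\<phi>. as_induced p X (\<lambda>x. ()) ` carrier (as_cohomology p (discrete_topology {()})) #>\<^bsub>as_cohomology p X\<^esub> as_class p X \<phi>"
    by (rule reduced_class_hom(1))
  assume "trivial_group (as_reduced_cohomology p X)"
  then have "carrier (as_reduced_cohomology p X) = {\<one>\<^bsub>as_reduced_cohomology p X\<^esub>}"
    by (simp add: trivial_group_def)
  then show False using q.hom_closed[of \<phi>] assms reduced_class_hom(3)[OF assms(1)] by simp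
qed

lemma as_coboundary_relcocycle:
  assumes \<psi>: "\<psi> \<in> as_cochains (p - 1) X" and S: "as_locally_zero (subtopology X S) (cobd \<psi>)"
  shows "as_coboundary X \<psi> \<in> as_relcocycles p X S"
proof -
  have "as_coboundary X \<psi> \<in> as_cochains p X" using as_coboundary_in_cochains[OF \<psi>] by simp
  moreover have "as_locally_zero (subtopology X S) (as_coboundary X \<psi>)"
    by (rule as_locally_zero_cong[THEN iffD1, OF _ S]) (auto simp: as_coboundary_eq)
  moreover have "as_locally_zero X (cobd (as_coboundary X \<psi>))"
  proof (rule as_locally_zero_cong[THEN iffD1, OF _ as_locally_zero_0])
    fix xs assume "set xs \<subseteq> topspace X"
    then have "cobd (as_coboundary X \<psi>) xs = cobd (cobd \<psi>) xs"
      by (intro cobd_cong) (auto simp: as_coboundary_eq)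
    then show "0 = cobd (as_coboundary X \<psi>) xs" by simp
  qed
  ultimately show ?thesis by (simp add: mem_as_relcocycles)
qed

text \<open>
  The connecting homomorphism sends a cocycle \<open>\<psi>\<close> on the retract \<open>T\<close> to \<open>\<delta>(r\<^sup>*\<psi>)\<close>, where \<open>r\<^sup>*\<psi>\<close> is
  extended by \<open>0\<close> from \<open>S\<close> to \<open>X\<close>.  Contractibility of \<open>X\<close> makes it onto (every relative cocycle
  is a coboundary on \<open>X\<close>) and computes its kernel (\<open>r\<^sup>*\<psi>\<close> corrected by a cochain that vanishes on
  \<open>S\<close> is a cocycle on \<open>X\<close>, hence trivial up to a constant).
\<close>

theorem rel_cohomology_contractible:
  fixes X S T :: "'a::metric_space set"
  assumes TS: "T \<subseteq> S" and SX: "S \<subseteq> X" and ne: "T \<noteq> {}" and c: "c \<in> X"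
    and contr: "homotopic_with (\<lambda>h. True) (top_of_set X) (top_of_set X) (\<lambda>x. x) (\<lambda>x. c)"
    and r: "continuous_on S r" "r ` S \<subseteq> T" "\<And>x. x \<in> T \<Longrightarrow> r x = x"
    and retr: "homotopic_with (\<lambda>h. True) (top_of_set S) (top_of_set S) (\<lambda>x. x) r"
  shows "as_rel_cohomology p (top_of_set X) S \<cong> as_reduced_cohomology (p - 1) (top_of_set T)"
proof -
  let ?X = "top_of_set X" and ?S = "top_of_set S" and ?T = "top_of_set T"
  have sub: "subtopology ?X S = ?S" using SX by (simp add: subtopology_subtopology Int_absorb1)
  have r_cont: "continuous_map ?S ?T r" using r by auto
  have T_cont: "continuous_map ?T ?S (\<lambda>x. x)" and TX_cont: "continuous_map ?T ?X (\<lambda>x. x)"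
    and S_cont: "continuous_map ?S ?X (\<lambda>x. x)"
    using TS SX by auto
  have contr': "reduced_null ?X \<phi>" if "\<phi> \<in> as_cochains q ?X" "as_locally_zero ?X (cobd \<phi>)" for \<phi> q
    using nullhomotopic_reduced_null[OF contr _ that] c by simp
  \<comment> \<open>Extension by \<open>0\<close> to \<open>X\<close> is automatic, since a pullback to \<open>S\<close> vanishes outside \<open>S\<close>.\<close>
  define E where "E \<psi> = as_pullback ?S r \<psi>" for \<psi>
  have E_cochain: "E \<psi> \<in> as_cochains q ?X" if "\<psi> \<in> as_cochains q ?T" for \<psi> q
    using as_pullback_cochain[OF that, of ?S r] SX unfolding E_def as_cochains_def by (auto 0 3)
  have E_eq: "E \<psi> xs = \<psi> (map r xs)" if "set xs \<subseteq> S" for \<psi> xs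
    using that by (simp add: E_def as_pullback_def)
  have E_T: "E \<psi> xs = \<psi> xs" if "set xs \<subseteq> T" for \<psi> xs
  proof -
    have "map r xs = xs" using that r(3) by (induction xs) auto
    then show ?thesis using E_eq[of xs \<psi>] that TS by auto
  qed
  have E_cocycle: "as_locally_zero ?S (cobd (E \<psi>))" if "as_locally_zero ?T (cobd \<psi>)" for \<psi>
    using as_locally_zero_map[OF that r_cont]
    by (rule as_locally_zero_cong[THEN iffD1, rotated]) (simp add: E_def cobd_as_pullback)
  define h where "h \<psi> = rel_class p ?X S (as_coboundary ?X (E \<psi>))" for \<psi>
  have dE: "as_coboundary ?X (E \<psi>) \<in> as_relcocycles p ?X S" if "\<psi> \<in> as_relcocycles (p - 1) ?T {}" for \<psi>
    using that E_cochain E_cocycle by (intro as_coboundary_relcocycle) (auto simp: mem_as_relcocycles_empty sub)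
  let ?G = "as_cocycle_group (p - 1) ?T {}" and ?H = "as_rel_cohomology p ?X S"
  let ?q = "\<lambda>\<phi>. as_induced (p - 1) ?T (\<lambda>x. ()) ` carrier (as_cohomology (p - 1) (discrete_topology {()})) #>\<^bsub>as_cohomology (p - 1) ?T\<^esub> as_class (p - 1) ?T \<phi>"
  have h_hom: "group_hom ?G ?H h"
    unfolding group_hom_def group_hom_axioms_def
  proof (intro conjI group_as_cohomology group_as_cocycle_group homI)
    show "h \<psi> \<in> carrier ?H" if "\<psi> \<in> carrier ?G" for \<psi>
      using dE that by (simp add: h_def carrier_as_rel_cohomology)
    show "h (\<psi> \<otimes>\<^bsub>?G\<^esub> \<psi>') = h \<psi> \<otimes>\<^bsub>?H\<^esub> h \<psi>'" if "\<psi> \<in> carrier ?G" "\<psi>' \<in> carrier ?G" for \<psi> \<psi>'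
    proof -
      have E_add: "E (\<lambda>xs. \<psi> xs + \<psi>' xs) = (\<lambda>xs. E \<psi> xs + E \<psi>' xs)"
        by (auto simp: E_def as_pullback_def fun_eq_iff)
      have "as_coboundary ?X (E (\<lambda>xs. \<psi> xs + \<psi>' xs)) = (\<lambda>xs. as_coboundary ?X (E \<psi>) xs + as_coboundary ?X (E \<psi>') xs)"
        by (rule ext) (simp add: as_coboundary_eq E_add cobd_add)
      then show ?thesis
        using hom_mult[OF rel_class_hom, of "as_coboundary ?X (E \<psi>)" p ?X S "as_coboundary ?X (E \<psi>')"] dE that
        by (simp add: h_def)
    qed
  qed
  have h_onto: "h ` carrier ?G = carrier ?H"
  proof
    show "h ` carrier ?G \<subseteq> carrier ?H" using dE by (auto simp: h_def carrier_as_rel_cohomology)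
    show "carrier ?H \<subseteq> h ` carrier ?G"
      unfolding carrier_as_rel_cohomology
    proof (rule image_subsetI)
      fix \<phi> assume \<phi>: "\<phi> \<in> as_relcocycles p ?X S"
      then have \<phi>c: "\<phi> \<in> as_cochains p ?X" and \<phi>S: "as_locally_zero ?S \<phi>" and "as_locally_zero ?X (cobd \<phi>)"
        by (auto simp: mem_as_relcocycles sub)
      then obtain \<alpha>0 where \<alpha>0: "as_locally_zero ?X (\<lambda>xs. \<phi> xs + cobd \<alpha>0 xs)"
        using contr' by (auto simp: reduced_null_def)
      obtain \<alpha> where \<alpha>: "\<alpha> \<in> as_cochains (p - 1) ?X" "as_locally_zero ?X (\<lambda>xs. \<phi> xs + cobd \<alpha> xs)"
      proof -
        define \<alpha>1 where "\<alpha>1 = (\<lambda>xs. if xs = [] then 0 else \<alpha>0 xs)"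
        have "as_locally_zero ?X (\<lambda>xs. \<phi> xs + cobd (truncate_cochain (p - 1) ?X \<alpha>1) xs)"
        \<comment> \<open>In degree \<open>0\<close> the relative cocycle vanishes somewhere, so the augmentation of \<open>\<alpha>0\<close> is \<open>0\<close>.\<close>
        proof (cases "p = 0")
          case True
          obtain s where s: "s \<in> T" using ne by blast
          then have sX: "s \<in> topspace ?S" "s \<in> topspace ?X" using TS SX by auto
          obtain U where "s \<in> U" "\<And>xs. set xs \<subseteq> U \<Longrightarrow> \<phi> xs = 0"
            using as_locally_zeroE[OF \<phi>S sX(1)] by metis
          moreover obtain V where "s \<in> V" "\<And>xs. set xs \<subseteq> V \<Longrightarrow> \<phi> xs + cobd \<alpha>0 xs = 0"
            using as_locally_zeroE[OF \<alpha>0 sX(2)] by metis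
          ultimately have "\<phi> [s] = 0" "\<phi> [s] + cobd \<alpha>0 [s] = 0" by (metis empty_set list.simps(15) empty_subsetI insert_subset)+
          then have "\<alpha>0 [] = 0" by (simp add: cobd_Cons)
          then have "\<alpha>1 = \<alpha>0" by (auto simp: \<alpha>1_def)
          then show ?thesis
            using \<alpha>0 \<open>\<alpha>0 [] = 0\<close> as_locally_zero_add_cobd_truncate[OF \<phi>c] by simp
        next
          case False
          show ?thesis
            using \<alpha>0
          proof (rule as_locally_zero_mono)
            fix U xs assume U: "U \<subseteq> topspace ?X" "\<forall>ys. set ys \<subseteq> U \<longrightarrow> \<phi> ys + cobd \<alpha>0 ys = 0" and xs: "set xs \<subseteq> U"
            have tr: "cobd (truncate_cochain (p - 1) ?X \<alpha>1) xs = (if int (length xs) = p + 1 then cobd \<alpha>1 xs else 0)"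
              by (rule cobd_truncate) (use U xs in \<open>auto simp: \<alpha>1_def\<close>)
            show "\<phi> xs + cobd (truncate_cochain (p - 1) ?X \<alpha>1) xs = 0"
            proof (cases "int (length xs) = p + 1")
              case True
              then have "cobd \<alpha>1 xs = cobd \<alpha>0 xs" using False by (intro cobd_cong) (auto simp: \<alpha>1_def)
              then show ?thesis using tr True U(2) xs by simp
            next
              case False
              then show ?thesis using tr as_cochains_wrong_length[OF \<phi>c] by simp
            qed
          qed
        qed
        then show ?thesis using truncate_cochain_in that by blast
      qed
      define \<psi> where "\<psi> = as_pullback ?T (\<lambda>x. x) \<alpha>"
      have \<alpha>S: "as_locally_zero ?S (cobd \<alpha>)"
        using as_locally_zero_add[OF \<phi>S as_locally_zero_map[OF \<alpha>(2) S_cont]] by simp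
      have \<psi>: "\<psi> \<in> as_relcocycles (p - 1) ?T {}"
        unfolding mem_as_relcocycles_empty
      proof
        show "\<psi> \<in> as_cochains (p - 1) ?T" unfolding \<psi>_def by (rule as_pullback_cochain[OF \<alpha>(1)])
        show "as_locally_zero ?T (cobd \<psi>)"
          using as_locally_zero_map[OF \<alpha>S T_cont]
          by (rule as_locally_zero_cong[THEN iffD1, rotated]) (simp add: \<psi>_def cobd_as_pullback)
      qed
      obtain \<beta> where \<beta>: "\<beta> [] = 0" "as_locally_zero ?S (\<lambda>xs. \<alpha> xs + \<alpha> (map r xs) + cobd \<beta> xs)"
        using homotopic_cocycles[OF retr \<alpha>S] by (auto simp: null_cochain_def)
      define \<eta> where "\<eta> = (\<lambda>xs. \<alpha> xs + E \<psi> xs + cobd \<beta> xs)"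
      have \<eta>S: "as_locally_zero ?S \<eta>"
      proof (rule as_locally_zero_cong[THEN iffD1, OF _ \<beta>(2)])
        fix xs assume "set xs \<subseteq> topspace ?S"
        then have "E \<psi> xs = \<psi> (map r xs)" "set (map r xs) \<subseteq> T"
          using E_eq[of xs \<psi>] r(2) by (auto simp: image_subset_iff subset_iff)
        then show "\<alpha> xs + \<alpha> (map r xs) + cobd \<beta> xs = \<eta> xs"
          by (simp add: \<eta>_def \<psi>_def as_pullback_def)
      qed
      have "as_locally_zero ?X (\<lambda>xs. (\<phi> xs + as_coboundary ?X (E \<psi>) xs) + cobd \<eta> xs)"
        using \<alpha>(2)
        by (rule as_locally_zero_cong[THEN iffD1, rotated]) (simp add: \<eta>_def cobd_add as_coboundary_eq ac_simps)
      moreover have "\<eta> [] = 0"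
        using as_cochains_Nil[OF \<alpha>(1)] as_cochains_Nil[OF E_cochain, of \<psi> "p - 1"] \<psi> \<beta>(1)
        by (simp add: \<eta>_def mem_as_relcocycles_empty)
      moreover have "(\<lambda>xs. \<phi> xs + as_coboundary ?X (E \<psi>) xs) \<in> as_cochains p ?X"
        using as_relcocycles_add[OF \<phi> dE[OF \<psi>]] by (simp add: mem_as_relcocycles)
      ultimately have "(\<lambda>xs. \<phi> xs + as_coboundary ?X (E \<psi>) xs) \<in> as_relboundaries p ?X S"
        using \<eta>S by (auto simp: mem_as_relboundaries sub)
      then have "rel_class p ?X S \<phi> = h \<psi>"
        unfolding h_def using rel_class_eq_iff[OF \<phi> dE[OF \<psi>]] by blast
      then show "rel_class p ?X S \<phi> \<in> h ` carrier ?G" using \<psi> by auto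
    qed
  qed
  have h_ker: "h \<psi> = \<one>\<^bsub>?H\<^esub> \<longleftrightarrow> ?q \<psi> = \<one>\<^bsub>as_reduced_cohomology (p - 1) ?T\<^esub>" if "\<psi> \<in> carrier ?G" for \<psi>
  proof -
    have \<psi>: "\<psi> \<in> as_relcocycles (p - 1) ?T {}" using that by simp
    then have \<psi>c: "\<psi> \<in> as_cochains (p - 1) ?T" by (simp add: mem_as_relcocycles_empty)
    have "h \<psi> = \<one>\<^bsub>?H\<^esub> \<longleftrightarrow> as_coboundary ?X (E \<psi>) \<in> as_relboundaries p ?X S"
      unfolding h_def by (rule rel_class_eq_one_iff[OF dE[OF \<psi>]])
    also have "\<dots> \<longleftrightarrow> reduced_null ?T \<psi>"
    proof
      assume "as_coboundary ?X (E \<psi>) \<in> as_relboundaries p ?X S"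
      then obtain \<eta> where \<eta>: "\<eta> \<in> as_cochains (p - 1) ?X" "as_locally_zero ?S \<eta>"
        "as_locally_zero ?X (\<lambda>xs. as_coboundary ?X (E \<psi>) xs - as_coboundary ?X \<eta> xs)"
        unfolding as_relboundaries_def as_relcochains_def by (auto simp: sub simp del: minus_bit_def)
      define \<gamma> where "\<gamma> = (\<lambda>xs. E \<psi> xs + \<eta> xs)"
      have "\<gamma> \<in> as_cochains (p - 1) ?X" unfolding \<gamma>_def by (intro as_cochains_add E_cochain \<psi>c \<eta>)
      moreover have "as_locally_zero ?X (cobd \<gamma>)"
        using \<eta>(3) by (rule as_locally_zero_cong[THEN iffD1, rotated]) (simp add: \<gamma>_def cobd_add as_coboundary_eq)
      ultimately have "reduced_null ?X \<gamma>" by (rule contr')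
      from reduced_null_map[OF this TX_cont] have "reduced_null ?T \<gamma>" by simp
      moreover have "as_locally_zero ?T (\<lambda>xs. \<psi> xs + \<gamma> xs)"
        using as_locally_zero_map[OF \<eta>(2) T_cont]
        by (rule as_locally_zero_cong[THEN iffD1, rotated]) (simp add: \<gamma>_def E_T)
      ultimately show "reduced_null ?T \<psi>" using reduced_null_add_left by blast
    next
      assume "reduced_null ?T \<psi>"
      then obtain \<zeta> where \<zeta>: "as_locally_zero ?T (\<lambda>xs. \<psi> xs + cobd \<zeta> xs)" by (auto simp: reduced_null_def)
      define \<eta> where "\<eta> = (\<lambda>xs. E \<psi> xs + cobd (\<lambda>xs. \<zeta> (map r xs)) xs)"
      have "\<eta> [] = 0" using as_cochains_Nil[OF E_cochain[OF \<psi>c]] by (simp add: \<eta>_def)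
      moreover have "as_locally_zero ?S \<eta>"
        using as_locally_zero_map[OF \<zeta> r_cont]
        by (rule as_locally_zero_cong[THEN iffD1, rotated]) (simp add: \<eta>_def E_eq cobd_map)
      moreover have "as_locally_zero ?X (\<lambda>xs. as_coboundary ?X (E \<psi>) xs + cobd \<eta> xs)"
        by (rule as_locally_zero_cong[THEN iffD1, OF _ as_locally_zero_0])
           (simp add: \<eta>_def cobd_add as_coboundary_eq)
      ultimately show "as_coboundary ?X (E \<psi>) \<in> as_relboundaries p ?X S"
        using dE[OF \<psi>] by (auto simp: mem_as_relboundaries mem_as_relcocycles sub)
    qed
    also have "\<dots> \<longleftrightarrow> ?q \<psi> = \<one>\<^bsub>as_reduced_cohomology (p - 1) ?T\<^esub>"
      by (rule reduced_class_hom(3)[OF \<psi>, symmetric])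
    finally show ?thesis .
  qed
  show ?thesis
    by (rule isomorphic_if_same_kernel[OF h_hom h_onto reduced_class_hom(1) _ h_ker])
       (simp_all add: reduced_class_hom(2))
qed

lemma reduced_cohomology_neg_trivial: "p < 0 \<Longrightarrow> trivial_group (as_reduced_cohomology p X)"
proof -
  assume "p < 0"
  then have Z: "as_relcocycles p X {} = {\<lambda>xs. 0}"
    using as_cochains_neg[of p _ X] as_relcocycles_0[of p X "{}"] by (fastforce simp: mem_as_relcocycles_empty)
  have "group (as_reduced_cohomology p X)"
    using reduced_class_hom(1)[of p X] by (simp add: group_hom_def)
  moreover have "\<exists>a. carrier (as_reduced_cohomology p X) = {a}"
    unfolding reduced_class_hom(2)[symmetric] Z by auto
  ultimately show ?thesis by (simp add: group.trivial_group)
qed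

section \<open>The cohomology of a point\<close>

lemma point_cohomology:
  fixes c :: "'a::topological_space"
  shows "as_cohomology (int l) (top_of_set {c}) \<cong> (if l = 0 then integer_mod_group 2 else singleton_group 0)"
proof -
  let ?P = "top_of_set {c}" and ?p = "int l"
  have lz: "as_locally_zero ?P \<phi> \<longleftrightarrow> (\<forall>n. \<phi> (replicate n c) = 0)" for \<phi>
  proof
    assume "as_locally_zero ?P \<phi>"
    then obtain U where U: "c \<in> U" "\<And>xs. set xs \<subseteq> U \<Longrightarrow> \<phi> xs = 0"
      by (rule as_locally_zeroE[where x = c]) auto
    show "\<forall>n. \<phi> (replicate n c) = 0" by (intro allI U(2)) (use U(1) in auto)
  next
    assume *: "\<forall>n. \<phi> (replicate n c) = 0"
    show "as_locally_zero ?P \<phi>"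
      unfolding as_locally_zero_iff
    proof
      fix x assume "x \<in> topspace ?P"
      moreover have "xs = replicate (length xs) c" if "set xs \<subseteq> {c}" for xs
        using that by (simp add: replicate_length_same subset_iff)
      ultimately show "\<exists>U. openin ?P U \<and> x \<in> U \<and> (\<forall>xs. set xs \<subseteq> U \<longrightarrow> \<phi> xs = 0)"
        using * by (intro exI[of _ "{c}"]) (metis openin_subtopology_self singletonI topspace_euclidean_subtopology)
    qed
  qed
  show ?thesis
  proof (cases l)
    case (Suc m)
    have "\<phi> \<in> as_relboundaries ?p ?P {}" if \<phi>: "\<phi> \<in> as_relcocycles ?p ?P {}" for \<phi>
    proof -
      have "reduced_null ?P (\<lambda>xs. \<phi> (map (\<lambda>_. c) xs))"
        using \<phi> by (intro reduced_null_constant_map[where p = ?p and Y = ?P]) (auto simp: mem_as_relcocycles_empty)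
      then obtain \<psi> where \<psi>: "as_locally_zero ?P (\<lambda>xs. \<phi> (map (\<lambda>_. c) xs) + cobd \<psi> xs)"
        by (auto simp: reduced_null_def)
      then have eq: "\<phi> (replicate n c) = cobd \<psi> (replicate n c)" for n by (simp add: lz bit_eq_add_iff)
      have "as_locally_zero ?P (\<lambda>xs. \<phi> xs + cobd (\<lambda>xs. if length xs = l then \<psi> xs else 0) xs)"
        unfolding lz
      proof
        fix n
        show "\<phi> (replicate n c) + cobd (\<lambda>xs. if length xs = l then \<psi> xs else 0) (replicate n c) = 0"
        proof (cases "n = Suc l")
          case True
          then have "cobd (\<lambda>xs. if length xs = l then \<psi> xs else 0) (replicate n c) = cobd \<psi> (replicate n c)"
            by (intro cobd_cong) auto
          then show ?thesis using eq by simp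
        next
          case False
          then have "cobd (\<lambda>xs. if length xs = l then \<psi> xs else 0) (replicate n c) = 0"
            by (intro cobd_eq_0) auto
          moreover have "\<phi> (replicate n c) = 0"
            using \<phi> False as_cochains_wrong_length[of \<phi> ?p ?P "replicate n c"] by (auto simp: mem_as_relcocycles_empty)
          ultimately show ?thesis by simp
        qed
      qed
      then have "null_cochain ?P \<phi>"
        unfolding null_cochain_def using Suc by (intro exI[of _ "\<lambda>xs. if length xs = l then \<psi> xs else 0"]) auto
      with \<phi> show ?thesis by (simp add: mem_as_relboundaries_empty mem_as_relcocycles_empty)
    qed
    then have "carrier (as_cohomology ?p ?P) = {\<one>\<^bsub>as_cohomology ?p ?P\<^esub>}"
      unfolding carrier_as_rel_cohomology using rel_class_eq_one_iff as_relcocycles_0 by blast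
    then have "(\<lambda>_. 0) \<in> iso (as_cohomology ?p ?P) (singleton_group (0::int))"
      by (simp add: iso_def bij_betw_def group.hom_into_singleton_iff[OF group_as_cohomology])
    then have "as_cohomology ?p ?P \<cong> singleton_group (0::int)" by (rule is_isoI)
    then show ?thesis using Suc by simp
  next
    case 0
    let ?H = "as_cohomology 0 ?P"
    have val: "\<phi> xs = (if xs = [c] then \<phi> [c] else 0)" if "\<phi> \<in> as_relcocycles 0 ?P {}" for \<phi> xs
    proof (cases "xs = [c]")
      case False
      have "\<not> (int (length xs) = 0 + 1 \<and> set xs \<subseteq> topspace ?P)"
        using False by (cases xs) auto
      then have "\<phi> xs = 0"
        using that as_cochains_wrong_length[of \<phi> 0 ?P xs] as_cochains_outside[of \<phi> 0 ?P xs]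
        by (auto simp: mem_as_relcocycles_empty)
      with False show ?thesis by simp
    qed simp
    define g where "g \<phi> = (if \<phi> [c] = 0 then 0 else 1 :: int)" for \<phi> :: "'a list \<Rightarrow> bit"
    have "group_hom (as_cocycle_group 0 ?P {}) (integer_mod_group 2) g"
      unfolding group_hom_def group_hom_axioms_def
      by (intro conjI group_as_cocycle_group group_integer_mod_group homI)
         (auto simp: g_def carrier_integer_mod_group)
    moreover have "g ` carrier (as_cocycle_group 0 ?P {}) = carrier (integer_mod_group 2)"
    proof -
      define \<phi> where "\<phi> = (\<lambda>xs. if xs = [c] then 1 else 0 :: bit)"
      have "cobd \<phi> (replicate n c) = 0" for n
      proof (cases "n = 2")
        case True
        then show ?thesis by (simp add: numeral_2_eq_2 cobd_Cons \<phi>_def)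
      qed (auto intro!: cobd_eq_0 simp: \<phi>_def)
      moreover have "\<phi> \<in> as_cochains 0 ?P" by (simp add: as_cochains_def \<phi>_def)
      ultimately have "\<phi> \<in> as_relcocycles 0 ?P {}" unfolding mem_as_relcocycles_empty lz by blast
      then have "1 \<in> g ` as_relcocycles 0 ?P {}" by (intro image_eqI[of _ _ \<phi>]) (auto simp: g_def \<phi>_def)
      moreover have "0 \<in> g ` as_relcocycles 0 ?P {}"
        by (intro image_eqI[of _ _ "\<lambda>_. 0"]) (auto simp: g_def as_relcocycles_0)
      moreover have "{0..<2} = {0, 1::int}" by auto
      moreover have "g ` as_relcocycles 0 ?P {} \<subseteq> {0, 1}" unfolding g_def by (rule image_subsetI) simp
      ultimately show ?thesis
        unfolding carrier_integer_mod_group as_cocycle_group_simps by (simp add: subset_antisym)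
    qed
    moreover have "rel_class 0 ?P {} \<phi> = \<one>\<^bsub>?H\<^esub> \<longleftrightarrow> g \<phi> = \<one>\<^bsub>integer_mod_group 2\<^esub>"
      if "\<phi> \<in> carrier (as_cocycle_group 0 ?P {})" for \<phi>
    proof -
      have \<phi>: "\<phi> \<in> as_relcocycles 0 ?P {}" using that by simp
      have "null_cochain ?P \<phi> \<longleftrightarrow> \<phi> [c] = 0"
      proof
        assume "null_cochain ?P \<phi>"
        then obtain \<psi> where "\<psi> [] = 0" "\<forall>n. \<phi> (replicate n c) + cobd \<psi> (replicate n c) = 0"
          by (auto simp: null_cochain_def lz)
        then show "\<phi> [c] = 0" by (auto dest!: spec[of _ 1] simp: cobd_Cons)
      next
        assume "\<phi> [c] = 0"
        then have "\<phi> xs = 0" for xs using val[OF \<phi>, of xs] by (cases "xs = [c]") auto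
        then have "\<phi> = (\<lambda>xs. 0)" by blast
        then show "null_cochain ?P \<phi>" by (simp add: null_cochain_locally_zero)
      qed
      then show ?thesis
        using rel_class_eq_one_iff[OF \<phi>] \<phi> by (auto simp: g_def mem_as_relboundaries_empty mem_as_relcocycles_empty)
    qed
    ultimately have "?H \<cong> integer_mod_group 2"
      by (intro isomorphic_if_same_kernel[of "as_cocycle_group 0 ?P {}" _ "rel_class 0 ?P {}" _ g])
         (auto simp: group_hom_def group_hom_axioms_def rel_class_hom group_as_cohomology group_as_cocycle_group carrier_as_rel_cohomology)
    with 0 show ?thesis by simp
  qed
qed

section \<open>Cup products\<close>

lemma cup_in_cochains:
  assumes "\<phi> \<in> as_cochains (int p) X" "\<psi> \<in> as_cochains (int q) X"
  shows "as_cup_cochain p \<phi> \<psi> \<in> as_cochains (int (p + q)) X"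
  unfolding as_cochains_def mem_Collect_eq
proof (intro allI impI)
  fix xs assume "as_cup_cochain p \<phi> \<psi> xs \<noteq> 0"
  then have nz: "\<phi> (take (Suc p) xs) \<noteq> 0" "\<psi> (drop p xs) \<noteq> 0" by (auto simp: as_cup_cochain_def)
  from nz(1) assms(1) have t: "int (length (take (Suc p) xs)) = int p + 1" "set (take (Suc p) xs) \<subseteq> topspace X"
    unfolding as_cochains_def by blast+
  from nz(2) assms(2) have d: "int (length (drop p xs)) = int q + 1" "set (drop p xs) \<subseteq> topspace X"
    unfolding as_cochains_def by blast+
  have "set xs = set (take p xs) \<union> set (drop p xs)" by (metis append_take_drop_id set_append)
  moreover have "set (take p xs) \<subseteq> set (take (Suc p) xs)" by (rule set_take_subset_set_take) simp
  ultimately show "xs \<noteq> [] \<and> int (length xs) = int (p + q) + 1 \<and> set xs \<subseteq> topspace X"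
    using t d by auto
qed

lemma cobd_cup_cochain:
  assumes \<phi>: "\<phi> \<in> as_cochains (int p) X" and \<psi>: "\<psi> [] = 0"
  shows "cobd (as_cup_cochain p \<phi> \<psi>) =
    (\<lambda>xs. as_cup_cochain (Suc p) (cobd \<phi>) \<psi> xs + as_cup_cochain p \<phi> (cobd \<psi>) xs)"
proof
  fix xs
  show "cobd (as_cup_cochain p \<phi> \<psi>) xs =
    as_cup_cochain (Suc p) (cobd \<phi>) \<psi> xs + as_cup_cochain p \<phi> (cobd \<psi>) xs"
  proof (cases "length xs \<ge> p + 2")
    case True
    then show ?thesis by (rule cobd_cup)
  next
    case False
    have \<phi>0: "\<phi> ys = 0" if "length ys \<noteq> Suc p" for ys
      by (rule as_cochains_wrong_length[OF \<phi>]) (use that in auto)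
    have 1: "cobd (as_cup_cochain p \<phi> \<psi>) xs = 0"
      by (rule cobd_eq_0) (use False in \<open>auto simp: as_cup_cochain_def \<phi>0\<close>)
    have 2: "cobd \<phi> xs = 0" by (rule cobd_eq_0) (use False in \<open>auto intro!: \<phi>0\<close>)
    have 3: "\<phi> xs * cobd \<psi> (drop p xs) = 0"
    proof (cases "length xs = Suc p")
      case True
      then have "length (drop p xs) = 1" by simp
      then obtain x where "drop p xs = [x]" by (metis One_nat_def length_0_conv length_Suc_conv)
      then show ?thesis by (simp add: cobd_Cons \<psi>)
    qed (simp add: \<phi>0)
    from False have "take (Suc (Suc p)) xs = xs" "take (Suc p) xs = xs" by auto
    with 1 2 3 show ?thesis by (simp add: as_cup_cochain_def)
  qed
qed

lemma as_locally_zero_cobd_cup: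
  assumes "\<phi> \<in> as_cochains (int p) X" "\<psi> [] = 0"
    and "as_locally_zero Y (cobd \<phi>)" "as_locally_zero Y (cobd \<psi>)"
  shows "as_locally_zero Y (cobd (as_cup_cochain p \<phi> \<psi>))"
  unfolding cobd_cup_cochain[where \<psi> = \<psi>, OF assms(1,2)]
  using assms(3,4) by (intro as_locally_zero_add as_locally_zero_cup) auto

lemma cup_cocycle:
  assumes "\<phi> \<in> as_relcocycles (int p) X {}" "\<psi> \<in> as_relcocycles (int q) X {}"
  shows "as_cup_cochain p \<phi> \<psi> \<in> as_relcocycles (int (p + q)) X {}"
  using assms cup_in_cochains as_locally_zero_cobd_cup as_cochains_Nil
  unfolding mem_as_relcocycles_empty by metis

lemma cup_add_left:
  "as_cup_cochain p (\<lambda>xs. \<phi> xs + \<phi>' xs) \<psi> xs = as_cup_cochain p \<phi> \<psi> xs + as_cup_cochain p \<phi>' \<psi> xs"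
  by (simp add: as_cup_cochain_def distrib_right)

lemma cup_add_right:
  "as_cup_cochain p \<phi> (\<lambda>xs. \<psi> xs + \<psi>' xs) xs = as_cup_cochain p \<phi> \<psi> xs + as_cup_cochain p \<phi> \<psi>' xs"
  by (simp add: as_cup_cochain_def distrib_left)

lemma null_cup_right:
  assumes \<phi>: "\<phi> \<in> as_relcocycles (int p) X {}" and \<psi>: "null_cochain X \<psi>"
  shows "null_cochain X (as_cup_cochain p \<phi> \<psi>)"
proof -
  from \<psi> obtain \<eta> where \<eta>: "\<eta> [] = 0" "as_locally_zero X (\<lambda>xs. \<psi> xs + cobd \<eta> xs)"
    by (auto simp: null_cochain_def)
  have \<phi>': "\<phi> \<in> as_cochains (int p) X" "as_locally_zero X (cobd \<phi>)" using \<phi> by (auto simp: mem_as_relcocycles_empty)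
  have 1: "as_locally_zero X (as_cup_cochain p \<phi> (\<lambda>xs. \<psi> xs + cobd \<eta> xs))"
    by (rule as_locally_zero_cup) (simp add: \<eta>)
  have 2: "as_locally_zero X (as_cup_cochain (Suc p) (cobd \<phi>) \<eta>)"
    by (rule as_locally_zero_cup) (simp add: \<phi>')
  have "as_locally_zero X (\<lambda>xs. as_cup_cochain p \<phi> \<psi> xs + cobd (as_cup_cochain p \<phi> \<eta>) xs)"
    using as_locally_zero_add[OF 1 2] by (simp add: cup_add_right cobd_cup_cochain[where \<psi> = \<eta>, OF \<phi>'(1) \<eta>(1)] ac_simps)
  then show ?thesis
    unfolding null_cochain_def by (intro exI[of _ "as_cup_cochain p \<phi> \<eta>"]) (simp add: as_cup_cochain_def \<eta>)
qed

text \<open>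
  Leibniz for \<open>\<eta> \<union> \<psi>\<close> with \<open>\<delta>\<eta> = \<phi>\<close>.  In degree \<open>0\<close> there is no such \<open>\<eta>\<close>, and \<open>\<phi>\<close> is itself
  locally zero.
\<close>

lemma null_cup_left:
  assumes \<phi>: "\<phi> \<in> as_cochains (int p) X" "null_cochain X \<phi>" and \<psi>: "\<psi> \<in> as_relcocycles q X {}"
  shows "null_cochain X (as_cup_cochain p \<phi> \<psi>)"
proof -
  from \<phi>(2) obtain \<eta>0 where \<eta>0: "\<eta>0 [] = 0" "as_locally_zero X (\<lambda>xs. \<phi> xs + cobd \<eta>0 xs)"
    by (auto simp: null_cochain_def)
  define \<eta> where "\<eta> = truncate_cochain (int p - 1) X \<eta>0"
  have \<eta>: "\<eta> \<in> as_cochains (int p - 1) X" "as_locally_zero X (\<lambda>xs. \<phi> xs + cobd \<eta> xs)"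
    unfolding \<eta>_def by (rule truncate_cochain_in, rule as_locally_zero_add_cobd_truncate[OF \<phi>(1) \<eta>0])
  have \<psi>': "\<psi> [] = 0" "as_locally_zero X (cobd \<psi>)" using \<psi> as_cochains_Nil by (auto simp: mem_as_relcocycles_empty)
  have 1: "as_locally_zero X (as_cup_cochain p (\<lambda>xs. \<phi> xs + cobd \<eta> xs) \<psi>)"
    by (rule as_locally_zero_cup) (simp add: \<eta>)
  show ?thesis
  proof (cases p)
    case 0
    then have "\<eta> = (\<lambda>xs. 0)" using as_cochains_neg[OF _ \<eta>(1)] by simp
    then show ?thesis using 1 by (simp add: null_cochain_locally_zero)
  next
    case (Suc n)
    have \<eta>n: "\<eta> \<in> as_cochains (int n) X" using \<eta>(1) Suc by simp
    have 2: "as_locally_zero X (as_cup_cochain n \<eta> (cobd \<psi>))"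
      by (rule as_locally_zero_cup) (simp add: \<psi>')
    have "as_locally_zero X (\<lambda>xs. as_cup_cochain p \<phi> \<psi> xs + cobd (as_cup_cochain n \<eta> \<psi>) xs)"
      using as_locally_zero_add[OF 1 2] by (simp add: Suc cup_add_left cobd_cup_cochain[where \<psi> = \<psi>, OF \<eta>n \<psi>'(1)] ac_simps)
    then show ?thesis
      unfolding null_cochain_def by (intro exI[of _ "as_cup_cochain n \<eta> \<psi>"]) (simp add: as_cup_cochain_def \<psi>')
  qed
qed

lemma null_cup_cong:
  assumes \<phi>: "\<phi> \<in> as_relcocycles (int p) X {}" "\<phi>' \<in> as_relcocycles (int p) X {}" "null_cochain X (\<lambda>xs. \<phi> xs + \<phi>' xs)"
    and \<psi>: "\<psi> \<in> as_relcocycles q X {}" "null_cochain X (\<lambda>xs. \<psi> xs + \<psi>' xs)"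
  shows "null_cochain X (\<lambda>xs. as_cup_cochain p \<phi> \<psi> xs + as_cup_cochain p \<phi>' \<psi>' xs)"
proof -
  have 1: "null_cochain X (as_cup_cochain p (\<lambda>xs. \<phi> xs + \<phi>' xs) \<psi>)"
    using \<phi> by (intro null_cup_left[OF _ _ \<psi>(1)]) (auto simp: mem_as_relcocycles_empty as_cochains_add)
  have 2: "null_cochain X (as_cup_cochain p \<phi>' (\<lambda>xs. \<psi> xs + \<psi>' xs))"
    by (rule null_cup_right[OF \<phi>(2) \<psi>(2)])
  show ?thesis using null_cochain_add[OF 1 2] by (simp add: cup_add_left cup_add_right ac_simps)
qed

lemma as_cup_as_class:
  assumes \<phi>: "\<phi> \<in> as_relcocycles (int p) X {}" and \<psi>: "\<psi> \<in> as_relcocycles (int q) X {}"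
  shows "as_cup p q X (as_class (int p) X \<phi>) (as_class (int q) X \<psi>) = as_class (int (p + q)) X (as_cup_cochain p \<phi> \<psi>)"
proof -
  have eq: "as_class (int (p + q)) X (as_cup_cochain p \<phi>' \<psi>') = as_class (int (p + q)) X (as_cup_cochain p \<phi> \<psi>)"
    if a: "\<phi>' \<in> as_class (int p) X \<phi>" and b: "\<psi>' \<in> as_class (int q) X \<psi>" for \<phi>' \<psi>'
  proof -
    have \<phi>': "\<phi>' \<in> as_relcocycles (int p) X {}" "null_cochain X (\<lambda>xs. \<phi>' xs + \<phi> xs)"
      using a mem_as_class[OF \<phi>] as_class_eq_iff[OF _ \<phi>] by auto
    have \<psi>': "\<psi>' \<in> as_relcocycles (int q) X {}" "null_cochain X (\<lambda>xs. \<psi>' xs + \<psi> xs)"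
      using b mem_as_class[OF \<psi>] as_class_eq_iff[OF _ \<psi>] by auto
    show ?thesis
      using as_class_eq_iff[OF cup_cocycle[OF \<phi>'(1) \<psi>'(1)] cup_cocycle[OF \<phi> \<psi>]]
        null_cup_cong[OF \<phi>'(1) \<phi> \<phi>'(2) \<psi>'] by blast
  qed
  have "\<phi> \<in> as_class (int p) X \<phi>" "\<psi> \<in> as_class (int q) X \<psi>"
    using mem_as_class[OF \<phi>] mem_as_class[OF \<psi>] \<phi> \<psi> by blast+
  then show ?thesis unfolding as_cup_def using eq by blast
qed

definition unit_cochain :: "'a topology \<Rightarrow> 'a list \<Rightarrow> bit" where
  "unit_cochain X xs = (if length xs = 1 \<and> set xs \<subseteq> topspace X then 1 else 0)"

lemma unit_cochain_cocycle: "unit_cochain X \<in> as_relcocycles (int 0) X {}"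
  unfolding mem_as_relcocycles_empty
proof
  show "unit_cochain X \<in> as_cochains (int 0) X" by (auto simp: as_cochains_def unit_cochain_def)
  show "as_locally_zero X (cobd (unit_cochain X))"
  proof (rule as_locally_zero_cong[THEN iffD1, OF _ as_locally_zero_0])
    fix xs assume xs: "set xs \<subseteq> topspace X"
    show "0 = cobd (unit_cochain X) xs"
    proof (cases "length xs = 2")
      case True
      then have "cobd (unit_cochain X) xs = cobd (\<lambda>_. 1) xs"
        by (intro cobd_cong) (use xs in \<open>auto simp: unit_cochain_def\<close>)
      then show ?thesis using True by (simp add: cobd_const)
    qed (rule sym, rule cobd_eq_0, simp add: unit_cochain_def)
  qed
qed

primrec cup_power :: "'a topology \<Rightarrow> ('a list \<Rightarrow> bit) \<Rightarrow> nat \<Rightarrow> 'a list \<Rightarrow> bit" where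
  "cup_power X w 0 = unit_cochain X"
| "cup_power X w (Suc n) = as_cup_cochain n (cup_power X w n) w"

lemma cup_power_cocycle:
  assumes "w \<in> as_relcocycles 1 X {}"
  shows "cup_power X w n \<in> as_relcocycles (int n) X {}"
proof (induction n)
  case 0
  then show ?case using unit_cochain_cocycle[of X] by simp
next
  case (Suc n)
  then show ?case using cup_cocycle[of "cup_power X w n" n X w 1] assms by simp
qed

lemma as_power_as_class:
  assumes "w \<in> as_relcocycles 1 X {}"
  shows "as_power X (as_class 1 X w) n = as_class (int n) X (cup_power X w n)"
proof (induction n)
  case 0
  show ?case by (simp add: as_unit_def unit_cochain_def[abs_def])
next
  case (Suc n)
  then show ?case
    using as_cup_as_class[OF cup_power_cocycle[OF assms, of n], of w 1] assms by simp
qed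

lemma cup_power_cong:
  assumes "w \<in> as_relcocycles 1 X {}" "w' \<in> as_relcocycles 1 X {}" "null_cochain X (\<lambda>xs. w xs + w' xs)"
  shows "null_cochain X (\<lambda>xs. cup_power X w n xs + cup_power X w' n xs)"
proof (induction n)
  case 0
  then show ?case by (simp add: null_cochain_locally_zero)
next
  case (Suc n)
  then show ?case
    using null_cup_cong[OF cup_power_cocycle[OF assms(1)] cup_power_cocycle[OF assms(2)] Suc assms(1,3)] by simp
qed

lemma null_cup_power_mono:
  assumes "w \<in> as_relcocycles 1 X {}" "null_cochain X (cup_power X w m)" "m \<le> n"
  shows "null_cochain X (cup_power X w n)"
  using assms(3)
proof (induction n rule: dec_induct)
  case base
  then show ?case by (rule assms(2))
next
  case (step n)
  then show ?case
    using null_cup_left[of "cup_power X w n" n X w 1] cup_power_cocycle[OF assms(1)] assms(1)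
    by (simp add: mem_as_relcocycles_empty)
qed

lemma as_pullback_cup_power:
  assumes "\<And>x. x \<in> topspace X \<Longrightarrow> f x \<in> topspace Y"
  shows "set xs \<subseteq> topspace X \<Longrightarrow> cup_power X (as_pullback X f w) n xs = cup_power Y w n (map f xs)"
proof (induction n arbitrary: xs)
  case 0
  then show ?case using assms by (auto simp: unit_cochain_def)
next
  case (Suc n)
  have "set (take (Suc n) xs) \<subseteq> topspace X" "set (drop n xs) \<subseteq> topspace X"
    using Suc.prems set_take_subset[of "Suc n" xs] set_drop_subset[of n xs] by auto
  then show ?case using Suc.IH by (simp add: as_cup_cochain_def as_pullback_def take_map drop_map)
qed

lemma cup_assoc:
  "as_cup_cochain (p + q) (as_cup_cochain p \<phi> \<psi>) \<theta> xs = as_cup_cochain p \<phi> (as_cup_cochain q \<psi> \<theta>) xs"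
  by (simp add: as_cup_cochain_def drop_take add.commute min_def mult.assoc)

text \<open>
  A power in which the factors are allowed to be different representatives of the same class.
\<close>

primrec cup_list :: "'a topology \<Rightarrow> ('a list \<Rightarrow> bit) list \<Rightarrow> 'a list \<Rightarrow> bit" where
  "cup_list X [] = unit_cochain X"
| "cup_list X (\<phi> # \<phi>s) = as_cup_cochain 1 \<phi> (cup_list X \<phi>s)"

lemma cup_list_cocycle:
  "set \<phi>s \<subseteq> as_relcocycles 1 X {} \<Longrightarrow> cup_list X \<phi>s \<in> as_relcocycles (int (length \<phi>s)) X {}"
proof (induction \<phi>s)
  case Nil
  then show ?case using unit_cochain_cocycle[of X] by simp
next
  case (Cons \<phi> \<phi>s)
  then show ?case using cup_cocycle[of \<phi> 1 X "cup_list X \<phi>s" "length \<phi>s"] by simp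
qed

lemma cup_list_cong:
  assumes w: "w \<in> as_relcocycles 1 X {}"
    and "\<And>\<phi>. \<phi> \<in> set \<phi>s \<Longrightarrow> \<phi> \<in> as_relcocycles 1 X {} \<and> null_cochain X (\<lambda>xs. w xs + \<phi> xs)"
  shows "null_cochain X (\<lambda>xs. cup_list X (replicate (length \<phi>s) w) xs + cup_list X \<phi>s xs)"
  using assms(2)
proof (induction \<phi>s)
  case Nil
  then show ?case by (simp add: null_cochain_locally_zero)
next
  case (Cons \<phi> \<phi>s)
  have "set (replicate (length \<phi>s) w) \<subseteq> as_relcocycles 1 X {}" using w by auto
  from cup_list_cocycle[OF this] Cons w show ?case
    using null_cup_cong[of w 1 X \<phi> "cup_list X (replicate (length \<phi>s) w)" "int (length \<phi>s)" "cup_list X \<phi>s"] by simp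
qed

lemma cup_list_eq_0:
  assumes "\<phi> \<in> set \<phi>s" "\<And>ys. set ys \<subseteq> U \<Longrightarrow> \<phi> ys = 0" "set xs \<subseteq> U"
  shows "cup_list X \<phi>s xs = 0"
  using assms(1,3)
proof (induction \<phi>s arbitrary: xs)
  case (Cons \<phi>' \<phi>s)
  have sub: "set (take 2 xs) \<subseteq> U" "set (drop 1 xs) \<subseteq> U"
    using Cons.prems(2) set_take_subset[of 2 xs] set_drop_subset[of 1 xs] by auto
  show ?case
  proof (cases "\<phi>' = \<phi>")
    case True
    then show ?thesis using assms(2)[OF sub(1)] by (simp add: as_cup_cochain_def numeral_2_eq_2)
  next
    case False
    then show ?thesis using Cons.IH[OF _ sub(2)] Cons.prems(1) by (simp add: as_cup_cochain_def)
  qed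
qed simp

text \<open>
  Powers are built by multiplication from the right; the transfer argument needs the left factor.
\<close>

lemma cup_power_Suc_left:
  assumes w: "w \<in> as_cochains 1 X"
  shows "cup_power X w (Suc n) = as_cup_cochain 1 w (cup_power X w n)"
proof (induction n)
  case 0
  show ?case
  proof
    fix xs
    show "cup_power X w (Suc 0) xs = as_cup_cochain 1 w (cup_power X w 0) xs"
    proof (cases "length xs = 2 \<and> set xs \<subseteq> topspace X")
      case True
      then obtain x y where "xs = [x, y]" by (auto simp: numeral_2_eq_2 length_Suc_conv)
      with True show ?thesis by (simp add: as_cup_cochain_def unit_cochain_def)
    next
      case False
      then have "w xs = 0"
        using as_cochains_wrong_length[OF w, of xs] as_cochains_outside[OF w, of xs] by fastforce
      moreover have "w (take 2 xs) * unit_cochain X (drop 1 xs) = 0"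
      proof (rule ccontr)
        assume "w (take 2 xs) * unit_cochain X (drop 1 xs) \<noteq> 0"
        then have "w (take 2 xs) \<noteq> 0" "length (drop 1 xs) = 1" by (auto simp: unit_cochain_def split: if_splits)
        then have "length xs = 2" "w xs \<noteq> 0" by auto
        with \<open>w xs = 0\<close> show False by simp
      qed
      ultimately show ?thesis by (simp add: as_cup_cochain_def numeral_2_eq_2)
    qed
  qed
next
  case (Suc n)
  show ?case
  proof
    fix xs
    have "cup_power X w (Suc (Suc n)) xs = as_cup_cochain (1 + n) (as_cup_cochain 1 w (cup_power X w n)) w xs"
      using Suc by simp
    also have "\<dots> = as_cup_cochain 1 w (cup_power X w (Suc n)) xs"
      unfolding cup_assoc by simp
    finally show "cup_power X w (Suc (Suc n)) xs = as_cup_cochain 1 w (cup_power X w (Suc n)) xs" .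
  qed
qed

lemma cup_power_eq_cup_list:
  "w \<in> as_cochains 1 X \<Longrightarrow> cup_power X w n = cup_list X (replicate n w)"
proof (induction n)
  case (Suc n)
  then show ?case unfolding cup_power_Suc_left[OF Suc.prems] by simp
qed simp

text \<open>
  Change the \<open>i\<close>-th factor of \<open>w\<^sup>n\<close> by the coboundary of \<open>e\<^sub>i\<close>.  The class of the product stays the
  same, and near each point one of the new factors vanishes.
\<close>

theorem Lusternik_Schnirelmann_cup_length:
  assumes w: "w \<in> as_relcocycles 1 X {}"
    and e: "\<And>i. i < n \<Longrightarrow> e i \<in> as_cochains 0 X"
    and cover: "\<And>x. x \<in> topspace X \<Longrightarrow> \<exists>i<n. \<exists>U. openin X U \<and> x \<in> U \<and> (\<forall>xs. set xs \<subseteq> U \<longrightarrow> w xs + cobd (e i) xs = 0)"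
  shows "null_cochain X (cup_power X w n)"
proof -
  define \<phi> where "\<phi> i = (\<lambda>xs. w xs + as_coboundary X (e i) xs)" for i
  have \<phi>: "\<phi> i \<in> as_relcocycles 1 X {}" "null_cochain X (\<lambda>xs. w xs + \<phi> i xs)" if "i < n" for i
  proof -
    have "as_coboundary X (e i) \<in> as_relcocycles 1 X {}"
      using as_coboundary_relcocycle[of "e i" 1 X "{}"] e[OF that] by simp
    then show "\<phi> i \<in> as_relcocycles 1 X {}" unfolding \<phi>_def by (rule as_relcocycles_add[OF w])
    have "null_cochain X (cobd (e i))" by (rule null_cochain_cobd) (rule as_cochains_Nil[OF e[OF that]])
    then show "null_cochain X (\<lambda>xs. w xs + \<phi> i xs)"
      by (rule null_cochain_cong[THEN iffD1, rotated]) (simp add: \<phi>_def as_coboundary_eq)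
  qed
  let ?\<phi>s = "map \<phi> [0..<n]"
  have "null_cochain X (\<lambda>xs. cup_list X (replicate (length ?\<phi>s) w) xs + cup_list X ?\<phi>s xs)"
    by (rule cup_list_cong[OF w]) (use \<phi> in auto)
  moreover have "as_locally_zero X (cup_list X ?\<phi>s)"
    unfolding as_locally_zero_iff
  proof
    fix x assume "x \<in> topspace X"
    then obtain i U where i: "i < n" and U: "openin X U" "x \<in> U" "\<And>xs. set xs \<subseteq> U \<Longrightarrow> w xs + cobd (e i) xs = 0"
      using cover by blast
    have "\<phi> i ys = 0" if "set ys \<subseteq> U" for ys
      using U(3)[OF that] that openin_subset[OF U(1)] by (simp add: \<phi>_def as_coboundary_eq)
    then have "cup_list X ?\<phi>s xs = 0" if "set xs \<subseteq> U" for xs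
      using cup_list_eq_0[of "\<phi> i" ?\<phi>s U xs X] that i by simp
    then show "\<exists>U. openin X U \<and> x \<in> U \<and> (\<forall>xs. set xs \<subseteq> U \<longrightarrow> cup_list X ?\<phi>s xs = 0)"
      using U by blast
  qed
  ultimately show ?thesis
    using null_cochain_add_cancel null_cochain_locally_zero cup_power_eq_cup_list w
    by (fastforce simp: mem_as_relcocycles_empty)
qed

section \<open>The characteristic class of an antipodal double covering\<close>

definition orbit :: "'a::uminus \<Rightarrow> 'a set" where
  "orbit x = {x, - x}"

text \<open>
  The law \<open>- (- x) = x\<close> is part of the definition because the type class only provides the symbol.
\<close>

definition antipodal_space :: "'a::uminus topology \<Rightarrow> bool" where
  "antipodal_space X \<longleftrightarrow> (\<forall>x\<in>topspace X. - (- x) = x) \<and> continuous_map X X uminus"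

lemma antipodal_spaceD:
  assumes "antipodal_space X"
  shows "x \<in> topspace X \<Longrightarrow> - x \<in> topspace X" "x \<in> topspace X \<Longrightarrow> - (- x) = x"
    "continuous_map X X uminus" "x \<in> topspace X \<Longrightarrow> orbit (- x) = orbit x"
proof -
  show cont: "continuous_map X X uminus" and m: "x \<in> topspace X \<Longrightarrow> - (- x) = x" for x
    using assms by (auto simp: antipodal_space_def)
  show "x \<in> topspace X \<Longrightarrow> - x \<in> topspace X" using continuous_map_image_subset_topspace[OF cont] by blast
  show "x \<in> topspace X \<Longrightarrow> orbit (- x) = orbit x" using m by (auto simp: orbit_def)
qed

lemma openin_antipodal_quotient_orbit:
  "openin (antipodal_quotient X) V \<longleftrightarrow>
     V \<subseteq> orbit ` topspace X \<and> openin X {x \<in> topspace X. orbit x \<in> V}"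
  by (simp add: openin_antipodal_quotient orbit_def[abs_def])

lemma topspace_antipodal_quotient [simp]: "topspace (antipodal_quotient X) = orbit ` topspace X"
proof
  show "topspace (antipodal_quotient X) \<subseteq> orbit ` topspace X"
    using openin_antipodal_quotient_orbit[of X "topspace (antipodal_quotient X)"] openin_topspace by blast
  have "{x \<in> topspace X. orbit x \<in> orbit ` topspace X} = topspace X" by auto
  then have "openin (antipodal_quotient X) (orbit ` topspace X)"
    by (simp add: openin_antipodal_quotient_orbit)
  then show "orbit ` topspace X \<subseteq> topspace (antipodal_quotient X)" by (rule openin_subset)
qed

lemma continuous_map_orbit: "continuous_map X (antipodal_quotient X) orbit"
  unfolding continuous_map by (auto simp: openin_antipodal_quotient_orbit)

lemma openin_orbit_image:
  assumes X: "antipodal_space X" and V: "openin X V"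
  shows "openin (antipodal_quotient X) (orbit ` V)"
  unfolding openin_antipodal_quotient_orbit
proof
  have sub: "V \<subseteq> topspace X" by (rule openin_subset[OF V])
  then show "orbit ` V \<subseteq> orbit ` topspace X" by blast
  have "{x \<in> topspace X. orbit x \<in> orbit ` V} = V \<union> {x \<in> topspace X. - x \<in> V}"
  proof (intro equalityI subsetI)
    fix x assume "x \<in> {x \<in> topspace X. orbit x \<in> orbit ` V}"
    then obtain y where "x \<in> topspace X" "y \<in> V" "{x, - x} = {y, - y}" by (auto simp: orbit_def)
    then show "x \<in> V \<union> {x \<in> topspace X. - x \<in> V}" by (auto simp: doubleton_eq_iff)
  next
    fix x assume "x \<in> V \<union> {x \<in> topspace X. - x \<in> V}"
    then show "x \<in> {x \<in> topspace X. orbit x \<in> orbit ` V}"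
      using sub antipodal_spaceD(4)[OF X, of x, symmetric] by (auto simp: image_iff)
  qed
  then show "openin X {x \<in> topspace X. orbit x \<in> orbit ` V}"
    using openin_continuous_map_preimage[OF antipodal_spaceD(3)[OF X] V] V by (simp add: openin_Un)
qed

text \<open>
  The projection is open, and lists in the image of a set lift to lists in that set.
\<close>

lemma as_locally_zero_antipodal_quotient:
  assumes X: "antipodal_space X" and \<phi>: "as_locally_zero X (\<lambda>xs. \<phi> (map orbit xs))"
  shows "as_locally_zero (antipodal_quotient X) \<phi>"
  unfolding as_locally_zero_iff
proof
  fix a assume "a \<in> topspace (antipodal_quotient X)"
  then obtain x where x: "x \<in> topspace X" "a = orbit x" by auto
  obtain V where V: "openin X V" "x \<in> V" "\<And>xs. set xs \<subseteq> V \<Longrightarrow> \<phi> (map orbit xs) = 0"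
    using as_locally_zeroE[OF \<phi> x(1)] by metis
  have "\<phi> as = 0" if "set as \<subseteq> orbit ` V" for as
  proof -
    have "as \<in> map orbit ` {xs. set xs \<subseteq> V}"
      using that lists_image[of orbit V] unfolding lists_eq_set by blast
    then obtain xs where "as = map orbit xs" "set xs \<subseteq> V" by blast
    then show ?thesis using V(3) by simp
  qed
  then show "\<exists>U. openin (antipodal_quotient X) U \<and> a \<in> U \<and> (\<forall>as. set as \<subseteq> U \<longrightarrow> \<phi> as = 0)"
    using openin_orbit_image[OF X V(1)] V(2) x(2) by blast
qed

definition point_cochain :: "'a topology \<Rightarrow> ('a \<Rightarrow> bit) \<Rightarrow> 'a list \<Rightarrow> bit" where
  "point_cochain X \<epsilon> xs = (if length xs = 1 \<and> set xs \<subseteq> topspace X then \<epsilon> (hd xs) else 0)"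

lemma point_cochain_in: "point_cochain X \<epsilon> \<in> as_cochains 0 X"
  by (auto simp: point_cochain_def as_cochains_def)

lemma point_cochain_simps [simp]:
  "point_cochain X \<epsilon> [] = 0" "x \<in> topspace X \<Longrightarrow> point_cochain X \<epsilon> [x] = \<epsilon> x"
  by (auto simp: point_cochain_def)

text \<open>
  \<open>w\<close> records whether nearby orbits have their chosen representatives on the same sheet: the
  function \<open>\<epsilon>\<close> numbers the two sheets over each orbit, and locally
  \<open>w({y, - y}, {z, - z}) = \<epsilon>(y) + \<epsilon>(z)\<close>.
\<close>

definition sheet_cochain :: "'a::uminus topology \<Rightarrow> ('a set list \<Rightarrow> bit) \<Rightarrow> bool" where
  "sheet_cochain X w \<longleftrightarrow> w \<in> as_cochains 1 (antipodal_quotient X) \<and>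
     (\<exists>\<epsilon>. (\<forall>x\<in>topspace X. \<epsilon> (- x) = \<epsilon> x + 1) \<and>
          as_locally_zero X (\<lambda>xs. w (map orbit xs) + cobd (point_cochain X \<epsilon>) xs))"

lemma sheet_cochain_cocycle:
  assumes X: "antipodal_space X" and w: "sheet_cochain X w"
  shows "w \<in> as_relcocycles 1 (antipodal_quotient X) {}"
proof -
  obtain \<epsilon> where "as_locally_zero X (\<lambda>xs. w (map orbit xs) + cobd (point_cochain X \<epsilon>) xs)"
    using w by (auto simp: sheet_cochain_def)
  from as_locally_zero_cobd[OF this] have "as_locally_zero X (\<lambda>xs. cobd w (map orbit xs))"
    by (simp add: cobd_add cobd_map[abs_def])
  then show ?thesis
    using w as_locally_zero_antipodal_quotient[OF X] by (simp add: sheet_cochain_def mem_as_relcocycles_empty)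
qed

lemma even_function_descends:
  assumes X: "antipodal_space X" and even: "\<And>x. x \<in> topspace X \<Longrightarrow> \<delta> (- x) = \<delta> x" and x: "x \<in> topspace X"
  shows "\<delta> (SOME y. y \<in> orbit x) = \<delta> x"
proof -
  have "(SOME y. y \<in> orbit x) \<in> orbit x" by (rule someI[of _ x]) (simp add: orbit_def)
  then show ?thesis using even[OF x] by (auto simp: orbit_def)
qed

text \<open>
  The sum of two sheet numberings is even, so it descends to the quotient and cobounds the
  difference.
\<close>

lemma sheet_cochain_unique:
  assumes X: "antipodal_space X" and w: "sheet_cochain X w" "sheet_cochain X w'"
  shows "null_cochain (antipodal_quotient X) (\<lambda>xs. w xs + w' xs)"
proof -
  let ?Q = "antipodal_quotient X"
  obtain \<epsilon> \<epsilon>' where odd: "\<forall>x\<in>topspace X. \<epsilon> (- x) = \<epsilon> x + 1" "\<forall>x\<in>topspace X. \<epsilon>' (- x) = \<epsilon>' x + 1"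
    and lz: "as_locally_zero X (\<lambda>xs. w (map orbit xs) + cobd (point_cochain X \<epsilon>) xs)"
      "as_locally_zero X (\<lambda>xs. w' (map orbit xs) + cobd (point_cochain X \<epsilon>') xs)"
    using w by (auto simp: sheet_cochain_def)
  define \<delta> where "\<delta> x = \<epsilon> x + \<epsilon>' x" for x
  have \<delta>: "\<delta> (SOME y. y \<in> orbit x) = \<delta> x" if "x \<in> topspace X" for x
    by (rule even_function_descends[OF X _ that]) (simp add: \<delta>_def odd ac_simps)
  define d where "d = point_cochain ?Q (\<lambda>a. \<delta> (SOME y. y \<in> a))"
  have d: "d (map orbit xs) = point_cochain X \<epsilon> xs + point_cochain X \<epsilon>' xs" if "set xs \<subseteq> topspace X" for xs
    using that \<delta> by (cases xs) (auto simp: d_def point_cochain_def \<delta>_def)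
  have "as_locally_zero X (\<lambda>xs. (\<lambda>as. w as + w' as + cobd d as) (map orbit xs))"
    using as_locally_zero_add[OF lz]
  proof (rule as_locally_zero_cong[THEN iffD1, rotated])
    fix xs assume xs: "set xs \<subseteq> topspace X"
    have "cobd d (map orbit xs) = cobd (\<lambda>xs. point_cochain X \<epsilon> xs + point_cochain X \<epsilon>' xs) xs"
      unfolding cobd_map[symmetric] by (rule cobd_cong) (rule d, use xs in blast)
    then show "w (map orbit xs) + cobd (point_cochain X \<epsilon>) xs + (w' (map orbit xs) + cobd (point_cochain X \<epsilon>') xs) =
        w (map orbit xs) + w' (map orbit xs) + cobd d (map orbit xs)"
      by (simp add: cobd_add ac_simps)
  qed
  from as_locally_zero_antipodal_quotient[OF X this]
  show ?thesis unfolding null_cochain_def by (intro exI[of _ d]) (simp add: d_def)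
qed

lemma sheet_cochain_pullback:
  assumes g: "continuous_map X Y g" "\<And>x. x \<in> topspace X \<Longrightarrow> g (- x) = - g x"
    and f: "\<And>x. x \<in> topspace X \<Longrightarrow> f (orbit x) = orbit (g x)"
    and w: "sheet_cochain Y w"
  shows "sheet_cochain X (as_pullback (antipodal_quotient X) f w)"
proof -
  obtain \<epsilon> where odd: "\<forall>y\<in>topspace Y. \<epsilon> (- y) = \<epsilon> y + 1"
    and lz: "as_locally_zero Y (\<lambda>xs. w (map orbit xs) + cobd (point_cochain Y \<epsilon>) xs)"
    using w by (auto simp: sheet_cochain_def)
  have gY: "g x \<in> topspace Y" if "x \<in> topspace X" for x
    using continuous_map_image_subset_topspace[OF g(1)] that by blast
  have "as_locally_zero X (\<lambda>xs. as_pullback (antipodal_quotient X) f w (map orbit xs) + cobd (point_cochain X (\<lambda>x. \<epsilon> (g x))) xs)"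
    using as_locally_zero_map[OF lz g(1)]
  proof (rule as_locally_zero_cong[THEN iffD1, rotated])
    fix xs assume xs: "set xs \<subseteq> topspace X"
    then have 1: "map f (map orbit xs) = map orbit (map g xs)" using f by auto
    have "cobd (point_cochain Y \<epsilon>) (map g xs) = cobd (point_cochain X (\<lambda>x. \<epsilon> (g x))) xs"
      unfolding cobd_map[symmetric]
    proof (rule cobd_cong)
      fix ys assume "set ys \<subseteq> set xs"
      then have "set ys \<subseteq> topspace X" "g ` set ys \<subseteq> topspace Y" using xs gY by blast+
      then show "point_cochain Y \<epsilon> (map g ys) = point_cochain X (\<lambda>x. \<epsilon> (g x)) ys"
        by (cases ys) (auto simp: point_cochain_def)
    qed
    moreover have "as_pullback (antipodal_quotient X) f w (map orbit xs) = w (map orbit (map g xs))"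
      unfolding 1[symmetric] using xs by (simp add: as_pullback_def image_mono)
    ultimately show "w (map orbit (map g xs)) + cobd (point_cochain Y \<epsilon>) (map g xs) =
       as_pullback (antipodal_quotient X) f w (map orbit xs) + cobd (point_cochain X (\<lambda>x. \<epsilon> (g x))) xs"
      by (simp only:)
  qed
  moreover have "as_pullback (antipodal_quotient X) f w \<in> as_cochains 1 (antipodal_quotient X)"
    using w by (intro as_pullback_cochain[where Y = "antipodal_quotient Y"]) (simp add: sheet_cochain_def)
  ultimately show ?thesis
    using odd gY g(2) unfolding sheet_cochain_def by (intro conjI exI[of _ "\<lambda>x. \<epsilon> (g x)"]) auto
qed

text \<open>
  Where \<open>h\<^sub>i \<noteq> 0\<close>, the sign of \<open>h\<^sub>i\<close> is a locally constant choice of sheet.  Adding it to \<open>\<epsilon>\<close> gives an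
  even function, whose coboundary on the quotient is \<open>w\<close> there.
\<close>

theorem odd_functions_cup_power_null:
  fixes h :: "nat \<Rightarrow> 'a::uminus \<Rightarrow> real"
  assumes X: "antipodal_space X" and w: "sheet_cochain X w"
    and h: "\<And>i. i < n \<Longrightarrow> continuous_map X euclideanreal (h i)"
    and odd: "\<And>i x. i < n \<Longrightarrow> x \<in> topspace X \<Longrightarrow> h i (- x) = - h i x"
    and nz: "\<And>x. x \<in> topspace X \<Longrightarrow> \<exists>i<n. h i x \<noteq> 0"
  shows "null_cochain (antipodal_quotient X) (cup_power (antipodal_quotient X) w n)"
proof -
  let ?Q = "antipodal_quotient X"
  obtain \<epsilon> where \<epsilon>: "\<forall>x\<in>topspace X. \<epsilon> (- x) = \<epsilon> x + 1"
    and lz: "as_locally_zero X (\<lambda>xs. w (map orbit xs) + cobd (point_cochain X \<epsilon>) xs)"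
    using w by (auto simp: sheet_cochain_def)
  define \<delta> where "\<delta> i x = \<epsilon> x + (if h i x < 0 then 1 else 0)" for i x
  define e where "e i = point_cochain ?Q (\<lambda>a. \<delta> i (SOME x. x \<in> a))" for i
  have e_eq: "e i [orbit x] = \<delta> i x" if "i < n" "x \<in> topspace X" "h i x \<noteq> 0" for i x
  proof -
    have "(SOME y. y \<in> orbit x) \<in> orbit x" by (rule someI[of _ x]) (simp add: orbit_def)
    moreover have "\<delta> i (- x) = \<delta> i x" using that \<epsilon> odd by (auto simp: \<delta>_def)
    ultimately have "\<delta> i (SOME y. y \<in> orbit x) = \<delta> i x" by (auto simp: orbit_def)
    then show ?thesis using that by (simp add: e_def)
  qed
  show ?thesis
  proof (rule Lusternik_Schnirelmann_cup_length)
    show "w \<in> as_relcocycles 1 ?Q {}" by (rule sheet_cochain_cocycle[OF X w])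
    show "e i \<in> as_cochains 0 ?Q" for i unfolding e_def by (rule point_cochain_in)
    fix a assume "a \<in> topspace ?Q"
    then obtain x where x: "x \<in> topspace X" "a = orbit x" by auto
    obtain i where i: "i < n" "h i x \<noteq> 0" using nz[OF x(1)] by blast
    obtain V where V: "openin X V" "x \<in> V" "\<And>xs. set xs \<subseteq> V \<Longrightarrow> w (map orbit xs) + cobd (point_cochain X \<epsilon>) xs = 0"
      using as_locally_zeroE[OF lz x(1)] by metis
    define S :: "real set" where "S = (if h i x < 0 then {..<0} else {0<..})"
    define V' where "V' = V \<inter> {y \<in> topspace X. h i y \<in> S}"
    have "openin X {y \<in> topspace X. h i y \<in> S}"
      by (rule openin_continuous_map_preimage[OF h[OF i(1)]]) (simp add: S_def)
    then have V': "openin X V'" "x \<in> V'" using V i x by (auto simp: V'_def S_def)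
    have "w as + cobd (e i) as = 0" if "set as \<subseteq> orbit ` V'" for as
    proof -
      have "as \<in> map orbit ` {xs. set xs \<subseteq> V'}"
        using that lists_image[of orbit V'] unfolding lists_eq_set by blast
      then obtain xs where as: "as = map orbit xs" and xs: "set xs \<subseteq> V'" by blast
      have xsX: "set xs \<subseteq> topspace X" using xs openin_subset[OF V'(1)] by blast
      define s where "s = (if h i x < 0 then 1 else 0 :: bit)"
      have e': "e i (map orbit ys) = point_cochain X \<epsilon> ys + point_cochain X (\<lambda>_. s) ys"
        if ys: "set ys \<subseteq> set xs" for ys
      proof (cases "length ys = 1")
        case True
        then obtain y where "ys = [y]" by (auto simp: length_Suc_conv)
        then have "y \<in> V'" "y \<in> topspace X" "ys = [y]" using ys xs xsX by auto
        then show ?thesis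
          using e_eq[OF i(1), of y] by (auto simp: \<delta>_def s_def V'_def S_def split: if_splits)
      qed (simp add: e_def point_cochain_def)
      have "cobd (point_cochain X (\<lambda>_. s)) xs = 0"
      proof (cases "length xs = 2")
        case True
        then have "cobd (point_cochain X (\<lambda>_. s)) xs = cobd (\<lambda>_. s) xs"
          by (intro cobd_cong) (use xsX in \<open>auto simp: point_cochain_def\<close>)
        then show ?thesis using True by (simp add: cobd_const)
      qed (rule cobd_eq_0, simp add: point_cochain_def)
      moreover have "cobd (e i) as = cobd (\<lambda>ys. point_cochain X \<epsilon> ys + point_cochain X (\<lambda>_. s) ys) xs"
        unfolding as cobd_map[symmetric] by (rule cobd_cong) (rule e')
      ultimately show ?thesis
        using V(3)[of xs] xs as by (auto simp: cobd_add V'_def)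
    qed
    then show "\<exists>i<n. \<exists>U. openin ?Q U \<and> a \<in> U \<and> (\<forall>xs. set xs \<subseteq> U \<longrightarrow> w xs + cobd (e i) xs = 0)"
      using i(1) openin_orbit_image[OF X V'(1)] V'(2) x(2) by blast
  qed
qed

text \<open>
  If \<open>w\<^sup>k\<^sup>+\<^sup>1 = \<delta>\<eta>\<close> on the quotient and \<open>p\<^sup>*w = \<delta>\<epsilon>\<close> on \<open>X\<close>, where \<open>p\<close> is the projection, then
  \<open>\<xi> = p\<^sup>*\<eta> + \<epsilon> \<union> p\<^sup>*w\<^sup>k\<close> is a cocycle.  Its transfer, the sum of \<open>\<xi>\<close> and its antipodal image, is
  \<open>p\<^sup>*w\<^sup>k\<close>, because \<open>\<epsilon>\<close> changes by \<open>1\<close>.  If \<open>\<xi>\<close> were \<open>\<delta>\<zeta>\<close> up to a constant, the constant would cancel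
  in the transfer and the transfer of \<open>\<zeta>\<close> would show that \<open>w\<^sup>k = 0\<close>.
\<close>

theorem transfer_nontrivial:
  assumes X: "antipodal_space X" and w: "sheet_cochain X w"
    and null: "null_cochain (antipodal_quotient X) (cup_power (antipodal_quotient X) w (Suc k))"
    and nonnull: "\<not> null_cochain (antipodal_quotient X) (cup_power (antipodal_quotient X) w k)"
  obtains \<xi> where "\<xi> \<in> as_relcocycles (int k) X {}" "\<not> reduced_null X \<xi>"
proof -
  let ?Q = "antipodal_quotient X"
  define W where "W = cup_power ?Q w k"
  have wc: "w \<in> as_relcocycles 1 ?Q {}" by (rule sheet_cochain_cocycle[OF X w])
  have W: "W \<in> as_cochains (int k) ?Q" "as_locally_zero ?Q (cobd W)"
    using cup_power_cocycle[OF wc, of k] by (auto simp: W_def mem_as_relcocycles_empty)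
  have W1: "cup_power ?Q w (Suc k) = as_cup_cochain 1 w W"
    unfolding W_def using wc by (intro cup_power_Suc_left) (simp add: mem_as_relcocycles_empty)
  obtain \<epsilon> where odd: "\<forall>x\<in>topspace X. \<epsilon> (- x) = \<epsilon> x + 1"
    and lz: "as_locally_zero X (\<lambda>xs. w (map orbit xs) + cobd (point_cochain X \<epsilon>) xs)"
    using w by (auto simp: sheet_cochain_def)
  define e where "e = point_cochain X \<epsilon>"
  obtain \<eta> where \<eta>: "\<eta> \<in> as_cochains (int k) ?Q" "as_locally_zero ?Q (\<lambda>xs. as_cup_cochain 1 w W xs + cobd \<eta> xs)"
  proof -
    obtain \<eta>0 where "\<eta>0 [] = 0" "as_locally_zero ?Q (\<lambda>xs. as_cup_cochain 1 w W xs + cobd \<eta>0 xs)"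
      using null unfolding W1 null_cochain_def by blast
    moreover have "as_cup_cochain 1 w W \<in> as_cochains (int (Suc k)) ?Q"
      using cup_power_cocycle[OF wc, of "Suc k"] unfolding W1 by (simp add: mem_as_relcocycles_empty)
    ultimately have "as_locally_zero ?Q (\<lambda>xs. as_cup_cochain 1 w W xs + cobd (truncate_cochain (int (Suc k) - 1) ?Q \<eta>0) xs)"
      using as_locally_zero_add_cobd_truncate[of "as_cup_cochain 1 w W" "int (Suc k)" ?Q \<eta>0] by blast
    then show ?thesis using that[of "truncate_cochain (int (Suc k) - 1) ?Q \<eta>0"] truncate_cochain_in[of "int k" ?Q] by simp
  qed
  define W' where "W' = (\<lambda>xs. W (map orbit xs))"
  define w' where "w' = (\<lambda>xs. w (map orbit xs))"
  have W'0: "W' [] = 0" using as_cochains_Nil[OF W(1)] by (simp add: W'_def)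
  have e0: "e \<in> as_cochains (int 0) X" using point_cochain_in by (simp add: e_def)
  define \<xi>0 where "\<xi>0 = (\<lambda>xs. \<eta> (map orbit xs) + as_cup_cochain 0 e W' xs)"
  define \<xi> where "\<xi> = truncate_cochain (int k) X \<xi>0"
  have \<xi>_eq: "\<xi> xs = \<xi>0 xs" if "set xs \<subseteq> topspace X" for xs
  proof (cases "length xs = Suc k")
    case True
    then show ?thesis using that by (auto simp: \<xi>_def truncate_cochain_def)
  next
    case False
    then have "\<eta> (map orbit xs) = 0" "W' xs = 0"
      using as_cochains_wrong_length[OF \<eta>(1), of "map orbit xs"] as_cochains_wrong_length[OF W(1), of "map orbit xs"]
      by (auto simp: W'_def)
    then show ?thesis using False by (simp add: \<xi>_def \<xi>0_def truncate_cochain_def as_cup_cochain_def)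
  qed
  have "as_locally_zero X (cobd \<xi>0)"
  proof -
    have A: "as_locally_zero X (\<lambda>xs. as_cup_cochain 1 w' W' xs + cobd \<eta> (map orbit xs))"
      using as_locally_zero_map[OF \<eta>(2) continuous_map_orbit]
      by (simp add: as_cup_cochain_def w'_def W'_def take_map drop_map)
    have B: "as_locally_zero X (as_cup_cochain 1 (\<lambda>xs. w' xs + cobd e xs) W')"
      by (rule as_locally_zero_cup) (use lz in \<open>simp add: w'_def e_def\<close>)
    have "as_locally_zero X (cobd W')"
      using as_locally_zero_map[OF W(2) continuous_map_orbit] by (simp add: W'_def cobd_map[abs_def])
    then have C: "as_locally_zero X (as_cup_cochain 0 e (cobd W'))"
      by (intro as_locally_zero_cup) simp
    have "cobd \<xi>0 = (\<lambda>xs. (as_cup_cochain 1 w' W' xs + cobd \<eta> (map orbit xs)) +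
        as_cup_cochain 1 (\<lambda>xs. w' xs + cobd e xs) W' xs + as_cup_cochain 0 e (cobd W') xs)"
      unfolding \<xi>0_def cobd_add cobd_cup_cochain[where \<psi> = W', OF e0 W'0]
      by (rule ext) (simp add: cup_add_left cobd_map ac_simps)
    then show ?thesis using as_locally_zero_add[OF as_locally_zero_add[OF A B] C] by simp
  qed
  moreover have "as_locally_zero X (cobd \<xi>) = as_locally_zero X (cobd \<xi>0)"
    by (intro as_locally_zero_cong cobd_cong \<xi>_eq) blast
  ultimately have \<xi>_cocycle: "\<xi> \<in> as_relcocycles (int k) X {}"
    unfolding mem_as_relcocycles_empty \<xi>_def using truncate_cochain_in by blast
  have "\<not> reduced_null X \<xi>"
  proof
    assume "reduced_null X \<xi>"
    then obtain \<zeta> where \<zeta>: "as_locally_zero X (\<lambda>xs. \<xi> xs + cobd \<zeta> xs)" by (auto simp: reduced_null_def)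
    define Z where "Z = (\<lambda>xs. \<zeta> xs + \<zeta> (map uminus xs))"
    have C: "as_locally_zero X (\<lambda>xs. W (map orbit xs) + cobd Z xs)"
      using as_locally_zero_add[OF \<zeta> as_locally_zero_map[OF \<zeta> antipodal_spaceD(3)[OF X]]]
    proof (rule as_locally_zero_cong[THEN iffD1, rotated])
      fix xs assume xs: "set xs \<subseteq> topspace X"
      then have mX: "set (map uminus xs) \<subseteq> topspace X" using antipodal_spaceD(1)[OF X] by auto
      have mo: "map orbit (map uminus xs) = map orbit xs" using xs antipodal_spaceD(4)[OF X] by auto
      have "\<xi> xs + \<xi> (map uminus xs) = W (map orbit xs)"
      proof (cases xs)
        case Nil
        then show ?thesis using W'0 by (simp add: \<xi>_def truncate_cochain_def W'_def)
      next
        case (Cons x ys)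
        have "\<xi> xs + \<xi> (map uminus xs) = (e [x] + e [- x]) * W (map orbit xs)"
          unfolding \<xi>_eq[OF xs] \<xi>_eq[OF mX] \<xi>0_def W'_def as_cup_cochain_def mo drop_0
          by (simp add: Cons algebra_simps)
        also have "e [x] + e [- x] = 1"
          using Cons xs mX odd by (auto simp: e_def)
        finally show ?thesis by simp
      qed
      moreover have "cobd Z xs = cobd \<zeta> xs + cobd \<zeta> (map uminus xs)" by (simp add: Z_def cobd_add cobd_map)
      ultimately show "\<xi> xs + cobd \<zeta> xs + (\<xi> (map uminus xs) + cobd \<zeta> (map uminus xs)) = W (map orbit xs) + cobd Z xs"
        by (simp add: ac_simps)
    qed
    \<comment> \<open>Lifts a tuple of orbits sheet by sheet, starting with any lift of its first entry; the other choice of that lift changes all signs, and \<open>Z\<close> is even.\<close>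
    define lift where "lift as = (let x0 = SOME x. x \<in> hd as in
        map (\<lambda>a. SOME x. x \<in> a \<and> \<epsilon> x = \<epsilon> x0 + w [hd as, a]) as)" for as :: "'a set list"
    define \<theta> where "\<theta> as = Z (lift as)" for as
    have Z_even: "Z (map uminus xs) = Z xs" if "set xs \<subseteq> topspace X" for xs
    proof -
      have "map (uminus \<circ> uminus) xs = xs" using that antipodal_spaceD(2)[OF X] by (induction xs) auto
      then show ?thesis by (simp add: Z_def ac_simps)
    qed
    have lift: "\<theta> (map orbit xs) = Z xs"
      if xs: "set xs \<subseteq> topspace X" and small: "\<And>x y. x \<in> set xs \<Longrightarrow> y \<in> set xs \<Longrightarrow> w [orbit x, orbit y] = \<epsilon> x + \<epsilon> y" for xs
    proof (cases xs)
      case Nil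
      then show ?thesis by (simp add: \<theta>_def lift_def)
    next
      case (Cons x ys)
      then have x: "x \<in> topspace X" "x \<in> set xs" using xs by auto
      define x0 where "x0 = (SOME y. y \<in> orbit x)"
      have "x0 \<in> orbit x" unfolding x0_def by (rule someI[of _ x]) (simp add: orbit_def)
      then consider "x0 = x" | "x0 = - x" by (auto simp: orbit_def)
      then show ?thesis
      proof cases
        case 1
        have "(SOME z. z \<in> orbit y \<and> \<epsilon> z = \<epsilon> x0 + w [orbit x, orbit y]) = y" if "y \<in> set xs" for y
        proof (rule some_equality)
          have "w [orbit x, orbit y] = \<epsilon> x + \<epsilon> y" by (rule small[OF x(2) that])
          then have "\<epsilon> y = \<epsilon> x0 + w [orbit x, orbit y]" by (simp add: 1)
          then show "y \<in> orbit y \<and> \<epsilon> y = \<epsilon> x0 + w [orbit x, orbit y]" by (simp add: orbit_def)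
          fix z assume z: "z \<in> orbit y \<and> \<epsilon> z = \<epsilon> x0 + w [orbit x, orbit y]"
          then have "\<epsilon> z = \<epsilon> y" by (simp add: 1 \<open>w [orbit x, orbit y] = _\<close>)
          then show "z = y" using z odd that xs by (cases "\<epsilon> y") (auto simp: orbit_def)
        qed
        then have "lift (map orbit xs) = xs"
          unfolding lift_def using Cons by (simp add: x0_def[symmetric] Let_def map_idI)
        then show ?thesis by (simp add: \<theta>_def)
      next
        case 2
        have "(SOME z. z \<in> orbit y \<and> \<epsilon> z = \<epsilon> x0 + w [orbit x, orbit y]) = - y" if "y \<in> set xs" for y
        proof (rule some_equality)
          have y: "y \<in> topspace X" using that xs by blast
          have eq: "w [orbit x, orbit y] = \<epsilon> x + \<epsilon> y" by (rule small[OF x(2) that])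
          have x0: "\<epsilon> x0 = \<epsilon> x + 1" using odd x(1) by (simp add: 2)
          have "\<epsilon> (- y) = \<epsilon> x0 + w [orbit x, orbit y]"
            using odd y by (simp add: eq x0 ac_simps)
          then show "- y \<in> orbit y \<and> \<epsilon> (- y) = \<epsilon> x0 + w [orbit x, orbit y]"
            by (simp add: orbit_def)
          fix z assume z: "z \<in> orbit y \<and> \<epsilon> z = \<epsilon> x0 + w [orbit x, orbit y]"
          then have "\<epsilon> z = \<epsilon> y + 1" by (simp add: eq x0 ac_simps)
          then show "z = - y" using z by (cases "\<epsilon> y") (auto simp: orbit_def)
        qed
        then have "lift (map orbit xs) = map uminus xs"
          unfolding lift_def using Cons by (simp add: x0_def[symmetric] Let_def)
        then show ?thesis using Z_even[OF xs] by (simp add: \<theta>_def)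
      qed
    qed
    have "as_locally_zero X (\<lambda>xs. (\<lambda>as. W as + cobd \<theta> as) (map orbit xs))"
      unfolding as_locally_zero_iff
    proof
      fix x assume x: "x \<in> topspace X"
      obtain U where U: "openin X U" "x \<in> U" "\<And>xs. set xs \<subseteq> U \<Longrightarrow> W (map orbit xs) + cobd Z xs = 0"
        using as_locally_zeroE[OF C x] by metis
      obtain V where V: "openin X V" "x \<in> V" "\<And>xs. set xs \<subseteq> V \<Longrightarrow> w (map orbit xs) + cobd (point_cochain X \<epsilon>) xs = 0"
        using as_locally_zeroE[OF lz x] by metis
      have small: "w [orbit y, orbit z] = \<epsilon> y + \<epsilon> z" if "y \<in> V" "z \<in> V" for y z
      proof -
        have "y \<in> topspace X" "z \<in> topspace X" using that openin_subset[OF V(1)] by auto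
        then show ?thesis using V(3)[of "[y, z]"] that by (simp add: cobd_Cons bit_eq_add_iff add.commute)
      qed
      have "W (map orbit xs) + cobd \<theta> (map orbit xs) = 0" if xs: "set xs \<subseteq> U \<inter> V" for xs
      proof -
        have "cobd \<theta> (map orbit xs) = cobd Z xs"
          unfolding cobd_map[symmetric]
          by (rule cobd_cong, rule lift) (use xs small openin_subset[OF V(1)] in blast)+
        then show ?thesis using U(3) xs by simp
      qed
      then show "\<exists>U. openin X U \<and> x \<in> U \<and> (\<forall>xs. set xs \<subseteq> U \<longrightarrow> W (map orbit xs) + cobd \<theta> (map orbit xs) = 0)"
        using U V by (intro exI[of _ "U \<inter> V"]) auto
    qed
    from as_locally_zero_antipodal_quotient[OF X this]
    have "as_locally_zero ?Q (\<lambda>as. W as + cobd \<theta> as)" by simp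
    moreover have "\<theta> [] = 0" by (simp add: \<theta>_def lift_def Z_def)
    ultimately have "null_cochain ?Q W" unfolding null_cochain_def by blast
    with nonnull show False by (simp add: W_def)
  qed
  with \<xi>_cocycle show ?thesis by (rule that)
qed

section \<open>The first cohomology of infinite projective space\<close>

lemma nsphere_eq: "nsphere n = top_of_set (topspace (nsphere n))"
proof -
  let ?S = "{x. (\<Sum>i\<le>n. (x i)\<^sup>2) = 1 \<and> (\<forall>i>n. x i = 0)}"
  have 1: "nsphere n = top_of_set ?S"
    unfolding nsphere euclidean_product_topology ..
  then have "topspace (nsphere n) = ?S" by (simp only: topspace_euclidean_subtopology)
  with 1 show ?thesis by (simp only:)
qed

lemma topspace_nsphere_iff:
  "x \<in> topspace (nsphere n) \<longleftrightarrow> (\<Sum>i\<le>n. (x i)\<^sup>2) = 1 \<and> (\<forall>i>n. x i = 0)"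
  by (simp add: nsphere)

lemma sum_products_extend:
  fixes x :: "nat \<Rightarrow> real"
  assumes "\<forall>i>m. x i = 0" "m \<le> n"
  shows "(\<Sum>i\<le>n. x i * y i) = (\<Sum>i\<le>m. x i * y i)"
  by (rule sum.mono_neutral_right) (use assms in auto)

lemma topspace_nsphere_mono: "m \<le> n \<Longrightarrow> topspace (nsphere m) \<subseteq> topspace (nsphere n)"
  using sum_products_extend[of m _ n] by (fastforce simp: topspace_nsphere_iff power2_eq_square)

lemma continuous_map_nsphere_mono: "m \<le> n \<Longrightarrow> continuous_map (nsphere m) (nsphere n) (\<lambda>x. x)"
  using topspace_nsphere_mono[of m n] by (subst nsphere_eq, subst (2) nsphere_eq) auto

lemma topspace_infinite_sphere: "topspace infinite_sphere = (\<Union>n. topspace (nsphere n))"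
proof
  show "topspace infinite_sphere \<subseteq> (\<Union>n. topspace (nsphere n))"
    using openin_infinite_sphere[of "topspace infinite_sphere"] by simp
  have "(\<Union>n. topspace (nsphere n)) \<inter> topspace (nsphere n) = topspace (nsphere n)" for n by blast
  then have "openin infinite_sphere (\<Union>n. topspace (nsphere n))"
    unfolding openin_infinite_sphere by (metis openin_topspace order_refl)
  then show "(\<Union>n. topspace (nsphere n)) \<subseteq> topspace infinite_sphere" by (rule openin_subset)
qed

lemma continuous_map_nsphere_infinite: "continuous_map (nsphere n) infinite_sphere (\<lambda>x. x)"
  unfolding continuous_map
proof (intro conjI allI impI)
  show "(\<lambda>x. x) ` topspace (nsphere n) \<subseteq> topspace infinite_sphere"
    by (auto simp: topspace_infinite_sphere)
  fix U assume "openin infinite_sphere U"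
  then have "openin (nsphere n) (U \<inter> topspace (nsphere n))" by (simp add: openin_infinite_sphere)
  then show "openin (nsphere n) {x \<in> topspace (nsphere n). x \<in> U}" by (simp add: Int_def conj_commute)
qed

lemma uminus_nsphere: "- x \<in> topspace (nsphere n) \<longleftrightarrow> x \<in> topspace (nsphere n)"
  by (simp add: topspace_nsphere_iff)

lemma continuous_map_nsphere_uminus: "continuous_map (nsphere n) (nsphere n) uminus"
proof -
  have "continuous_map (nsphere n) (powertop_real UNIV) uminus"
    unfolding continuous_map_componentwise_UNIV uminus_apply
    by (intro allI continuous_map_minus continuous_map_nsphere_projection)
  then show ?thesis
    using uminus_nsphere by (subst (2) nsphere) (auto simp: continuous_map_in_subtopology topspace_nsphere_iff)
qed

lemma antipodal_space_infinite_sphere: "antipodal_space infinite_sphere"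
  unfolding antipodal_space_def
proof
  show "\<forall>x\<in>topspace infinite_sphere. - (- x) = x" by (auto simp: fun_eq_iff)
  show "continuous_map infinite_sphere infinite_sphere uminus"
    unfolding continuous_map
  proof (intro conjI allI impI)
    show "uminus ` topspace infinite_sphere \<subseteq> topspace infinite_sphere"
      using uminus_nsphere by (auto simp: topspace_infinite_sphere)
    fix U assume U: "openin infinite_sphere U"
    show "openin infinite_sphere {x \<in> topspace infinite_sphere. - x \<in> U}"
      unfolding openin_infinite_sphere
    proof (intro conjI allI)
      fix n
      have "openin (nsphere n) {x \<in> topspace (nsphere n). - x \<in> U \<inter> topspace (nsphere n)}"
        using U by (intro openin_continuous_map_preimage[OF continuous_map_nsphere_uminus]) (simp add: openin_infinite_sphere)
      moreover have "{x \<in> topspace (nsphere n). - x \<in> U \<inter> topspace (nsphere n)} =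
          {x \<in> topspace infinite_sphere. - x \<in> U} \<inter> topspace (nsphere n)"
        using uminus_nsphere by (auto simp: topspace_infinite_sphere)
      ultimately show "openin (nsphere n) ({x \<in> topspace infinite_sphere. - x \<in> U} \<inter> topspace (nsphere n))"
        by simp
    qed (auto simp: topspace_infinite_sphere)
  qed
qed

text \<open>
  The sphere \<open>S\<^sup>k\<close> lies in the upper hemisphere of \<open>S\<^sup>k\<^sup>+\<^sup>1\<close>, which is contractible.
\<close>

lemma nsphere_inclusion_nullhomotopic:
  assumes "continuous_map (nsphere (Suc k)) Y (\<lambda>x. x)"
  obtains c where "c \<in> topspace Y" "homotopic_with (\<lambda>h. True) (nsphere k) Y (\<lambda>x. x) (\<lambda>x. c)"
proof -
  let ?H = "subtopology (nsphere (Suc k)) {x. x (Suc k) \<ge> 0}"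
  obtain a where a: "homotopic_with (\<lambda>x. True) ?H ?H id (\<lambda>x. a)"
    using contractible_space_upper_hemisphere[of "Suc k" "Suc k"] by (auto simp: contractible_space_def)
  have "continuous_map (nsphere k) ?H (\<lambda>x. x)"
    using continuous_map_nsphere_mono[of k "Suc k"]
    by (auto simp: continuous_map_in_subtopology topspace_nsphere_iff)
  from homotopic_with_compose_continuous_map_right[OF a this, of "\<lambda>_. True"]
  have h: "homotopic_with (\<lambda>x. True) (nsphere k) ?H (\<lambda>x. x) (\<lambda>x. a)" by (simp add: o_def)
  have c: "continuous_map ?H Y (\<lambda>x. x)" by (rule continuous_map_from_subtopology[OF assms])
  from homotopic_with_compose_continuous_map_left[OF h c, of "\<lambda>_. True"]
  have H: "homotopic_with (\<lambda>x. True) (nsphere k) Y (\<lambda>x. x) (\<lambda>x. a)" by (simp add: o_def)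
  have "continuous_map (nsphere k) Y (\<lambda>x. a)" using homotopic_with_imp_continuous_maps[OF H] by simp
  then have "a \<in> topspace Y"
    using continuous_map_image_subset_topspace[of "nsphere k" Y "\<lambda>x. a"] in_topspace_nsphere[of k] by blast
  then show ?thesis using that H by blast
qed

lemma nsphere_reduced_null:
  assumes "continuous_map (nsphere (Suc k)) Y (\<lambda>x. x)" "\<phi> \<in> as_cochains p Y" "as_locally_zero Y (cobd \<phi>)"
  shows "reduced_null (nsphere k) \<phi>"
proof -
  obtain c where c: "c \<in> topspace Y" "homotopic_with (\<lambda>h. True) (nsphere k) Y (\<lambda>x. x) (\<lambda>x. c)"
    using nsphere_inclusion_nullhomotopic[OF assms(1)] by blast
  from c(2) have "homotopic_with (\<lambda>h. True) (top_of_set (topspace (nsphere k))) Y (\<lambda>x. x) (\<lambda>x. c)"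
    by (simp only: nsphere_eq[symmetric])
  from nullhomotopic_reduced_null[OF this c(1) assms(2,3)]
  have "reduced_null (top_of_set (topspace (nsphere k))) \<phi>" by simp
  then show ?thesis by (simp only: nsphere_eq[symmetric])
qed

text \<open>
  Lists of length two are the only ones on which the condition says something.
\<close>

lemma as_locally_zero_point_cochain_iff:
  assumes "\<And>xs. length xs \<noteq> 2 \<Longrightarrow> \<phi> xs = 0"
  shows "as_locally_zero X (\<lambda>xs. \<phi> xs + cobd (point_cochain X s) xs) \<longleftrightarrow>
    (\<forall>x\<in>topspace X. \<exists>U. openin X U \<and> x \<in> U \<and> (\<forall>y\<in>U. \<forall>z\<in>U. \<phi> [y, z] = s y + s z))"
proof -
  have eq: "(\<forall>xs. set xs \<subseteq> U \<longrightarrow> \<phi> xs + cobd (point_cochain X s) xs = 0) \<longleftrightarrow> (\<forall>y\<in>U. \<forall>z\<in>U. \<phi> [y, z] = s y + s z)"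
    if U: "openin X U" for U
  proof -
    have two: "\<phi> [y, z] + cobd (point_cochain X s) [y, z] = 0 \<longleftrightarrow> \<phi> [y, z] = s y + s z" if "y \<in> U" "z \<in> U" for y z
    proof -
      have "y \<in> topspace X" "z \<in> topspace X" using that openin_subset[OF U] by auto
      then show ?thesis by (auto simp: cobd_Cons bit_eq_add_iff add.commute)
    qed
    have other: "\<phi> xs + cobd (point_cochain X s) xs = 0" if "length xs \<noteq> 2" for xs
    proof -
      have "cobd (point_cochain X s) xs = 0" by (rule cobd_eq_0) (use that in \<open>auto simp: point_cochain_def\<close>)
      then show ?thesis using assms[OF that] by simp
    qed
    show ?thesis
    proof
      assume *: "\<forall>xs. set xs \<subseteq> U \<longrightarrow> \<phi> xs + cobd (point_cochain X s) xs = 0"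
      show "\<forall>y\<in>U. \<forall>z\<in>U. \<phi> [y, z] = s y + s z"
      proof (intro ballI)
        fix y z assume yz: "y \<in> U" "z \<in> U"
        then have "\<phi> [y, z] + cobd (point_cochain X s) [y, z] = 0" using *[rule_format, of "[y, z]"] by simp
        then show "\<phi> [y, z] = s y + s z" using two yz by blast
      qed
    next
      assume *: "\<forall>y\<in>U. \<forall>z\<in>U. \<phi> [y, z] = s y + s z"
      show "\<forall>xs. set xs \<subseteq> U \<longrightarrow> \<phi> xs + cobd (point_cochain X s) xs = 0"
      proof (intro allI impI)
        fix xs assume xs: "set xs \<subseteq> U"
        show "\<phi> xs + cobd (point_cochain X s) xs = 0"
        proof (cases "length xs = 2")
          case True
          then obtain y z where "xs = [y, z]" by (auto simp: numeral_2_eq_2 length_Suc_conv)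
          then show ?thesis using two[of y z] * xs by auto
        qed (rule other)
      qed
    qed
  qed
  show ?thesis unfolding as_locally_zero_iff by (intro ball_cong refl ex_cong1 conj_cong eq) auto
qed

lemma as_locally_zero_cobd_point_cochain_iff:
  "as_locally_zero X (cobd (point_cochain X s)) \<longleftrightarrow>
    (\<forall>x\<in>topspace X. \<exists>U. openin X U \<and> x \<in> U \<and> (\<forall>y\<in>U. \<forall>z\<in>U. s y = s z))"
  using as_locally_zero_point_cochain_iff[of "\<lambda>_. 0" X s]
  by (simp add: eq_commute[of 0] bit_eq_add_iff)

lemma locally_constant_on_nsphere:
  assumes cont: "continuous_map (nsphere (Suc k)) Y (\<lambda>x. x)" and s: "as_locally_zero Y (cobd (point_cochain Y s))"
    and x: "x \<in> topspace (nsphere k)" "y \<in> topspace (nsphere k)"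
  shows "s x = s y"
proof -
  have kY: "topspace (nsphere k) \<subseteq> topspace Y"
    using continuous_map_image_subset_topspace[OF cont] topspace_nsphere_mono[of k "Suc k"] by auto
  obtain \<psi> where \<psi>: "as_locally_zero (nsphere k) (\<lambda>xs. point_cochain Y s xs + cobd \<psi> xs)"
    using nsphere_reduced_null[OF cont point_cochain_in s] by (auto simp: reduced_null_def)
  have "s z = \<psi> []" if z: "z \<in> topspace (nsphere k)" for z
  proof -
    obtain U where "z \<in> U" "\<And>xs. set xs \<subseteq> U \<Longrightarrow> point_cochain Y s xs + cobd \<psi> xs = 0"
      using as_locally_zeroE[OF \<psi> z] by metis
    from this(2)[of "[z]"] this(1) kY z show ?thesis by (auto simp: cobd_Cons bit_eq_add_iff)
  qed
  then show ?thesis using x by simp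
qed

lemma locally_constant_on_infinite_sphere:
  assumes s: "as_locally_zero infinite_sphere (cobd (point_cochain infinite_sphere s))"
    and x: "x \<in> topspace infinite_sphere" "y \<in> topspace infinite_sphere"
  shows "s x = s y"
proof -
  obtain m n where "x \<in> topspace (nsphere m)" "y \<in> topspace (nsphere n)"
    using x by (auto simp: topspace_infinite_sphere)
  then have "x \<in> topspace (nsphere (max m n))" "y \<in> topspace (nsphere (max m n))"
    using topspace_nsphere_mono[of m "max m n"] topspace_nsphere_mono[of n "max m n"] by auto
  then show ?thesis using locally_constant_on_nsphere[OF continuous_map_nsphere_infinite s] by blast
qed

text \<open>
  The weak topology is not metrizable, so homotopy invariance only gives primitives \<open>s\<^sub>n\<close> on the
  finite spheres.  Normalised at a base point they agree, on \<open>S\<^sup>k\<close>, as soon as their index exceeds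
  \<open>k\<close>, because a locally constant function on \<open>S\<^sup>k\<^sup>+\<^sup>1\<close> is constant on \<open>S\<^sup>k\<close>.  They therefore have a
  common limit \<open>t\<close>.  Around a point \<open>x\<close>, the set on which \<open>t(y) + \<phi>(y, x)\<close> keeps its value at \<open>x\<close> is
  open in each finite sphere, hence open, and \<open>\<phi> = \<delta>t\<close> on it.
\<close>

theorem infinite_sphere_H1:
  assumes \<phi>: "\<phi> \<in> as_relcocycles 1 infinite_sphere {}"
  obtains s where "as_locally_zero infinite_sphere (\<lambda>xs. \<phi> xs + cobd (point_cochain infinite_sphere s) xs)"
proof -
  let ?S = infinite_sphere
  have \<phi>c: "\<phi> \<in> as_cochains 1 ?S" and \<phi>lz: "as_locally_zero ?S (cobd \<phi>)"
    using \<phi> by (auto simp: mem_as_relcocycles_empty)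
  have \<phi>2: "\<phi> xs = 0" if "length xs \<noteq> 2" for xs
    by (rule as_cochains_wrong_length[OF \<phi>c]) (use that in simp)
  define o' :: "nat \<Rightarrow> real" where "o' = (\<lambda>n. if n = 0 then 1 else 0)"
  have o': "o' \<in> topspace (nsphere n)" for n unfolding o'_def by (rule in_topspace_nsphere)
  have "\<exists>s. s o' = 0 \<and> (\<forall>x\<in>topspace (nsphere n). \<exists>U. openin (nsphere n) U \<and> x \<in> U \<and> (\<forall>y\<in>U. \<forall>z\<in>U. \<phi> [y, z] = s y + s z))" for n
  proof -
    obtain \<psi> where \<psi>: "as_locally_zero (nsphere n) (\<lambda>xs. \<phi> xs + cobd \<psi> xs)"
      using nsphere_reduced_null[OF continuous_map_nsphere_infinite \<phi>c \<phi>lz] by (auto simp: reduced_null_def)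
    define s where "s x = \<psi> [x] + \<psi> [o']" for x
    have "\<exists>U. openin (nsphere n) U \<and> x \<in> U \<and> (\<forall>y\<in>U. \<forall>z\<in>U. \<phi> [y, z] = s y + s z)" if x: "x \<in> topspace (nsphere n)" for x
    proof -
      obtain U where U: "openin (nsphere n) U" "x \<in> U" "\<And>xs. set xs \<subseteq> U \<Longrightarrow> \<phi> xs + cobd \<psi> xs = 0"
        using as_locally_zeroE[OF \<psi> x] by metis
      have "\<phi> [y, z] = s y + s z" if "y \<in> U" "z \<in> U" for y z
      proof -
        have "\<phi> [y, z] = cobd \<psi> [y, z]" using U(3)[of "[y, z]"] that by (simp add: bit_eq_add_iff)
        then show ?thesis by (simp add: cobd_Cons s_def ac_simps)
      qed
      then show ?thesis using U by blast
    qed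
    moreover have "s o' = 0" by (simp add: s_def)
    ultimately show ?thesis by blast
  qed
  then obtain s where s0: "\<And>n. s n o' = 0"
    and s: "\<And>n x. x \<in> topspace (nsphere n) \<Longrightarrow> \<exists>U. openin (nsphere n) U \<and> x \<in> U \<and> (\<forall>y\<in>U. \<forall>z\<in>U. \<phi> [y, z] = s n y + s n z)"
    by metis
  have agree: "s m x = s n x" if x: "x \<in> topspace (nsphere k)" and mn: "k < m" "m \<le> n" for k m n x
  proof -
    let ?d = "\<lambda>x. s m x + s n x"
    have "as_locally_zero (nsphere m) (cobd (point_cochain (nsphere m) ?d))"
      unfolding as_locally_zero_cobd_point_cochain_iff
    proof
      fix y assume y: "y \<in> topspace (nsphere m)"
      then have y': "y \<in> topspace (nsphere n)" using topspace_nsphere_mono[OF mn(2)] by blast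
      obtain U where U: "openin (nsphere m) U" "y \<in> U" "\<forall>a\<in>U. \<forall>b\<in>U. \<phi> [a, b] = s m a + s m b"
        using s[OF y] by blast
      obtain V where V: "openin (nsphere n) V" "y \<in> V" "\<forall>a\<in>V. \<forall>b\<in>V. \<phi> [a, b] = s n a + s n b"
        using s[OF y'] by blast
      have "openin (nsphere m) (U \<inter> {a \<in> topspace (nsphere m). a \<in> V})"
        by (intro openin_Int U openin_continuous_map_preimage[OF continuous_map_nsphere_mono[OF mn(2)] V(1)])
      moreover have "?d a = ?d b" if "a \<in> U \<inter> {a \<in> topspace (nsphere m). a \<in> V}" "b \<in> U \<inter> {a \<in> topspace (nsphere m). a \<in> V}" for a b
      proof -
        have "s m a + s m b = s n a + s n b" using that U(3) V(3) by (metis IntD1 IntD2 mem_Collect_eq)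
        then show ?thesis by (cases "s m a"; cases "s m b"; cases "s n a"; cases "s n b") auto
      qed
      ultimately show "\<exists>U. openin (nsphere m) U \<and> y \<in> U \<and> (\<forall>a\<in>U. \<forall>b\<in>U. ?d a = ?d b)"
        using U(2) V(2) y by (intro exI[of _ "U \<inter> {a \<in> topspace (nsphere m). a \<in> V}"]) blast
    qed
    from locally_constant_on_nsphere[OF continuous_map_nsphere_mono this x o'] mn(1)
    show ?thesis by (simp add: s0 bit_eq_add_iff)
  qed
  \<comment> \<open>The index is one more than that of the sphere, so that \<open>agree\<close> applies.\<close>
  define t where "t x = s (Suc (LEAST k. x \<in> topspace (nsphere k))) x" for x
  have t: "t x = s (Suc k) x" if "x \<in> topspace (nsphere k)" for k x
  proof -
    have "x \<in> topspace (nsphere (LEAST k. x \<in> topspace (nsphere k)))" by (rule LeastI) (rule that)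
    moreover have "(LEAST k. x \<in> topspace (nsphere k)) \<le> k" by (rule Least_le) (rule that)
    ultimately show ?thesis unfolding t_def by (intro agree) auto
  qed
  have "as_locally_zero ?S (\<lambda>xs. \<phi> xs + cobd (point_cochain ?S t) xs)"
  proof (rule as_locally_zero_point_cochain_iff[THEN iffD2, rotated], rule ballI)
    fix x assume x: "x \<in> topspace ?S"
    obtain U where U: "openin ?S U" "x \<in> U" "\<And>xs. set xs \<subseteq> U \<Longrightarrow> cobd \<phi> xs = 0"
      using as_locally_zeroE[OF \<phi>lz x] by metis
    have cyc: "\<phi> [a, b] = \<phi> [a, c] + \<phi> [b, c]" if "a \<in> U" "b \<in> U" "c \<in> U" for a b c
    proof -
      have "cobd \<phi> [a, b, c] = 0" by (rule U(3)) (use that in auto)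
      then show ?thesis by (cases "\<phi> [a, b]"; cases "\<phi> [a, c]"; cases "\<phi> [b, c]") (simp_all add: cobd_Cons)
    qed
    define c where "c = t x + \<phi> [x, x]"
    define V where "V = {y \<in> U. t y + \<phi> [y, x] = c}"
    have "openin ?S V"
      unfolding openin_infinite_sphere
    proof (intro conjI allI)
      show "V \<subseteq> (\<Union>n. topspace (nsphere n))"
        using openin_subset[OF U(1)] by (auto simp: V_def topspace_infinite_sphere)
      fix n
      show "openin (nsphere n) (V \<inter> topspace (nsphere n))"
      proof (subst openin_subopen, intro ballI)
        fix y assume y: "y \<in> V \<inter> topspace (nsphere n)"
        then have "y \<in> topspace (nsphere (Suc n))" using topspace_nsphere_mono[of n "Suc n"] by auto
        from s[OF this] obtain N where N: "openin (nsphere (Suc n)) N" "y \<in> N"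
          "\<forall>a\<in>N. \<forall>b\<in>N. \<phi> [a, b] = s (Suc n) a + s (Suc n) b" by blast
        let ?T = "{a \<in> topspace (nsphere n). a \<in> N} \<inter> (U \<inter> topspace (nsphere n))"
        have "openin (nsphere n) (U \<inter> topspace (nsphere n))" using U(1) by (simp add: openin_infinite_sphere)
        then have "openin (nsphere n) ?T"
          by (rule openin_Int[OF openin_continuous_map_preimage[OF continuous_map_nsphere_mono N(1)], rotated]) simp
        moreover have "y \<in> ?T" using y N by (auto simp: V_def)
        moreover have "?T \<subseteq> V \<inter> topspace (nsphere n)"
        proof
          fix a assume a: "a \<in> ?T"
          have "\<phi> [a, y] = t a + t y" using N(3) a N(2) y t by (metis (no_types, lifting) IntD1 IntD2 mem_Collect_eq)
          moreover have "\<phi> [a, y] = \<phi> [a, x] + \<phi> [y, x]" using a y U(2) by (intro cyc) (auto simp: V_def)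
          moreover have "t y + \<phi> [y, x] = c" using y by (simp add: V_def)
          ultimately have "t a + \<phi> [a, x] = c"
            by (cases "t a"; cases "t y"; cases "\<phi> [a, x]"; cases "\<phi> [y, x]") auto
          then show "a \<in> V \<inter> topspace (nsphere n)" using a by (simp add: V_def)
        qed
        ultimately show "\<exists>T. openin (nsphere n) T \<and> y \<in> T \<and> T \<subseteq> V \<inter> topspace (nsphere n)" by blast
      qed
    qed
    moreover have "x \<in> V" using U(2) by (simp add: V_def c_def)
    moreover have "\<phi> [a, b] = t a + t b" if "a \<in> V" "b \<in> V" for a b
    proof -
      have "\<phi> [a, b] = \<phi> [a, x] + \<phi> [b, x]" using that U(2) by (intro cyc) (auto simp: V_def)
      moreover have "t a + \<phi> [a, x] = c" "t b + \<phi> [b, x] = c" using that by (auto simp: V_def)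
      ultimately show ?thesis
        by (cases "t a"; cases "t b"; cases "\<phi> [a, x]"; cases "\<phi> [b, x]") auto
    qed
    ultimately show "\<exists>U. openin ?S U \<and> x \<in> U \<and> (\<forall>y\<in>U. \<forall>z\<in>U. \<phi> [y, z] = t y + t z)" by blast
  qed (rule \<phi>2)
  then show ?thesis by (rule that)
qed

text \<open>
  The sum runs over the support of \<open>x\<close>, which is finite on the infinite sphere.
\<close>

definition sphere_inner :: "(nat \<Rightarrow> real) \<Rightarrow> (nat \<Rightarrow> real) \<Rightarrow> real" where
  "sphere_inner x y = (\<Sum>i | x i \<noteq> 0. x i * y i)"

lemma sphere_inner_eq:
  assumes "x \<in> topspace (nsphere n)"
  shows "sphere_inner x y = (\<Sum>i\<le>n. x i * y i)"
  unfolding sphere_inner_def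
proof (rule sum.mono_neutral_left)
  show "{i. x i \<noteq> 0} \<subseteq> {..n}" using assms by (auto simp: topspace_nsphere_iff not_less[symmetric])
qed auto

lemma sphere_inner_uminus: "sphere_inner (- x) y = - sphere_inner x y" "sphere_inner x (- y) = - sphere_inner x y"
  by (simp_all add: sphere_inner_def sum_negf)

text \<open>
  If \<open>y\<close> and \<open>z\<close> are close to the unit vector \<open>x\<close>, then \<open>y + z\<close> is long: Cauchy--Schwarz against \<open>x\<close>
  gives \<open>2 + 2\<langle>y, z\<rangle> = |y + z|\<^sup>2 > 9/4\<close>.
\<close>

lemma sphere_inner_positive:
  assumes "x \<in> topspace infinite_sphere" "y \<in> topspace infinite_sphere" "z \<in> topspace infinite_sphere"
    and xy: "sphere_inner x y > 3/4" and xz: "sphere_inner x z > 3/4"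
  shows "sphere_inner y z > 0"
proof -
  obtain a b c where abc: "x \<in> topspace (nsphere a)" "y \<in> topspace (nsphere b)" "z \<in> topspace (nsphere c)"
    using assms by (auto simp: topspace_infinite_sphere)
  define n where "n = a + b + c"
  have x: "x \<in> topspace (nsphere n)" and y: "y \<in> topspace (nsphere n)" and z: "z \<in> topspace (nsphere n)"
    using abc topspace_nsphere_mono[of a n] topspace_nsphere_mono[of b n] topspace_nsphere_mono[of c n]
    by (auto simp: n_def)
  have sq: "(\<Sum>i\<le>n. (u i)\<^sup>2) = 1" if "u \<in> topspace (nsphere n)" for u using that by (simp add: topspace_nsphere_iff)
  have "(\<Sum>i\<le>n. x i * (y i + z i)) = sphere_inner x y + sphere_inner x z"
    by (simp add: sphere_inner_eq[OF x] distrib_left sum.distrib)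
  then have "3/2 \<le> (\<Sum>i\<le>n. x i * (y i + z i))" using xy xz by simp
  then have "(3/2)\<^sup>2 \<le> (\<Sum>i\<le>n. x i * (y i + z i))\<^sup>2" by (intro power_mono) auto
  also have "\<dots> \<le> (\<Sum>i\<le>n. (x i)\<^sup>2) * (\<Sum>i\<le>n. (y i + z i)\<^sup>2)" by (rule Cauchy_Schwarz_ineq_sum)
  also have "(\<Sum>i\<le>n. (y i + z i)\<^sup>2) = (\<Sum>i\<le>n. (y i)\<^sup>2) + (\<Sum>i\<le>n. (z i)\<^sup>2) + 2 * (\<Sum>i\<le>n. y i * z i)"
    by (simp add: power2_sum sum.distrib sum_distrib_left ac_simps)
  finally show ?thesis using sq[OF x] sq[OF y] sq[OF z] by (simp add: sphere_inner_eq[OF y] power2_eq_square)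
qed

lemma openin_sphere_cap:
  assumes "x \<in> topspace infinite_sphere"
  shows "openin infinite_sphere {y \<in> topspace infinite_sphere. sphere_inner x y > c}"
  unfolding openin_infinite_sphere
proof (intro conjI allI)
  fix n
  obtain k where "\<forall>i>k. x i = 0" using assms by (auto simp: topspace_infinite_sphere topspace_nsphere_iff)
  then have "{i. x i \<noteq> 0} \<subseteq> {..k}" by (auto simp: not_less[symmetric])
  then have "finite {i. x i \<noteq> 0}" by (rule finite_subset) simp
  then have "continuous_map (nsphere n) euclideanreal (sphere_inner x)"
    unfolding sphere_inner_def
    by (intro continuous_map_sum continuous_map_real_mult continuous_map_nsphere_projection) auto
  from openin_continuous_map_preimage[OF this, of "{c<..}"]
  have "openin (nsphere n) {y \<in> topspace (nsphere n). sphere_inner x y > c}" by simp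
  moreover have "{y \<in> topspace infinite_sphere. sphere_inner x y > c} \<inter> topspace (nsphere n)
      = {y \<in> topspace (nsphere n). sphere_inner x y > c}" by (auto simp: topspace_infinite_sphere)
  ultimately show "openin (nsphere n) ({y \<in> topspace infinite_sphere. sphere_inner x y > c} \<inter> topspace (nsphere n))"
    by simp
qed (auto simp: topspace_infinite_sphere)

text \<open>
  Take an arbitrary numbering of the sheets.  Nearby orbits have representatives with positive
  inner product, unique up to a common sign, and \<open>w\<close> compares their numbers.
\<close>

lemma infinite_sphere_sheet_cochain_exists:
  obtains w where "sheet_cochain infinite_sphere w"
proof -
  let ?S = infinite_sphere and ?Q = "antipodal_quotient infinite_sphere"
  note aS = antipodal_space_infinite_sphere
  have self: "sphere_inner x x = 1" if "x \<in> topspace ?S" for x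
    using that by (auto simp: topspace_infinite_sphere sphere_inner_eq topspace_nsphere_iff power2_eq_square)
  have ne: "- x \<noteq> x" if "x \<in> topspace ?S" for x
    using self[OF that] sphere_inner_uminus(1)[of x x] by auto
  define \<epsilon> :: "(nat \<Rightarrow> real) \<Rightarrow> bit" where "\<epsilon> x = (if (SOME y. y \<in> orbit x) = x then 0 else 1)" for x
  have odd: "\<epsilon> (- x) = \<epsilon> x + 1" if "x \<in> topspace ?S" for x
  proof -
    have "(SOME y. y \<in> orbit x) \<in> orbit x" by (rule someI[of _ x]) (simp add: orbit_def)
    then show ?thesis
      using ne[OF that] antipodal_spaceD(4)[OF aS that] by (auto simp: \<epsilon>_def orbit_def)
  qed
  define w where "w as = (if \<exists>x\<in>topspace ?S. \<exists>y\<in>topspace ?S. as = [orbit x, orbit y] \<and> sphere_inner x y > 0 \<and> \<epsilon> x \<noteq> \<epsilon> y then 1 else 0 :: bit)" for as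
  have wc: "w \<in> as_cochains 1 ?Q"
    unfolding as_cochains_def w_def by auto
  have w2: "w (map orbit xs) = 0" if "length xs \<noteq> 2" for xs :: "(nat \<Rightarrow> real) list"
    by (rule as_cochains_wrong_length[OF wc]) (use that in simp)
  have "as_locally_zero ?S (\<lambda>xs. w (map orbit xs) + cobd (point_cochain ?S \<epsilon>) xs)"
  proof (rule as_locally_zero_point_cochain_iff[THEN iffD2, rotated], rule ballI)
    fix x assume x: "x \<in> topspace ?S"
    let ?V = "{y \<in> topspace ?S. sphere_inner x y > 3/4}"
    have "w (map orbit [y, z]) = \<epsilon> y + \<epsilon> z" if yz: "y \<in> ?V" "z \<in> ?V" for y z
    proof -
      have y: "y \<in> topspace ?S" and z: "z \<in> topspace ?S" and pos: "sphere_inner y z > 0"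
        using yz sphere_inner_positive[OF x, of y z] by auto
      show ?thesis
      proof (cases "\<epsilon> y = \<epsilon> z")
        case False
        then have "w (map orbit [y, z]) = 1" using y z pos by (auto simp: w_def)
        then show ?thesis using False by (cases "\<epsilon> y"; cases "\<epsilon> z") auto
      next
        case True
        have "\<epsilon> y' = \<epsilon> z'" if "orbit y' = orbit y" "orbit z' = orbit z" "sphere_inner y' z' > 0" for y' z'
        proof -
          have "y' = y \<or> y' = - y" "z' = z \<or> z' = - z" using that(1,2) by (auto simp: orbit_def doubleton_eq_iff)
          then show ?thesis
            using that(3) pos True odd[OF y] odd[OF z] by (auto simp: sphere_inner_uminus)
        qed
        then have "w (map orbit [y, z]) = 0" by (auto simp: w_def)
        then show ?thesis using True by simp
      qed
    qed
    moreover have "x \<in> ?V" using x self by simp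
    ultimately show "\<exists>U. openin ?S U \<and> x \<in> U \<and> (\<forall>y\<in>U. \<forall>z\<in>U. w (map orbit [y, z]) = \<epsilon> y + \<epsilon> z)"
      using openin_sphere_cap[OF x] by blast
  qed (rule w2)
  then have "sheet_cochain ?S w" unfolding sheet_cochain_def using wc odd by (intro conjI exI[of _ \<epsilon>]) auto
  then show ?thesis by (rule that)
qed

text \<open>
  A primitive on the quotient would make the sheet numbering locally constant up to an even
  function, hence constant, but it changes under the antipodal map.
\<close>

lemma infinite_sphere_sheet_cochain_not_null:
  assumes w: "sheet_cochain infinite_sphere w"
  shows "\<not> null_cochain RP_infinity w"
proof
  let ?S = infinite_sphere
  assume "null_cochain RP_infinity w"
  then obtain \<eta> where \<eta>: "\<eta> [] = 0" "as_locally_zero RP_infinity (\<lambda>xs. w xs + cobd \<eta> xs)"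
    by (auto simp: null_cochain_def)
  obtain \<epsilon> where odd: "\<forall>x\<in>topspace ?S. \<epsilon> (- x) = \<epsilon> x + 1"
    and lz: "as_locally_zero ?S (\<lambda>xs. w (map orbit xs) + cobd (point_cochain ?S \<epsilon>) xs)"
    using w by (auto simp: sheet_cochain_def)
  have w1: "w \<in> as_cochains 1 RP_infinity" using w by (simp add: sheet_cochain_def RP_infinity_def)
  define s where "s x = \<epsilon> x + \<eta> [orbit x]" for x
  have "as_locally_zero ?S (cobd (point_cochain ?S s))"
    unfolding as_locally_zero_cobd_point_cochain_iff
  proof
    fix x assume x: "x \<in> topspace ?S"
    obtain U where U: "openin ?S U" "x \<in> U" "\<And>xs. set xs \<subseteq> U \<Longrightarrow> w (map orbit xs) + cobd (point_cochain ?S \<epsilon>) xs = 0"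
      using as_locally_zeroE[OF lz x] by metis
    have "as_locally_zero ?S (\<lambda>xs. w (map orbit xs) + cobd \<eta> (map orbit xs))"
      using as_locally_zero_map[OF \<eta>(2)[unfolded RP_infinity_def] continuous_map_orbit] by simp
    from as_locally_zeroE[OF this x] obtain V where V: "openin ?S V" "x \<in> V"
      "\<And>xs. set xs \<subseteq> V \<Longrightarrow> w (map orbit xs) + cobd \<eta> (map orbit xs) = 0" by metis
    have "s y = s z" if "y \<in> U \<inter> V" "z \<in> U \<inter> V" for y z
    proof -
      have "y \<in> topspace ?S" "z \<in> topspace ?S" using that openin_subset[OF U(1)] by auto
      then have "w [orbit y, orbit z] + (\<epsilon> y + \<epsilon> z) = 0" "w [orbit y, orbit z] + (\<eta> [orbit y] + \<eta> [orbit z]) = 0"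
        using U(3)[of "[y, z]"] V(3)[of "[y, z]"] that by (simp_all add: cobd_Cons ac_simps)
      then show ?thesis unfolding s_def
        by (cases "w [orbit y, orbit z]"; cases "\<epsilon> y"; cases "\<epsilon> z"; cases "\<eta> [orbit y]"; cases "\<eta> [orbit z]") auto
    qed
    then have "\<forall>y\<in>U \<inter> V. \<forall>z\<in>U \<inter> V. s y = s z" by blast
    moreover have "openin ?S (U \<inter> V)" "x \<in> U \<inter> V" using U(1,2) V(1,2) by (simp_all add: openin_Int)
    ultimately show "\<exists>U. openin ?S U \<and> x \<in> U \<and> (\<forall>y\<in>U. \<forall>z\<in>U. s y = s z)" by blast
  qed
  moreover obtain x where x: "x \<in> topspace ?S"
    using in_topspace_nsphere[of 0] by (auto simp: topspace_infinite_sphere)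
  ultimately have "s (- x) = s x"
    using locally_constant_on_infinite_sphere[of s "- x" x]
      antipodal_spaceD(1)[OF antipodal_space_infinite_sphere x] by simp
  then show False
    using odd x antipodal_spaceD(4)[OF antipodal_space_infinite_sphere x] by (cases "\<epsilon> x"; cases "\<eta> [orbit x]") (auto simp: s_def)
qed

text \<open>
  On the sphere \<open>p\<^sup>*\<phi> = \<delta>s\<close>, and \<open>s(x) + s(- x)\<close> is locally constant, hence constant.  If the constant
  is \<open>0\<close>, then \<open>s\<close> descends and \<open>\<phi>\<close> is trivial; if it is \<open>1\<close>, then \<open>s\<close> numbers the sheets.
\<close>

lemma RP_infinity_degree_one:
  assumes \<phi>: "\<phi> \<in> as_relcocycles 1 RP_infinity {}" and nonnull: "\<not> null_cochain RP_infinity \<phi>"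
  shows "sheet_cochain infinite_sphere \<phi>"
proof -
  let ?S = infinite_sphere and ?Q = "antipodal_quotient infinite_sphere"
  note aS = antipodal_space_infinite_sphere
  have \<phi>c: "\<phi> \<in> as_cochains 1 ?Q" using \<phi> by (simp add: mem_as_relcocycles_empty RP_infinity_def)
  have "as_pullback ?S orbit \<phi> \<in> as_relcocycles 1 ?S {}"
    using \<phi> by (intro as_pullback_cocycle[where Y = ?Q] continuous_map_orbit) (simp add: RP_infinity_def)
  then obtain s where "as_locally_zero ?S (\<lambda>xs. as_pullback ?S orbit \<phi> xs + cobd (point_cochain ?S s) xs)"
    by (rule infinite_sphere_H1)
  then have s: "as_locally_zero ?S (\<lambda>xs. \<phi> (map orbit xs) + cobd (point_cochain ?S s) xs)"
    by (rule as_locally_zero_cong[THEN iffD1, rotated]) (simp add: as_pullback_def)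
  define d where "d x = s x + s (- x)" for x
  have "as_locally_zero ?S (cobd (point_cochain ?S d))"
    using as_locally_zero_add[OF s as_locally_zero_map[OF s antipodal_spaceD(3)[OF aS]]]
  proof (rule as_locally_zero_cong[THEN iffD1, rotated])
    fix xs assume xs: "set xs \<subseteq> topspace ?S"
    then have mo: "map orbit (map uminus xs) = map orbit xs" using antipodal_spaceD(4)[OF aS] by auto
    have "cobd (point_cochain ?S d) xs = cobd (\<lambda>xs. point_cochain ?S s xs + point_cochain ?S s (map uminus xs)) xs"
    proof (rule cobd_cong)
      fix ys assume "set ys \<subseteq> set xs"
      then have "set ys \<subseteq> topspace ?S" using xs by blast
      then show "point_cochain ?S d ys = point_cochain ?S s ys + point_cochain ?S s (map uminus ys)"
        using antipodal_spaceD(1)[OF aS] by (cases ys) (auto simp: point_cochain_def d_def)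
    qed
    then show "\<phi> (map orbit xs) + cobd (point_cochain ?S s) xs + (\<phi> (map orbit (map uminus xs)) + cobd (point_cochain ?S s) (map uminus xs))
        = cobd (point_cochain ?S d) xs"
      unfolding mo by (simp add: cobd_add cobd_map ac_simps)
  qed
  then have const: "d x = d y" if "x \<in> topspace ?S" "y \<in> topspace ?S" for x y
    by (rule locally_constant_on_infinite_sphere[OF _ that])
  show ?thesis
  proof (cases "\<exists>x\<in>topspace ?S. d x = 0")
    case True
    then obtain y where y: "y \<in> topspace ?S" "d y = 0" by blast
    have even: "s (- x) = s x" if "x \<in> topspace ?S" for x
      using const[OF that y(1)] y(2) by (simp add: d_def bit_eq_add_iff)
    define e where "e = point_cochain ?Q (\<lambda>a. s (SOME y. y \<in> a))"
    have e: "e (map orbit xs) = point_cochain ?S s xs" if "set xs \<subseteq> topspace ?S" for xs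
      using that even_function_descends[where \<delta> = s, OF aS even] by (cases xs) (auto simp: e_def point_cochain_def)
    have "as_locally_zero ?S (\<lambda>xs. (\<lambda>as. \<phi> as + cobd e as) (map orbit xs))"
      using s
    proof (rule as_locally_zero_cong[THEN iffD1, rotated])
      fix xs assume xs: "set xs \<subseteq> topspace ?S"
      have "cobd e (map orbit xs) = cobd (point_cochain ?S s) xs"
        unfolding cobd_map[symmetric] by (rule cobd_cong, rule e) (use xs in blast)
      then show "\<phi> (map orbit xs) + cobd (point_cochain ?S s) xs = \<phi> (map orbit xs) + cobd e (map orbit xs)" by simp
    qed
    from as_locally_zero_antipodal_quotient[OF aS this]
    have "null_cochain RP_infinity \<phi>"
      unfolding null_cochain_def RP_infinity_def by (intro exI[of _ e]) (simp add: e_def)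
    with nonnull show ?thesis by blast
  next
    case False
    then have "s (- x) = s x + 1" if "x \<in> topspace ?S" for x
      using that by (cases "s x"; cases "s (- x)") (auto simp: d_def)
    then show ?thesis unfolding sheet_cochain_def using \<phi>c s by (intro conjI exI[of _ s]) auto
  qed
qed

theorem RP_generator_eq:
  assumes w: "sheet_cochain infinite_sphere w"
  shows "RP_generator = as_class 1 RP_infinity w"
  unfolding RP_generator_def
proof (rule the_equality)
  have wc: "w \<in> as_relcocycles 1 RP_infinity {}"
    unfolding RP_infinity_def by (rule sheet_cochain_cocycle[OF antipodal_space_infinite_sphere w])
  then show "as_class 1 RP_infinity w \<in> carrier (as_cohomology 1 RP_infinity) \<and>
      as_class 1 RP_infinity w \<noteq> \<one>\<^bsub>as_cohomology 1 RP_infinity\<^esub>"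
    using as_class_eq_one_iff[OF wc] infinite_sphere_sheet_cochain_not_null[OF w]
    by (simp add: carrier_as_rel_cohomology as_class_eq)
  fix a assume a: "a \<in> carrier (as_cohomology 1 RP_infinity) \<and> a \<noteq> \<one>\<^bsub>as_cohomology 1 RP_infinity\<^esub>"
  then obtain \<phi> where \<phi>: "\<phi> \<in> as_relcocycles 1 RP_infinity {}" "a = as_class 1 RP_infinity \<phi>"
    by (auto simp: carrier_as_rel_cohomology as_class_eq)
  with a have "\<not> null_cochain RP_infinity \<phi>" using as_class_eq_one_iff by blast
  from sheet_cochain_unique[OF antipodal_space_infinite_sphere RP_infinity_degree_one[OF \<phi>(1) this] w]
  show "a = as_class 1 RP_infinity w"
    unfolding \<phi>(2) as_class_eq_iff[OF \<phi>(1) wc] by (simp add: RP_infinity_def)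
qed

section \<open>Computing the cohomological index\<close>

lemma antipodal_space_top_of_set:
  fixes A :: "'a::real_normed_vector set"
  assumes "symmetric_set A"
  shows "antipodal_space (top_of_set A)"
  using assms by (auto simp: antipodal_space_def symmetric_set_def intro!: continuous_intros)

text \<open>
  The classifying map pulls the generator back to the class of a sheet cochain.  The powers that
  survive form an initial segment, so the supremum in the definition of the index is decided by a
  single power.
\<close>

lemma coh_index_sheet_cochain:
  fixes A :: "'a::real_normed_vector set"
  assumes sym: "symmetric_set A" and ne: "A \<noteq> {}" and cl: "\<exists>f. classifying_map A f"
  obtains w where "sheet_cochain (top_of_set A) w"
    "\<And>k. k \<ge> 1 \<Longrightarrow> enat k \<le> coh_index A \<longleftrightarrow>
       \<not> null_cochain (antipodal_quotient (top_of_set A)) (cup_power (antipodal_quotient (top_of_set A)) w (k - 1))"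
proof -
  let ?A = "top_of_set A" and ?Q = "antipodal_quotient (top_of_set A)"
  define f where "f = (SOME f. classifying_map A f)"
  have "classifying_map A f" unfolding f_def by (rule someI_ex[OF cl])
  then obtain g where f: "continuous_map ?Q RP_infinity f"
    and g: "continuous_map ?A infinite_sphere g" "\<And>u. u \<in> A \<Longrightarrow> g (- u) = - g u"
    and fg: "\<And>u. u \<in> A \<Longrightarrow> f (orbit u) = orbit (g u)"
    unfolding classifying_map_def orbit_def by blast
  obtain v where v: "sheet_cochain infinite_sphere v" by (rule infinite_sphere_sheet_cochain_exists)
  have vc: "v \<in> as_relcocycles 1 RP_infinity {}"
    unfolding RP_infinity_def by (rule sheet_cochain_cocycle[OF antipodal_space_infinite_sphere v])
  define w where "w = as_pullback ?Q f v"
  have w: "sheet_cochain ?A w"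
    unfolding w_def by (rule sheet_cochain_pullback[OF g(1) _ _ v]) (use g fg in auto)
  have wc: "w \<in> as_relcocycles 1 ?Q {}"
    by (rule sheet_cochain_cocycle[OF antipodal_space_top_of_set[OF sym] w])
  have fQ: "f a \<in> topspace RP_infinity" if "a \<in> topspace ?Q" for a
    using continuous_map_image_subset_topspace[OF f] that by blast
  have induced: "as_induced (int n) ?Q f (as_power RP_infinity RP_generator n) \<noteq> \<one>\<^bsub>as_cohomology (int n) ?Q\<^esub>
      \<longleftrightarrow> \<not> null_cochain ?Q (cup_power ?Q w n)" for n
  proof -
    have pc: "cup_power RP_infinity v n \<in> as_relcocycles (int n) RP_infinity {}" by (rule cup_power_cocycle[OF vc])
    have "as_induced (int n) ?Q f (as_power RP_infinity RP_generator n)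
        = as_class (int n) ?Q (as_pullback ?Q f (cup_power RP_infinity v n))"
      unfolding RP_generator_eq[OF v] as_power_as_class[OF vc] by (rule as_induced_as_class[OF f pc])
    then have "as_induced (int n) ?Q f (as_power RP_infinity RP_generator n) \<noteq> \<one>\<^bsub>as_cohomology (int n) ?Q\<^esub>
        \<longleftrightarrow> \<not> null_cochain ?Q (as_pullback ?Q f (cup_power RP_infinity v n))"
      by (simp add: as_class_eq_one_iff[OF as_pullback_cocycle[OF pc f]])
    also have "null_cochain ?Q (as_pullback ?Q f (cup_power RP_infinity v n)) = null_cochain ?Q (cup_power ?Q w n)"
    proof (rule null_cochain_cong)
      fix xs assume xs: "set xs \<subseteq> topspace ?Q"
      show "as_pullback ?Q f (cup_power RP_infinity v n) xs = cup_power ?Q w n xs"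
        unfolding w_def as_pullback_eq[OF xs] by (rule as_pullback_cup_power[OF fQ xs, symmetric])
    qed
    finally show ?thesis .
  qed
  have index: "coh_index A = Sup {enat m | m. m \<ge> 1 \<and> \<not> null_cochain ?Q (cup_power ?Q w (m - 1))}"
    using ne unfolding coh_index_def Let_def f_def[symmetric] induced by simp
  have "enat k \<le> coh_index A \<longleftrightarrow> \<not> null_cochain ?Q (cup_power ?Q w (k - 1))" if k: "k \<ge> 1" for k
  proof
    assume "\<not> null_cochain ?Q (cup_power ?Q w (k - 1))"
    then show "enat k \<le> coh_index A" unfolding index using k by (intro Sup_upper) blast
  next
    assume le: "enat k \<le> coh_index A"
    show "\<not> null_cochain ?Q (cup_power ?Q w (k - 1))"
    proof
      assume null: "null_cochain ?Q (cup_power ?Q w (k - 1))"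
      have "coh_index A \<le> enat (k - 1)"
        unfolding index
      proof (rule Sup_least)
        fix x assume "x \<in> {enat m | m. m \<ge> 1 \<and> \<not> null_cochain ?Q (cup_power ?Q w (m - 1))}"
        then obtain m where m: "x = enat m" "m \<ge> 1" "\<not> null_cochain ?Q (cup_power ?Q w (m - 1))" by blast
        have "\<not> k - 1 \<le> m - 1" using null_cup_power_mono[OF wc null] m(3) by blast
        then show "x \<le> enat (k - 1)" using m(1) by simp
      qed
      with le have "enat k \<le> enat (k - 1)" by (rule order_trans)
      then show False using k by simp
    qed
  qed
  with w show ?thesis by (rule that)
qed

section \<open>Separating a point from a closed subspace\<close>

definition sublinear :: "('a::real_vector \<Rightarrow> real) \<Rightarrow> bool" where
  "sublinear q \<longleftrightarrow> (\<forall>x y. q (x + y) \<le> q x + q y) \<and> (\<forall>t\<ge>0. \<forall>x. q (t *\<^sub>R x) = t * q x)"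

lemma sublinear_lower_bound: "sublinear q \<Longrightarrow> - q (- x) \<le> q x"
proof -
  assume q: "sublinear q"
  have "q (0 *\<^sub>R x) = 0 * q x" using q unfolding sublinear_def by blast
  then have "0 \<le> q x + q (- x)" using q unfolding sublinear_def by (metis add.right_inverse mult_zero_left scaleR_zero_left)
  then show ?thesis by simp
qed

definition sublinear_shift :: "('a::real_vector \<Rightarrow> real) \<Rightarrow> 'a \<Rightarrow> 'a \<Rightarrow> real" where
  "sublinear_shift q v x = (INF t\<in>{0..}. q (x + t *\<^sub>R v) - t * q v)"

text \<open>
  A sublinear functional below \<open>q\<close> that is as small as possible at \<open>- v\<close>: its value there is at most
  \<open>- q v\<close>.  A functional that cannot be lowered in this way is additive.
\<close>

lemma sublinear_shift:
  assumes q: "sublinear q"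
  shows "sublinear (sublinear_shift q v)" "sublinear_shift q v x \<le> q x" "0 \<le> t \<Longrightarrow> sublinear_shift q v x \<le> q (x + t *\<^sub>R v) - t * q v"
proof -
  have add: "q (x + y) \<le> q x + q y" and scale: "t \<ge> 0 \<Longrightarrow> q (t *\<^sub>R x) = t * q x" for x y t
    using q by (auto simp: sublinear_def)
  let ?g = "\<lambda>x t. q (x + t *\<^sub>R v) - t * q v"
  have lb: "- q (- x) \<le> ?g x t" if "t \<ge> 0" for x t
  proof -
    have "t * q v = q (x + t *\<^sub>R v + (- x))" using scale[OF that, of v] by simp
    also have "\<dots> \<le> q (x + t *\<^sub>R v) + q (- x)" by (rule add)
    finally show ?thesis by simp
  qed
  have bdd: "bdd_below (?g x ` {0..})" for x by (rule bdd_belowI2[of _ "- q (- x)"]) (simp add: lb)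
  have low: "sublinear_shift q v x \<le> ?g x t" if "t \<ge> 0" for x t
    unfolding sublinear_shift_def by (rule cINF_lower[OF bdd]) (use that in simp)
  have great: "c \<le> sublinear_shift q v x" if "\<And>t. t \<ge> 0 \<Longrightarrow> c \<le> ?g x t" for c x
    unfolding sublinear_shift_def by (rule cINF_greatest) (use that in auto)
  show "0 \<le> t \<Longrightarrow> sublinear_shift q v x \<le> ?g x t" for x t by (rule low)
  show "sublinear_shift q v x \<le> q x" for x using low[of 0 x] by simp
  show "sublinear (sublinear_shift q v)"
    unfolding sublinear_def
  proof (intro conjI allI impI)
    fix x y
    have "sublinear_shift q v (x + y) - ?g x s \<le> sublinear_shift q v y" if s: "s \<ge> 0" for s
    proof (rule great)
      fix t :: real assume t: "t \<ge> 0"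
      have "sublinear_shift q v (x + y) \<le> ?g (x + y) (s + t)" by (rule low) (use s t in simp)
      also have "q (x + y + (s + t) *\<^sub>R v) \<le> q (x + s *\<^sub>R v) + q (y + t *\<^sub>R v)"
        using add[of "x + s *\<^sub>R v" "y + t *\<^sub>R v"] by (simp add: algebra_simps)
      finally show "sublinear_shift q v (x + y) - ?g x s \<le> ?g y t" by (simp add: algebra_simps)
    qed
    then have "sublinear_shift q v (x + y) - sublinear_shift q v y \<le> sublinear_shift q v x"
      by (intro great) (simp add: algebra_simps)
    then show "sublinear_shift q v (x + y) \<le> sublinear_shift q v x + sublinear_shift q v y" by simp
  next
    fix c :: real and x :: 'a assume c: "0 \<le> c"
    show "sublinear_shift q v (c *\<^sub>R x) = c * sublinear_shift q v x"
    proof (cases "c = 0")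
      case True
      have "sublinear_shift q v 0 \<le> 0" using low[of 0 0] scale[of 0 0] by simp
      moreover have "0 \<le> sublinear_shift q v 0" by (rule great) (simp add: scale)
      ultimately show ?thesis using True by simp
    next
      case False
      then have c: "c > 0" using c by simp
      have g: "?g (c *\<^sub>R x) (c * t) = c * ?g x t" if "t \<ge> 0" for x t
        using scale[of c "x + t *\<^sub>R v"] c by (simp add: algebra_simps)
      have "c * sublinear_shift q v x \<le> sublinear_shift q v (c *\<^sub>R x)"
      proof (rule great)
        fix t :: real assume t: "0 \<le> t"
        have "c * sublinear_shift q v x \<le> c * ?g x (t / c)"
          by (rule mult_left_mono[OF low]) (use c t in auto)
        also have "\<dots> = ?g (c *\<^sub>R x) t" using g[of "t / c" x] c t by simp
        finally show "c * sublinear_shift q v x \<le> ?g (c *\<^sub>R x) t" .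
      qed
      moreover have "sublinear_shift q v (c *\<^sub>R x) / c \<le> sublinear_shift q v x"
      proof (rule great)
        fix t :: real assume t: "0 \<le> t"
        have "sublinear_shift q v (c *\<^sub>R x) \<le> ?g (c *\<^sub>R x) (c * t)" by (rule low) (use c t in simp)
        then show "sublinear_shift q v (c *\<^sub>R x) / c \<le> ?g x t"
          unfolding g[OF t] using c by (simp add: pos_divide_le_eq mult.commute)
      qed
      ultimately show ?thesis using c by (simp add: pos_divide_le_eq mult.commute)
    qed
  qed
qed

text \<open>
  A minimal sublinear functional below \<open>p\<close> exists by Zorn's lemma and is linear, since all its
  shifts coincide with it.  This is the Hahn--Banach theorem without partially defined functionals.
\<close>

theorem linear_below_sublinear:
  fixes p :: "'a::real_vector \<Rightarrow> real"
  assumes p: "sublinear p"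
  obtains f where "linear f" "\<And>x. f x \<le> p x"
proof -
  let ?A = "{q. sublinear q \<and> q \<le> p}" and ?P = "\<lambda>q q' :: 'a \<Rightarrow> real. q' \<le> q"
  have "\<exists>m\<in>?A. \<forall>a\<in>?A. ?P m a \<longrightarrow> a = m"
  proof (rule predicate_Zorn)
    show "partial_order_on ?A (relation_of ?P ?A)"
      by (rule partial_order_on_relation_ofI) auto
    fix C assume "C \<in> Chains (relation_of ?P ?A)"
    then have CA: "C \<subseteq> ?A" and chain: "\<And>q q'. q \<in> C \<Longrightarrow> q' \<in> C \<Longrightarrow> q \<le> q' \<or> q' \<le> q"
      by (auto simp: Chains_def relation_of_def)
    show "\<exists>u\<in>?A. \<forall>a\<in>C. u \<le> a"
    proof (cases "C = {}")
      case True
      then show ?thesis using p by blast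
    next
      case False
      have lb: "- p (- x) \<le> q x" if "q \<in> C" for q x
      proof -
        have "q (- x) \<le> p (- x)" "- q (- x) \<le> q x" using that CA sublinear_lower_bound by (auto simp: le_fun_def)
        then show ?thesis by simp
      qed
      define r where "r x = (INF q\<in>C. q x)" for x
      have low: "r x \<le> q x" if "q \<in> C" for q x
        unfolding r_def by (rule cINF_lower[OF _ that]) (rule bdd_belowI2[of _ "- p (- x)"], rule lb)
      have great: "c \<le> r x" if "\<And>q. q \<in> C \<Longrightarrow> c \<le> q x" for c x
        unfolding r_def by (rule cINF_greatest[OF False that])
      have "sublinear r"
        unfolding sublinear_def
      proof (intro conjI allI impI)
        fix x y
        have "r (x + y) - r y \<le> q x" if q: "q \<in> C" for q
        proof -
          have "r (x + y) - q x \<le> q' y" if q': "q' \<in> C" for q'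
          proof -
            obtain q'' where q'': "q'' \<in> C" "q'' \<le> q" "q'' \<le> q'" using chain[OF q q'] q q' by blast
            have "r (x + y) \<le> q'' (x + y)" by (rule low[OF q''(1)])
            also have "\<dots> \<le> q'' x + q'' y" using q''(1) CA by (auto simp: sublinear_def)
            also have "\<dots> \<le> q x + q' y" using q'' by (simp add: le_fun_def add_mono)
            finally show ?thesis by simp
          qed
          then have "r (x + y) - q x \<le> r y" by (rule great)
          then show ?thesis by simp
        qed
        then have "r (x + y) - r y \<le> r x" by (rule great)
        then show "r (x + y) \<le> r x + r y" by simp
      next
        fix t :: real and x :: 'a assume t: "0 \<le> t"
        have qt: "q (t *\<^sub>R x) = t * q x" if "q \<in> C" for q using that CA t by (auto simp: sublinear_def)
        show "r (t *\<^sub>R x) = t * r x"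
        proof (cases "t = 0")
          case True
          have "q 0 = 0" if "q \<in> C" for q using qt[OF that] True by simp
          then have "(\<lambda>q. q 0) ` C = {0}" using False by force
          then have "r 0 = 0" by (simp add: r_def)
          then show ?thesis using True by simp
        next
          case False
          then have t: "t > 0" using t by simp
          have "t * r x \<le> r (t *\<^sub>R x)" using low t by (intro great) (simp add: qt)
          moreover have "r (t *\<^sub>R x) / t \<le> r x"
            using low[of _ "t *\<^sub>R x"] t by (intro great) (simp add: qt pos_divide_le_eq mult.commute)
          ultimately show ?thesis using t by (simp add: pos_divide_le_eq mult.commute)
        qed
      qed
      moreover have "r \<le> p"
      proof -
        obtain q where q: "q \<in> C" using False by blast
        then have "q \<le> p" using CA by blast
        then have "r x \<le> p x" for x using low[OF q, of x] order_trans by (auto simp: le_fun_def)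
        then show ?thesis by (simp add: le_fun_def)
      qed
      ultimately show ?thesis using low by (intro bexI[of _ r]) (auto simp: le_fun_def)
    qed
  qed
  then obtain f where f: "sublinear f" "f \<le> p" and min: "\<And>q. sublinear q \<Longrightarrow> q \<le> f \<Longrightarrow> q = f"
    by (metis (mono_tags, lifting) mem_Collect_eq order_trans)
  have shift: "sublinear_shift f v = f" for v
    using sublinear_shift(1,2)[OF f(1)] by (intro min) (auto simp: le_fun_def)
  have "f x + f v \<le> f (x + v)" for x v
    using sublinear_shift(3)[OF f(1), of 1 v x] by (simp add: shift)
  moreover have "f (x + v) \<le> f x + f v" for x v using f(1) by (simp add: sublinear_def)
  ultimately have add: "f (x + v) = f x + f v" for x v by (simp add: antisym)
  have scale: "f (t *\<^sub>R x) = t * f x" if "t \<ge> 0" for t x using f(1) that by (simp add: sublinear_def)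
  have "f (0 + 0) = f 0 + f 0" by (rule add)
  then have "f 0 = 0" by simp
  then have neg: "f (- x) = - f x" for x using add[of x "- x"] by simp
  have "linear f"
  proof (rule linearI)
    show "f (t *\<^sub>R x) = t *\<^sub>R f x" for t x
      using scale[of t x] scale[of "- t" x] neg[of "t *\<^sub>R x"] by (cases "t \<ge> 0") auto
  qed (rule add)
  then show ?thesis using that f(2) by (simp add: le_fun_def)
qed

text \<open>
  The distance to \<open>Z\<close> is sublinear and vanishes on \<open>Z\<close>, so a linear functional below it vanishes on
  \<open>Z\<close>.  Starting from the shift in the direction \<open>u\<close> keeps its value at \<open>u\<close> positive.
\<close>

theorem separate_from_closed_subspace:
  fixes Z :: "'a::real_normed_vector set"
  assumes Z: "closed Z" "subspace Z" and u: "u \<notin> Z"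
  obtains f :: "'a dual" where "\<And>z. z \<in> Z \<Longrightarrow> blinfun_apply f z = 0" "blinfun_apply f u \<noteq> 0"
proof -
  define p where "p x = infdist x Z" for x
  have Z0: "0 \<in> Z" and ne: "Z \<noteq> {}" using subspace_0[OF Z(2)] by auto
  have low: "p x \<le> norm (x - z)" if "z \<in> Z" for x z
    using infdist_le[OF that, of x] by (simp add: p_def dist_norm)
  have great: "c \<le> p x" if "\<And>z. z \<in> Z \<Longrightarrow> c \<le> norm (x - z)" for c x
    unfolding p_def infdist_notempty[OF ne] by (rule cINF_greatest[OF ne]) (simp add: that dist_norm)
  have p: "sublinear p"
    unfolding sublinear_def
  proof (intro conjI allI impI)
    fix x y
    have "p (x + y) - p y \<le> norm (x - z)" if z: "z \<in> Z" for z
    proof -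
      have "p (x + y) - norm (x - z) \<le> norm (y - z')" if z': "z' \<in> Z" for z'
      proof -
        have "p (x + y) \<le> norm ((x + y) - (z + z'))" by (rule low) (rule subspace_add[OF Z(2) z z'])
        also have "\<dots> = norm ((x - z) + (y - z'))" by (simp add: algebra_simps)
        also have "\<dots> \<le> norm (x - z) + norm (y - z')" by (rule norm_triangle_ineq)
        finally show ?thesis by simp
      qed
      then have "p (x + y) - norm (x - z) \<le> p y" by (rule great)
      then show ?thesis by simp
    qed
    then have "p (x + y) - p y \<le> p x" by (rule great)
    then show "p (x + y) \<le> p x + p y" by simp
  next
    fix t :: real and x :: 'a assume t: "0 \<le> t"
    show "p (t *\<^sub>R x) = t * p x"
    proof (cases "t = 0")
      case True
      then show ?thesis using Z0 by (simp add: p_def)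
    next
      case False
      then have t: "t > 0" using t by simp
      have n: "norm (t *\<^sub>R x - t *\<^sub>R z) = t * norm (x - z)" for x z
        using t by (simp add: scaleR_diff_right[symmetric])
      have "t * p x \<le> p (t *\<^sub>R x)"
      proof (rule great)
        fix z assume z: "z \<in> Z"
        have "t * p x \<le> t * norm (x - (1/t) *\<^sub>R z)"
          by (intro mult_left_mono low subspace_scale[OF Z(2) z]) (use t in simp)
        also have "\<dots> = norm (t *\<^sub>R x - z)" unfolding n[symmetric] using t by simp
        finally show "t * p x \<le> norm (t *\<^sub>R x - z)" .
      qed
      moreover have "p (t *\<^sub>R x) / t \<le> p x"
      proof (rule great)
        fix z assume z: "z \<in> Z"
        have "p (t *\<^sub>R x) \<le> norm (t *\<^sub>R x - t *\<^sub>R z)" by (rule low) (rule subspace_scale[OF Z(2) z])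
        then show "p (t *\<^sub>R x) / t \<le> norm (x - z)" unfolding n using t by (simp add: pos_divide_le_eq mult.commute)
      qed
      ultimately show ?thesis using t by (simp add: pos_divide_le_eq mult.commute)
    qed
  qed
  obtain f where f: "linear f" "\<And>x. f x \<le> sublinear_shift p u x"
    using linear_below_sublinear[OF sublinear_shift(1)[OF p]] by blast
  have fp: "f x \<le> p x" for x using f(2) sublinear_shift(2)[OF p] order_trans by blast
  have neg: "f (- x) = - f x" for x by (rule linear_neg[OF f(1)])
  have bound: "\<bar>f x\<bar> \<le> norm x" for x
    using fp[of x] fp[of "- x"] low[OF Z0, of x] low[OF Z0, of "- x"] by (simp add: neg)
  have bl: "bounded_linear f"
  proof (rule bounded_linear_intro[where K = 1])
    show "f (x + y) = f x + f y" for x y by (rule linear_add[OF f(1)])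
    show "f (r *\<^sub>R x) = r *\<^sub>R f x" for r x by (rule linear_scale[OF f(1)])
    show "norm (f x) \<le> norm x * 1" for x using bound by simp
  qed
  have "f z = 0" if "z \<in> Z" for z
  proof -
    have "p z = 0" "p (- z) = 0" using that subspace_neg[OF Z(2) that] by (auto simp: p_def)
    then show ?thesis using fp[of z] fp[of "- z"] by (simp add: neg)
  qed
  moreover have "f u \<noteq> 0"
  proof -
    have "f (- u) \<le> p (- u + 1 *\<^sub>R u) - 1 * p u"
      using f(2)[of "- u"] sublinear_shift(3)[OF p, of 1 u "- u"] by linarith
    also have "\<dots> = - p u" using Z0 by (simp add: p_def)
    finally have "f u \<ge> p u" by (simp add: neg)
    moreover have "p u > 0" unfolding p_def using infdist_pos_not_in_closed[OF Z(1) ne u] .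
    ultimately show ?thesis by simp
  qed
  ultimately show ?thesis
    using that[of "Blinfun f"] by (simp add: bounded_linear_Blinfun_apply[OF bl])
qed

section \<open>Weak compactness in reflexive spaces\<close>

text \<open>
  Evaluation embeds the sequence into a product of compact intervals indexed by the dual space.  A
  cluster point there is a bounded linear functional on the dual, hence evaluation at some \<open>x\<close>.
  Closed conditions on single functionals that hold eventually pass to \<open>x\<close>; this is all that is
  used of weak compactness.
\<close>

theorem reflexive_weak_cluster_point:
  fixes u :: "nat \<Rightarrow> 'a::real_normed_vector"
  assumes refl: "reflexive_space TYPE('a)" and bdd: "bounded (range u)"
  shows "\<exists>x. \<forall>(f :: 'a dual) C N. closed C \<longrightarrow> (\<forall>n\<ge>N. blinfun_apply f (u n) \<in> C) \<longrightarrow> blinfun_apply f x \<in> C"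
proof -
  obtain R where R: "\<And>n. norm (u n) \<le> R" using bdd by (auto simp: bounded_iff)
  have R0: "0 \<le> R" using R[of 0] norm_ge_zero order_trans by blast
  define a where "a n = (\<lambda>f :: 'a dual. blinfun_apply f (u n))" for n
  define K where "K = (\<Pi>\<^sub>E f\<in>(UNIV :: 'a dual set). {- (norm f * R)..norm f * R})"
  have "compactin (product_topology (\<lambda>_. euclideanreal) UNIV) K"
    unfolding K_def compactin_PiE by simp
  then have K: "compact K" by (simp add: euclidean_product_topology)
  have aK: "a n \<in> K" for n
  proof -
    have "\<bar>blinfun_apply f (u n)\<bar> \<le> norm f * R" for f :: "'a dual"
      using norm_blinfun[of f "u n"] mult_left_mono[OF R[of n], of "norm f"] by simp
    then have "blinfun_apply f (u n) \<in> {- (norm f * R)..norm f * R}" for f :: "'a dual"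
      by (simp add: abs_le_iff minus_le_iff)
    then show ?thesis unfolding K_def a_def by (simp add: PiE_UNIV_domain)
  qed
  define F where "F = filtermap a sequentially"
  have "F \<noteq> bot" "eventually (\<lambda>x. x \<in> K) F" by (auto simp: F_def filtermap_bot_iff eventually_filtermap aK)
  then obtain L where L: "inf (nhds L) F \<noteq> bot" using K unfolding compact_filter by blast
  have closedL: "L \<in> D" if D: "closed D" and ev: "\<And>n. n \<ge> N \<Longrightarrow> a n \<in> D" for D N
  proof (rule ccontr)
    assume "L \<notin> D"
    then have "eventually (\<lambda>x. x \<in> - D) (nhds L)" using D by (intro eventually_nhds_in_open) auto
    moreover have "eventually (\<lambda>x. x \<in> D) F"
      unfolding F_def eventually_filtermap eventually_sequentially using ev by blast
    ultimately have "eventually (\<lambda>x. False) (inf (nhds L) F)"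
      unfolding eventually_inf by (intro exI[of _ "\<lambda>x. x \<in> - D"] exI[of _ "\<lambda>x. x \<in> D"]) auto
    then show False using L by (simp add: trivial_limit_def[symmetric])
  qed
  have coord: "continuous_on UNIV (\<lambda>L. L f)" for f :: "'a dual" by simp
  have add: "L (f + g) = L f + L g" for f g
  proof -
    have "closed {L :: 'a dual \<Rightarrow> real. L (f + g) = L f + L g}"
      by (intro closed_Collect_eq continuous_on_add coord)
    from closedL[OF this, of 0] show ?thesis by (simp add: a_def blinfun.add_left)
  qed
  have scale: "L (c *\<^sub>R f) = c * L f" for c f
  proof -
    have "closed {L :: 'a dual \<Rightarrow> real. L (c *\<^sub>R f) = c * L f}"
      by (intro closed_Collect_eq continuous_on_mult coord continuous_on_const)
    from closedL[OF this, of 0] show ?thesis by (simp add: a_def blinfun.scaleR_left)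
  qed
  have LR: "\<bar>L f\<bar> \<le> norm f * R" for f
  proof -
    have "closed {L :: 'a dual \<Rightarrow> real. \<bar>L f\<bar> \<le> norm f * R}"
      by (intro closed_Collect_le continuous_on_rabs coord continuous_on_const)
    moreover have "\<bar>a n f\<bar> \<le> norm f * R" for n
      using aK[of n] by (auto simp: K_def PiE_UNIV_domain Pi_iff abs_le_iff minus_le_iff)
    ultimately show ?thesis using closedL[of _ 0] by blast
  qed
  have "bounded_linear L"
    by (rule bounded_linear_intro[where K = R]) (auto simp: add scale LR)
  then obtain x where x: "\<And>f. L f = blinfun_apply f x"
    using refl unfolding reflexive_space_def by (metis bounded_linear_Blinfun_apply)
  have "blinfun_apply f x \<in> C" if C: "closed C" and ev: "\<And>n. n \<ge> N \<Longrightarrow> blinfun_apply f (u n) \<in> C" for f :: "'a dual" and C N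
  proof -
    have "closed ((\<lambda>L. L f) -` C)" by (rule closed_vimage[OF C coord])
    from closedL[OF this, of N] ev show ?thesis by (simp add: a_def x)
  qed
  then show ?thesis by (intro exI[of _ x] allI impI) blast
qed

text \<open>
  An increasing sequence of finite sets whose union contains the successive choices \<open>c\<close> and is
  closed under sums and rational multiples, so that its closure is a subspace.
\<close>

primrec rational_hull :: "('a::real_vector set \<Rightarrow> 'a) \<Rightarrow> nat \<Rightarrow> 'a set" where
  "rational_hull c 0 = {0}"
| "rational_hull c (Suc n) = insert (c (rational_hull c n)) (rational_hull c n)
     \<union> (\<lambda>(a, b). a + b) ` (rational_hull c n \<times> rational_hull c n)
     \<union> (\<lambda>(k, a). of_rat (nat_to_rat_surj k) *\<^sub>R a) ` ({..n} \<times> rational_hull c n)"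

lemma rational_hull_mono: "m \<le> n \<Longrightarrow> rational_hull c m \<subseteq> rational_hull c n"
  by (induction n rule: dec_induct) auto

lemma finite_rational_hull: "finite (rational_hull c n)"
  by (induction n) auto

lemma subspace_closure_rational_hull:
  fixes c :: "'a::real_normed_vector set \<Rightarrow> 'a"
  shows "subspace (closure (\<Union>n. rational_hull c n))" (is "subspace (closure ?D)")
proof (rule subspaceI)
  have "0 \<in> ?D" by (rule UN_I[of 0]) simp_all
  then show "0 \<in> closure ?D" by (rule subsetD[OF closure_subset])
next
  fix x y assume "x \<in> closure ?D" "y \<in> closure ?D"
  then have "x + y \<in> closure (?D + ?D)" using closure_sum[of ?D ?D] by (meson set_plus_intro subsetD)
  moreover have "?D + ?D \<subseteq> ?D"
  proof
    fix z assume "z \<in> ?D + ?D"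
    then obtain a b m n where "z = a + b" "a \<in> rational_hull c m" "b \<in> rational_hull c n"
      by (auto simp: set_plus_def)
    then have "z \<in> rational_hull c (Suc (max m n))"
      using rational_hull_mono[of m "max m n" c] rational_hull_mono[of n "max m n" c] by force
    then show "z \<in> ?D" by blast
  qed
  ultimately show "x + y \<in> closure ?D" using closure_mono by blast
next
  fix x and t :: real assume x: "x \<in> closure ?D"
  have "q *\<^sub>R y \<in> closure ?D" if q: "q \<in> \<rat>" and y: "y \<in> closure ?D" for q :: real and y
  proof -
    have "q *\<^sub>R z \<in> ?D" if z: "z \<in> ?D" for z
    proof -
      obtain k where k: "q = of_rat (nat_to_rat_surj k)" using q surj_nat_to_rat_surj by (metis Rats_cases surjD)
      obtain n where "z \<in> rational_hull c n" using z by blast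
      then have "z \<in> rational_hull c (max n k)" using rational_hull_mono[of n "max n k" c] by auto
      then have "q *\<^sub>R z \<in> rational_hull c (Suc (max n k))" unfolding k by (force intro!: image_eqI[of _ _ "(k, z)"])
      then show ?thesis by blast
    qed
    then have "(\<lambda>z. q *\<^sub>R z) ` ?D \<subseteq> closure ?D" using closure_subset[of ?D] by (meson image_subsetI subsetD)
    then have "(\<lambda>z. q *\<^sub>R z) ` closure ?D \<subseteq> closure ?D"
      by (intro image_closure_subset) (auto intro!: continuous_intros)
    then show ?thesis using y by (meson image_subset_iff)
  qed
  then have "\<rat> \<subseteq> {q. q *\<^sub>R x \<in> closure ?D}" using x by blast
  moreover have "closed {q. q *\<^sub>R x \<in> closure ?D}"
  proof -
    have "closed ((\<lambda>q. q *\<^sub>R x) -` closure ?D)" by (rule continuous_closed_vimage) (auto intro!: continuous_intros)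
    then show ?thesis by (simp add: vimage_def)
  qed
  ultimately have "closure \<rat> \<subseteq> {q. q *\<^sub>R x \<in> closure ?D}" by (rule closure_minimal)
  then show "t *\<^sub>R x \<in> closure ?D" using Rats_closure_real by auto
qed

text \<open>
  Otherwise there is a sequence \<open>u\<^sub>n\<close> in \<open>K\<close> that is killed by \<open>B(v)\<close> for more and more vectors \<open>v\<close>,
  namely for a set that is dense in the closed span \<open>Z\<close> of the sequence.  Every weak cluster point
  \<open>x\<close> lies in \<open>Z\<close> and is killed by all these functionals, so \<open>B(x)x = 0\<close> by continuity of \<open>B\<close>, and
  \<open>x = 0\<close>.  Thus \<open>u\<^sub>n\<close> converges weakly to \<open>0\<close>, and \<open>J(u\<^sub>n) \<rightarrow> 0\<close>.  Choosing the sequence in this way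
  replaces the extraction of weakly convergent subsequences.
\<close>

theorem finitely_many_functionals:
  fixes B :: "'a::real_normed_vector \<Rightarrow> 'a dual" and J :: "'a \<Rightarrow> real"
  assumes refl: "reflexive_space TYPE('a)"
    and B: "continuous_on UNIV B" "\<And>u. u \<noteq> 0 \<Longrightarrow> blinfun_apply (B u) u > 0"
    and J: "\<And>X. bounded (range X) \<Longrightarrow> weakly_converges X 0 \<Longrightarrow> (\<lambda>n. J (X n)) \<longlonglongrightarrow> 0"
    and K: "bounded K" "c > 0" "\<And>u. u \<in> K \<Longrightarrow> J u \<ge> c"
  obtains V where "finite V" "\<And>u. u \<in> K \<Longrightarrow> \<exists>v\<in>V. blinfun_apply (B v) u \<noteq> 0"
proof (rule ccontr)
  assume "\<not> thesis"
  then have "\<forall>V. finite V \<longrightarrow> (\<exists>u\<in>K. \<forall>v\<in>V. blinfun_apply (B v) u = 0)" using that by blast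
  then obtain pick where pick: "\<And>V. finite V \<Longrightarrow> pick V \<in> K \<and> (\<forall>v\<in>V. blinfun_apply (B v) (pick V) = 0)"
    by metis
  define F where "F = rational_hull pick"
  define u where "u n = pick (F n)" for n
  define Z where "Z = closure (\<Union>n. F n)"
  have uK: "u n \<in> K" and uF: "v \<in> F n \<Longrightarrow> blinfun_apply (B v) (u n) = 0" for n v
    using pick[OF finite_rational_hull] by (auto simp: u_def F_def)
  have Z: "closed Z" "subspace Z" unfolding Z_def F_def by (simp, rule subspace_closure_rational_hull)
  have uZ: "u n \<in> Z" for n
  proof -
    have "u n \<in> F (Suc n)" by (simp add: u_def F_def)
    then have "u n \<in> (\<Union>n. F n)" by (rule UN_I[rotated]) simp
    then show ?thesis unfolding Z_def by (rule subsetD[OF closure_subset])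
  qed
  have bdd: "bounded (range u)" by (rule bounded_subset[OF K(1)]) (use uK in blast)
  have "weakly_converges u 0"
    unfolding weakly_converges_def
  proof
    fix f :: "'a dual"
    show "(\<lambda>n. blinfun_apply f (u n)) \<longlonglongrightarrow> blinfun_apply f 0"
    proof (rule ccontr)
      assume "\<not> ?thesis"
      then obtain e where e: "e > 0" "\<And>N. \<exists>n\<ge>N. e \<le> \<bar>blinfun_apply f (u n)\<bar>"
        unfolding LIMSEQ_def by (auto simp: not_less blinfun.zero_right)
      then have "\<exists>\<^sub>\<infinity>n. e \<le> \<bar>blinfun_apply f (u n)\<bar>" by (simp add: INFM_nat_le)
      then obtain r :: "nat \<Rightarrow> nat" where r: "strict_mono r" "\<And>n. e \<le> \<bar>blinfun_apply f (u (r n))\<bar>"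
        using infinite_enumerate[of "{n. e \<le> \<bar>blinfun_apply f (u n)\<bar>}"] by (auto simp: frequently_cofinite)
      have bdd': "bounded (range (\<lambda>n. u (r n)))" by (rule bounded_subset[OF bdd]) blast
      from reflexive_weak_cluster_point[OF refl bdd']
      obtain x where "\<forall>(f :: 'a dual) C N. closed C \<longrightarrow> (\<forall>n\<ge>N. blinfun_apply f (u (r n)) \<in> C) \<longrightarrow> blinfun_apply f x \<in> C" ..
      then have x: "blinfun_apply f x \<in> C" if "closed C" "\<And>n. n \<ge> N \<Longrightarrow> blinfun_apply f (u (r n)) \<in> C"
        for f :: "'a dual" and C N using that by blast
      have "blinfun_apply f x \<in> {y. e \<le> \<bar>y\<bar>}"
        by (rule x[of _ 0]) (use r(2) in \<open>auto intro!: closed_Collect_le continuous_intros\<close>)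
      then have "x \<noteq> 0" using e(1) by auto
      have "x \<in> Z"
      proof (rule ccontr)
        assume "x \<notin> Z"
        from separate_from_closed_subspace[OF Z this] obtain g :: "'a dual"
          where g: "\<And>z. z \<in> Z \<Longrightarrow> blinfun_apply g z = 0" "blinfun_apply g x \<noteq> 0" by blast
        have "blinfun_apply g x \<in> {0}" by (rule x[of _ 0]) (use g(1) uZ in auto)
        with g(2) show False by simp
      qed
      have D: "blinfun_apply (B v) x = 0" if v: "v \<in> (\<Union>n. F n)" for v
      proof -
        obtain m where m: "v \<in> F m" using v by blast
        have "blinfun_apply (B v) x \<in> {0}"
        proof (rule x[of _ m])
          fix n assume "n \<ge> m"
          then have "m \<le> r n" using strict_mono_imp_increasing[OF r(1), of n] by linarith
          then have "v \<in> F (r n)" using m rational_hull_mono[of m "r n" pick] by (auto simp: F_def)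
          then show "blinfun_apply (B v) (u (r n)) \<in> {0}" using uF by simp
        qed simp
        then show ?thesis by simp
      qed
      have "closed {v. blinfun_apply (B v) x = 0}"
        using B(1) by (intro closed_Collect_eq continuous_intros) auto
      then have "closure (\<Union>n. F n) \<subseteq> {v. blinfun_apply (B v) x = 0}"
        using D by (intro closure_minimal) auto
      then have "blinfun_apply (B x) x = 0" using \<open>x \<in> Z\<close> by (auto simp: Z_def)
      with B(2)[OF \<open>x \<noteq> 0\<close>] show False by simp
    qed
  qed
  from J[OF bdd this] have "(\<lambda>n. J (u n)) \<longlonglongrightarrow> 0" .
  then have "c \<le> 0" by (rule LIMSEQ_le_const) (use K(3) uK in blast)
  with K(2) show False by simp
qed

section \<open>Potentials of scaled operators\<close>

lemma potential_ray_derivative: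
  assumes "potential_of q Q"
  shows "((\<lambda>\<tau>. Q (\<tau> *\<^sub>R u)) has_real_derivative blinfun_apply (q (\<tau> *\<^sub>R u)) u) (at \<tau>)"
proof -
  have "(Q has_derivative blinfun_apply (q (\<tau> *\<^sub>R u))) (at (\<tau> *\<^sub>R u))"
    using assms by (simp add: potential_of_def)
  moreover have "((\<lambda>\<tau>. \<tau> *\<^sub>R u) has_derivative (\<lambda>h. h *\<^sub>R u)) (at \<tau>)"
    by (auto intro!: derivative_eq_intros)
  ultimately have "((\<lambda>\<tau>. Q (\<tau> *\<^sub>R u)) has_derivative (\<lambda>h. blinfun_apply (q (\<tau> *\<^sub>R u)) (h *\<^sub>R u))) (at \<tau>)"
    by (rule has_derivative_compose[rotated])
  then show ?thesis
    by (rule has_derivative_imp_has_field_derivative) (simp add: blinfun.scaleR_right)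
qed

lemma potential_mean_value:
  assumes "potential_of q Q"
  obtains \<tau> where "0 < \<tau>" "\<tau> < 1" "Q u = blinfun_apply (q (\<tau> *\<^sub>R u)) u"
proof -
  have "\<exists>z>0. z < 1 \<and> Q (1 *\<^sub>R u) - Q (0 *\<^sub>R u) = (1 - 0) * blinfun_apply (q (z *\<^sub>R u)) u"
    by (rule MVT2) (auto intro: potential_ray_derivative[OF assms])
  then show ?thesis using that assms by (auto simp: potential_of_def)
qed

lemma potential_positive:
  assumes Q: "potential_of q Q" and pos: "\<And>u. u \<noteq> 0 \<Longrightarrow> blinfun_apply (q u) u > 0" and u: "u \<noteq> 0"
  shows "Q u > 0"
proof -
  obtain \<tau> where \<tau>: "0 < \<tau>" "Q u = blinfun_apply (q (\<tau> *\<^sub>R u)) u"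
    using potential_mean_value[OF Q] by blast
  have "0 < blinfun_apply (q (\<tau> *\<^sub>R u)) (\<tau> *\<^sub>R u)" by (rule pos) (use \<tau> u in simp)
  then show ?thesis using \<tau> by (simp add: blinfun.scaleR_right zero_less_mult_iff)
qed

lemma potential_continuous: "potential_of q Q \<Longrightarrow> continuous_on S Q"
  unfolding potential_of_def
  by (meson continuous_at_imp_continuous_on has_derivative_continuous)

lemma potential_even:
  assumes Q: "potential_of q Q" and odd: "\<And>u. q (- u) = - q u"
  shows "Q (- u) = Q u"
proof -
  have "((\<lambda>\<tau>. Q (\<tau> *\<^sub>R (- u)) - Q (\<tau> *\<^sub>R u)) has_real_derivative 0) (at \<tau>)" for \<tau>
  proof -
    have "blinfun_apply (q (\<tau> *\<^sub>R (- u))) (- u) - blinfun_apply (q (\<tau> *\<^sub>R u)) u = 0"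
      by (simp add: odd blinfun.minus_left blinfun.minus_right)
    then show ?thesis
      using DERIV_diff[OF potential_ray_derivative[OF Q, of "- u" \<tau>] potential_ray_derivative[OF Q, of u \<tau>]] by simp
  qed
  then have "Q (1 *\<^sub>R (- u)) - Q (1 *\<^sub>R u) = Q (0 *\<^sub>R (- u)) - Q (0 *\<^sub>R u)"
    by (intro DERIV_isconst_all) blast
  then show ?thesis by simp
qed

text \<open>
  Both sides have the same derivative along the rays through \<open>u\<^sub>t\<close> and \<open>u\<close>, because the scaling is
  homogeneous, and they agree at \<open>0\<close>.
\<close>

lemma potential_scaled:
  assumes Q: "potential_of q Q" and sc: "scaling s sc" and q: "scaled_operator s sc q" and t: "t \<ge> 0"
  shows "Q (sc u t) = t powr s * Q u"
proof -
  have "((\<lambda>\<tau>. Q (\<tau> *\<^sub>R sc u t) - t powr s * Q (\<tau> *\<^sub>R u)) has_real_derivative 0) (at \<tau>)" for \<tau>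
  proof -
    have "\<tau> *\<^sub>R sc u t = sc (\<tau> *\<^sub>R u) t" using sc t by (simp add: scaling_def)
    then have "blinfun_apply (q (\<tau> *\<^sub>R sc u t)) (sc u t) = t powr s * blinfun_apply (q (\<tau> *\<^sub>R u)) u"
      using q t by (simp add: scaled_operator_def)
    then show ?thesis
      using DERIV_diff[OF potential_ray_derivative[OF Q, of "sc u t" \<tau>]
          DERIV_cmult[OF potential_ray_derivative[OF Q, of u \<tau>], of "t powr s"]] by simp
  qed
  then have "Q (1 *\<^sub>R sc u t) - t powr s * Q (1 *\<^sub>R u) = Q (0 *\<^sub>R sc u t) - t powr s * Q (0 *\<^sub>R u)"
    by (intro DERIV_isconst_all) blast
  then show ?thesis using Q by (simp add: potential_of_def)
qed

text \<open>
  By the mean value theorem \<open>Q(u\<^sub>n) = q(\<tau>\<^sub>n u\<^sub>n) u\<^sub>n\<close> with \<open>\<tau>\<^sub>n\<close> between \<open>0\<close> and \<open>1\<close>, and \<open>\<tau>\<^sub>n u\<^sub>n\<close> is again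
  weakly null.
\<close>

lemma potential_weakly_null:
  fixes q :: "'a::real_normed_vector \<Rightarrow> 'a dual"
  assumes Q: "potential_of q Q" and q0: "q 0 = 0"
    and d: "\<And>X u. weakly_converges X u \<Longrightarrow> (\<lambda>j. q (X j)) \<longlonglongrightarrow> q u"
    and X: "bounded (range X)" "weakly_converges X 0"
  shows "(\<lambda>n. Q (X n)) \<longlonglongrightarrow> 0"
proof -
  obtain R where R: "\<And>n. norm (X n) \<le> R" using X(1) by (auto simp: bounded_iff)
  have "\<exists>\<tau>. 0 < \<tau> \<and> \<tau> < 1 \<and> Q (X n) = blinfun_apply (q (\<tau> *\<^sub>R X n)) (X n)" for n
    using potential_mean_value[OF Q, of "X n"] by metis
  then obtain \<tau> where \<tau>: "\<And>n. 0 < \<tau> n" "\<And>n. \<tau> n < 1" "\<And>n. Q (X n) = blinfun_apply (q (\<tau> n *\<^sub>R X n)) (X n)"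
    by metis
  have "weakly_converges (\<lambda>n. \<tau> n *\<^sub>R X n) 0"
    unfolding weakly_converges_def
  proof
    fix f :: "'a dual"
    have f0: "(\<lambda>n. norm (blinfun_apply f (X n))) \<longlonglongrightarrow> 0"
      using X(2) unfolding weakly_converges_def by (metis blinfun.zero_right tendsto_norm_zero)
    have "\<forall>n. norm (blinfun_apply f (\<tau> n *\<^sub>R X n)) \<le> norm (blinfun_apply f (X n))"
      using \<tau>(1,2) by (auto simp: blinfun.scaleR_right abs_mult less_imp_le intro!: mult_left_le_one_le)
    then have "(\<lambda>n. blinfun_apply f (\<tau> n *\<^sub>R X n)) \<longlonglongrightarrow> 0"
      by (rule Lim_null_comparison[OF always_eventually f0])
    then show "(\<lambda>n. blinfun_apply f (\<tau> n *\<^sub>R X n)) \<longlonglongrightarrow> blinfun_apply f 0" by (simp add: blinfun.zero_right)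
  qed
  from d[OF this] have "(\<lambda>n. q (\<tau> n *\<^sub>R X n)) \<longlonglongrightarrow> 0" unfolding q0 .
  then have lim: "(\<lambda>n. norm (q (\<tau> n *\<^sub>R X n)) * R) \<longlonglongrightarrow> 0"
    by (intro tendsto_mult_left_zero tendsto_norm_zero)
  have bound: "\<forall>n. norm (Q (X n)) \<le> norm (q (\<tau> n *\<^sub>R X n)) * R"
  proof
    fix n
    have "norm (Q (X n)) \<le> norm (q (\<tau> n *\<^sub>R X n)) * norm (X n)" unfolding \<tau>(3)[of n] by (rule norm_blinfun)
    also have "\<dots> \<le> norm (q (\<tau> n *\<^sub>R X n)) * R" by (rule mult_left_mono[OF R norm_ge_zero])
    finally show "norm (Q (X n)) \<le> norm (q (\<tau> n *\<^sub>R X n)) * R" .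
  qed
  show ?thesis by (rule Lim_null_comparison[OF always_eventually[OF bound] lim])
qed

section \<open>Critical groups of homogeneous functionals\<close>

locale scaled_functionals =
  fixes s :: real and sc :: "'a::real_normed_vector \<Rightarrow> real \<Rightarrow> 'a" and I J :: "'a \<Rightarrow> real"
  assumes scal: "scaling s sc"
    and I_cont: "continuous_on UNIV I" and J_cont: "continuous_on UNIV J"
    and I_sc: "\<And>u t. t \<ge> 0 \<Longrightarrow> I (sc u t) = t powr s * I u"
    and J_sc: "\<And>u t. t \<ge> 0 \<Longrightarrow> J (sc u t) = t powr s * J u"
    and I_pos: "\<And>u. u \<noteq> 0 \<Longrightarrow> I u > 0" and J_pos: "\<And>u. u \<noteq> 0 \<Longrightarrow> J u > 0"
    and I0: "I 0 = 0" and J0: "J 0 = 0"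
begin

lemma sc_0: "sc u 0 = 0" and sc_1: "sc u 1 = u" and s_pos: "s > 0"
  and sc_sc: "t1 \<ge> 0 \<Longrightarrow> t2 \<ge> 0 \<Longrightarrow> sc (sc u t1) t2 = sc u (t1 * t2)"
  and sc_cont: "continuous_on (UNIV \<times> {0..}) (\<lambda>(u, t). sc u t)"
  using scal unfolding scaling_def by auto

lemma sc_eq_0_iff: "t > 0 \<Longrightarrow> sc u t = 0 \<longleftrightarrow> u = 0"
  using I_sc[of t u] I_pos[of u] I_pos[of "sc u t"] I0 by (metis less_irrefl less_imp_le mult_eq_0_iff powr_gt_zero)

lemma mem_Psi_sublevel: "u \<in> Psi_sublevel I J lam \<longleftrightarrow> I u = 1 \<and> I u \<le> lam * J u"
proof (cases "I u = 1")
  case True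
  then have "u \<noteq> 0" using I0 by auto
  then have "J u > 0" by (rule J_pos)
  then show ?thesis using True by (simp add: Psi_sublevel_def level_manifold_def Psi_tilde_def pos_divide_le_eq)
qed (simp add: Psi_sublevel_def level_manifold_def)

definition level_retraction :: "'a \<Rightarrow> 'a" where
  "level_retraction u = sc u ((1 / I u) powr (1 / s))"

text \<open>
  Since \<open>I(u\<^sub>t) = t\<^sup>s I(u)\<close>, the exponent \<open>1/s\<close> brings \<open>u\<close> to the level \<open>I = 1\<close>; the sign of
  \<open>I - \<lambda>J\<close> does not change under the scaling.
\<close>

lemma level_retraction:
  assumes "u \<noteq> 0" "I u \<le> lam * J u"
  shows "level_retraction u \<in> Psi_sublevel I J lam"
proof -
  have "((1 / I u) powr (1 / s)) powr s = 1 / I u"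
    using I_pos[OF assms(1)] s_pos by (simp add: powr_powr)
  then have "I (level_retraction u) = 1" "J (level_retraction u) = J u / I u"
    using I_pos[OF assms(1)] by (simp_all add: level_retraction_def I_sc J_sc)
  then show ?thesis
    using assms(2) I_pos[OF assms(1)] by (simp add: mem_Psi_sublevel pos_le_divide_eq)
qed

lemma nonpositive_set_empty_sublevel:
  assumes "Psi_sublevel I J lam = {}"
  shows "{u. I u - lam * J u \<le> 0} = {0}"
  using assms level_retraction[of _ lam] I0 J0 by auto

lemma continuous_on_sc:
  assumes "continuous_on S f" "continuous_on S g" "\<And>x. x \<in> S \<Longrightarrow> g x \<ge> 0"
  shows "continuous_on S (\<lambda>x. sc (f x) (g x))"
proof -
  have "continuous_on S (\<lambda>x. (f x, g x))" by (intro continuous_intros assms)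
  moreover have "(\<lambda>x. (f x, g x)) ` S \<subseteq> UNIV \<times> {0..}" using assms(3) by auto
  ultimately have "continuous_on S ((\<lambda>(u, t). sc u t) \<circ> (\<lambda>x. (f x, g x)))"
    by (intro continuous_on_compose continuous_on_subset[OF sc_cont])
  then show ?thesis by (simp add: o_def)
qed

theorem critical_group_iso_reduced:
  assumes ne: "Psi_sublevel I J lam \<noteq> {}"
  shows "critical_group (\<lambda>u. I u - lam * J u) l \<cong> as_reduced_cohomology (int l - 1) (top_of_set (Psi_sublevel I J lam))"
proof -
  define X where "X = {u. I u - lam * J u \<le> 0}"
  define S where "S = X - {0}"
  define \<rho> where "\<rho> u = (1 / I u) powr (1 / s)" for u
  let ?T = "Psi_sublevel I J lam"
  have sc_X: "sc u t \<in> X" if "u \<in> X" "t \<ge> 0" for u t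
  proof -
    have "I (sc u t) - lam * J (sc u t) = t powr s * (I u - lam * J u)"
      using that by (simp add: I_sc J_sc algebra_simps)
    also have "\<dots> \<le> 0" using that by (simp add: X_def mult_nonneg_nonpos)
    finally show ?thesis by (simp add: X_def)
  qed
  have sc_S: "sc u t \<in> S" if "u \<in> S" "t > 0" for u t
    using sc_X[of u t] that sc_eq_0_iff[OF that(2)] by (auto simp: S_def)
  have TS: "?T \<subseteq> S" using I0 by (auto simp: mem_Psi_sublevel S_def X_def)
  have \<rho>_pos: "\<rho> u > 0" if "u \<in> S" for u
    using I_pos[of u] that by (simp add: \<rho>_def S_def)
  have \<rho>_cont: "continuous_on S \<rho>"
    unfolding \<rho>_def
    by (intro continuous_intros continuous_on_subset[OF I_cont]) (use I_pos in \<open>force simp: S_def\<close>)+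
  have "as_rel_cohomology (int l) (top_of_set X) S \<cong> as_reduced_cohomology (int l - 1) (top_of_set ?T)"
  proof (rule rel_cohomology_contractible[OF TS _ ne])
    show "S \<subseteq> X" by (auto simp: S_def)
    show "0 \<in> X" by (simp add: X_def I0 J0)
    show "homotopic_with (\<lambda>h. True) (top_of_set X) (top_of_set X) (\<lambda>x. x) (\<lambda>x. 0)"
      unfolding homotopic_with_def
    proof (intro exI[of _ "\<lambda>(t, u). sc u (1 - t)"] conjI)
      show "continuous_map (prod_topology (top_of_set {0..1}) (top_of_set X)) (top_of_set X) (\<lambda>(t, u). sc u (1 - t))"
        using sc_X by (auto simp: case_prod_unfold intro!: continuous_on_sc continuous_intros)
    qed (auto simp: sc_0 sc_1)
    show "continuous_on S level_retraction"
      unfolding level_retraction_def \<rho>_def[symmetric]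
      by (intro continuous_on_sc \<rho>_cont continuous_intros) (use \<rho>_pos in \<open>force intro: less_imp_le\<close>)
    show "level_retraction ` S \<subseteq> ?T"
      using level_retraction[of _ lam] by (auto simp: S_def X_def)
    show "level_retraction x = x" if "x \<in> ?T" for x
      using that by (simp add: mem_Psi_sublevel level_retraction_def sc_1)
    show "homotopic_with (\<lambda>h. True) (top_of_set S) (top_of_set S) (\<lambda>x. x) level_retraction"
      unfolding homotopic_with_def
    proof (intro exI[of _ "\<lambda>(t, u). sc u ((1 - t) + t * \<rho> u)"] conjI)
      have pos: "(1 - t) + t * \<rho> u > 0" if "t \<in> {0..1}" "u \<in> S" for t u
        using \<rho>_pos[OF that(2)] that(1) by (cases "t = 0") (auto intro: add_nonneg_pos)
      have nonneg: "(1 - fst x) + fst x * \<rho> (snd x) \<ge> 0" if "x \<in> {0..1} \<times> S" for x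
        using pos[of "fst x" "snd x"] that by auto
      have "continuous_on ({0..1} \<times> S) (\<lambda>x. \<rho> (snd x))"
        by (rule continuous_on_compose2[OF \<rho>_cont]) (auto intro!: continuous_intros)
      then have "continuous_on ({0..1} \<times> S) (\<lambda>x. sc (snd x) ((1 - fst x) + fst x * \<rho> (snd x)))"
        by (intro continuous_on_sc continuous_intros nonneg)
      then show "continuous_map (prod_topology (top_of_set {0..1}) (top_of_set S)) (top_of_set S) (\<lambda>(t, u). sc u ((1 - t) + t * \<rho> u))"
        using pos sc_S by (auto simp: case_prod_unfold)
    qed (auto simp: sc_1 level_retraction_def \<rho>_def)
  qed
  then show ?thesis by (simp add: critical_group_def X_def S_def)
qed

theorem critical_group_iso_point:
  assumes "Psi_sublevel I J lam = {}"
  shows "critical_group (\<lambda>u. I u - lam * J u) l \<cong> (if l = 0 then integer_mod_group 2 else singleton_group 0)"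
  unfolding critical_group_def nonpositive_set_empty_sublevel[OF assms]
  using point_cohomology[of l "0::'a"] by simp

end

section \<open>The index of sets carrying odd functions\<close>

lemma continuous_map_antipodal_quotient:
  assumes g: "continuous_map X Y g" and fg: "\<And>x. x \<in> topspace X \<Longrightarrow> f (orbit x) = orbit (g x)"
  shows "continuous_map (antipodal_quotient X) (antipodal_quotient Y) f"
  unfolding continuous_map
proof (intro conjI allI impI)
  show "f ` topspace (antipodal_quotient X) \<subseteq> topspace (antipodal_quotient Y)"
    using fg continuous_map_image_subset_topspace[OF g] by auto
  fix V assume "openin (antipodal_quotient Y) V"
  from openin_continuous_map_preimage[OF continuous_map_compose[OF g continuous_map_orbit] this]
  have "openin X {x \<in> topspace X. orbit (g x) \<in> V}" by simp
  moreover have "{x \<in> topspace X. orbit (g x) \<in> V} = {x \<in> topspace X. orbit x \<in> {a \<in> topspace (antipodal_quotient X). f a \<in> V}}"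
    using fg by auto
  ultimately show "openin (antipodal_quotient X) {a \<in> topspace (antipodal_quotient X). f a \<in> V}"
    unfolding openin_antipodal_quotient_orbit by auto
qed

text \<open>
  Normalising the vector of the functions \<open>h\<^sub>i\<close> maps \<open>A\<close> to a finite sphere in the infinite one.  On
  orbits the covered map is the image under this map, since the latter is odd.
\<close>

lemma classifying_map_exists:
  fixes A :: "'a::real_normed_vector set" and h :: "nat \<Rightarrow> 'a \<Rightarrow> real"
  assumes sym: "symmetric_set A"
    and h: "\<And>i. i < n \<Longrightarrow> continuous_on A (h i)" "\<And>i u. i < n \<Longrightarrow> h i (- u) = - h i u"
    and nz: "\<And>u. u \<in> A \<Longrightarrow> \<exists>i<n. h i u \<noteq> 0"
  shows "\<exists>f. classifying_map A f"
proof -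
  define N where "N u = sqrt (\<Sum>j<n. (h j u)\<^sup>2)" for u
  define g where "g u = (\<lambda>i. if i < n then h i u / N u else 0)" for u
  have N: "N u > 0" if u: "u \<in> A" for u
  proof -
    obtain i where i: "i < n" "h i u \<noteq> 0" using nz[OF u] by blast
    have "0 < (h i u)\<^sup>2" using i by simp
    also have "\<dots> \<le> (\<Sum>j<n. (h j u)\<^sup>2)" using i by (intro member_le_sum) auto
    finally show ?thesis by (simp add: N_def)
  qed
  have N_cont: "continuous_on A N" unfolding N_def by (intro continuous_intros h) auto
  have g_odd: "g (- u) = - g u" for u
  proof -
    have "N (- u) = N u" by (simp add: N_def h(2))
    then show ?thesis by (auto simp: g_def h(2))
  qed
  have g_sphere: "g u \<in> topspace (nsphere n)" if u: "u \<in> A" for u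
  proof -
    have "(\<Sum>i\<le>n. (g u i)\<^sup>2) = (\<Sum>i<n. (h i u / N u)\<^sup>2)"
      by (rule sum.mono_neutral_cong_right) (auto simp: g_def)
    also have "\<dots> = (\<Sum>i<n. (h i u)\<^sup>2) / (N u)\<^sup>2" by (simp add: power_divide sum_divide_distrib)
    also have "(\<Sum>i<n. (h i u)\<^sup>2) = (N u)\<^sup>2" by (simp add: N_def sum_nonneg)
    finally show ?thesis using N[OF u] by (simp add: topspace_nsphere_iff g_def)
  qed
  have "continuous_map (top_of_set A) (powertop_real UNIV) g"
    unfolding continuous_map_componentwise_UNIV
  proof
    fix i
    have "continuous_on A (\<lambda>u. h i u / N u)" if "i < n"
      by (intro continuous_intros h(1)[OF that] N_cont) (use N in force)
    then show "continuous_map (top_of_set A) euclideanreal (\<lambda>u. g u i)" by (cases "i < n") (auto simp: g_def)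
  qed
  then have "continuous_map (top_of_set A) (nsphere n) g"
    using g_sphere by (subst nsphere) (auto simp: continuous_map_in_subtopology topspace_nsphere_iff)
  from continuous_map_compose[OF this continuous_map_nsphere_infinite]
  have g_cont: "continuous_map (top_of_set A) infinite_sphere g" by (simp add: o_def)
  have fg: "g ` orbit u = orbit (g u)" for u by (simp add: orbit_def g_odd)
  have "continuous_map (antipodal_quotient (top_of_set A)) RP_infinity ((`) g)"
    unfolding RP_infinity_def by (rule continuous_map_antipodal_quotient[OF g_cont]) (rule fg)
  then have "classifying_map A ((`) g)"
    unfolding classifying_map_def using g_cont g_odd by (intro conjI exI[of _ g]) auto
  then show ?thesis by blast
qed

text \<open>
  The monotonicity of the index, in terms of the characteristic classes.
\<close>

lemma null_cup_power_subset:
  fixes M T :: "'a::real_normed_vector set"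
  assumes MT: "M \<subseteq> T" and sym: "symmetric_set M"
    and v: "sheet_cochain (top_of_set T) v" and w: "sheet_cochain (top_of_set M) w"
    and null: "null_cochain (antipodal_quotient (top_of_set T)) (cup_power (antipodal_quotient (top_of_set T)) v n)"
  shows "null_cochain (antipodal_quotient (top_of_set M)) (cup_power (antipodal_quotient (top_of_set M)) w n)"
proof -
  let ?M = "top_of_set M" and ?T = "top_of_set T"
  let ?QM = "antipodal_quotient ?M" and ?QT = "antipodal_quotient ?T"
  define v' where "v' = as_pullback ?QM (\<lambda>a. a) v"
  have incl: "continuous_map ?M ?T (\<lambda>x. x)" using MT by auto
  have v': "sheet_cochain ?M v'"
    unfolding v'_def by (rule sheet_cochain_pullback[OF incl _ _ v]) auto
  have aM: "antipodal_space ?M" by (rule antipodal_space_top_of_set[OF sym])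
  have "continuous_map ?QM ?QT (\<lambda>a. a)" by (rule continuous_map_antipodal_quotient[OF incl]) simp
  from null_cochain_map[OF null this]
  have "null_cochain ?QM (cup_power ?QT v n)" by simp
  moreover have "cup_power ?QM v' n xs = cup_power ?QT v n xs" if "set xs \<subseteq> topspace ?QM" for xs
    using as_pullback_cup_power[of ?QM "\<lambda>a. a" ?QT xs v n] that MT unfolding v'_def by auto
  ultimately have "null_cochain ?QM (cup_power ?QM v' n)"
    using null_cochain_cong[of ?QM "cup_power ?QM v' n" "cup_power ?QT v n"] by blast
  moreover have "null_cochain ?QM (\<lambda>xs. cup_power ?QM v' n xs + cup_power ?QM w n xs)"
    by (intro cup_power_cong sheet_cochain_cocycle aM v' w sheet_cochain_unique)
  ultimately show ?thesis using null_cochain_add_cancel by blast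
qed

lemma unit_not_null: "topspace X \<noteq> {} \<Longrightarrow> \<not> null_cochain X (unit_cochain X)"
proof
  assume "topspace X \<noteq> {}" and "null_cochain X (unit_cochain X)"
  then obtain x where x: "x \<in> topspace X" by blast
  obtain \<eta> where \<eta>: "\<eta> [] = 0" "as_locally_zero X (\<lambda>xs. unit_cochain X xs + cobd \<eta> xs)"
    using \<open>null_cochain X (unit_cochain X)\<close> by (auto simp: null_cochain_def)
  obtain U where "x \<in> U" "\<And>xs. set xs \<subseteq> U \<Longrightarrow> unit_cochain X xs + cobd \<eta> xs = 0"
    using as_locally_zeroE[OF \<eta>(2) x] by metis
  from this(2)[of "[x]"] this(1) x \<eta>(1) show False by (simp add: unit_cochain_def cobd_Cons)
qed

theorem theorem1p4:
  fixes s :: real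
    and sc :: "'a::banach \<Rightarrow> real \<Rightarrow> 'a"
    and A B :: "'a \<Rightarrow> 'a dual"
    and I J :: "'a \<Rightarrow> real"
    and lam :: real
  assumes refl: "reflexive_space TYPE('a)"
    and scal: "scaling s sc"
    and A_op: "scaled_operator s sc A" and A_pot: "potential_of A I"
    and B_op: "scaled_operator s sc B" and B_pot: "potential_of B J"
    and a: "\<And>u. u \<noteq> 0 \<Longrightarrow> blinfun_apply (A u) u > 0"
    and b: "\<And>X u. weakly_converges X u \<Longrightarrow>
              (\<lambda>j. blinfun_apply (A (X j)) (X j - u)) \<longlonglongrightarrow> 0 \<Longrightarrow>
              (\<exists>r::nat \<Rightarrow> nat. strict_mono r \<and> (X \<circ> r) \<longlonglongrightarrow> u)"
    and c: "\<And>u. u \<noteq> 0 \<Longrightarrow> blinfun_apply (B u) u > 0"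
    and d: "\<And>X u. weakly_converges X u \<Longrightarrow> (\<lambda>j. B (X j)) \<longlonglongrightarrow> B u"
    and e: "filterlim I at_top at_infinity"
    and f: "\<And>u. u \<noteq> 0 \<Longrightarrow> (\<exists>!t. t > 0 \<and> I (t *\<^sub>R u) = 1)"
    and g: "\<And>\<mu> u. A u = \<mu> *\<^sub>R B u \<Longrightarrow> I u = \<mu> * J u"
    and noneigen: "lam \<notin> eigenvalues A B"
  shows "(ereal lam < minimax_eigenvalue I J 1 \<longrightarrow>
            (\<forall>l. critical_group (\<lambda>u. I u - lam * J u) l \<cong>
                 (if l = 0 then integer_mod_group 2 else singleton_group 0))) \<and>
         (minimax_eigenvalue I J 1 < ereal lam \<longrightarrow>
            (\<forall>l. critical_group (\<lambda>u. I u - lam * J u) l \<cong>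
                 as_reduced_cohomology (int l - 1) (top_of_set (Psi_sublevel I J lam))) \<and>
            trivial_group (critical_group (\<lambda>u. I u - lam * J u) 0)) \<and>
         (\<forall>k\<ge>1. minimax_eigenvalue I J k < ereal lam \<and> ereal lam < minimax_eigenvalue I J (k + 1) \<longrightarrow>
            \<not> trivial_group (critical_group (\<lambda>u. I u - lam * J u) k)) \<and>
         (\<exists>l. \<not> trivial_group (critical_group (\<lambda>u. I u - lam * J u) l))"
proof -
  let ?T = "Psi_sublevel I J lam"
  let ?C = "critical_group (\<lambda>u. I u - lam * J u)"
  let ?top = "top_of_set ?T" and ?Q = "antipodal_quotient (top_of_set ?T)"
  have A_odd: "A (- u) = - A u" and B_odd: "B (- u) = - B u" for u
    using A_op B_op by (simp_all add: scaled_operator_def)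
  have B0: "B 0 = 0"
  proof -
    have "2 *\<^sub>R B 0 = B 0 + - B 0" using B_odd[of 0] by (simp add: scaleR_2)
    then show ?thesis by simp
  qed
  have I_even: "I (- u) = I u" and J_even: "J (- u) = J u" for u
    using potential_even[OF A_pot A_odd] potential_even[OF B_pot B_odd] by simp_all
  interpret scaled_functionals s sc I J
  proof
    show "I (sc u t) = t powr s * I u" "J (sc u t) = t powr s * J u" if "t \<ge> 0" for u t
      using potential_scaled[OF A_pot scal A_op that] potential_scaled[OF B_pot scal B_op that] by simp_all
    show "I u > 0" "J u > 0" if "u \<noteq> 0" for u
      using potential_positive[OF A_pot a that] potential_positive[OF B_pot c that] by simp_all
    show "I 0 = 0" "J 0 = 0" using A_pot B_pot by (simp_all add: potential_of_def)
  qed (rule scal potential_continuous[OF A_pot] potential_continuous[OF B_pot])+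
  have T_sym: "symmetric_set ?T"
  proof -
    have "- u \<in> ?T" if "u \<in> ?T" for u using that by (simp add: mem_Psi_sublevel I_even J_even)
    then show ?thesis unfolding symmetric_set_def by (metis equalityI image_subsetI minus_minus image_eqI subsetI)
  qed
  have T_bounded: "bounded ?T"
  proof -
    have "eventually (\<lambda>u. I u > 1) at_infinity" using e by (simp add: filterlim_at_top_dense)
    then obtain R where R: "\<And>u. norm u \<ge> R \<Longrightarrow> I u > 1" by (auto simp: eventually_at_infinity)
    have "norm u \<le> R" if "u \<in> ?T" for u
      using R[of u] that by (cases "norm u \<le> R") (auto simp: mem_Psi_sublevel)
    then show ?thesis by (auto simp: bounded_iff)
  qed
  obtain V where V: "finite V" "\<And>u. u \<in> ?T \<Longrightarrow> \<exists>v\<in>V. blinfun_apply (B v) u \<noteq> 0"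
  proof (cases "?T = {}")
    case True
    then show ?thesis using that[of "{}"] by simp
  next
    case False
    have J_low: "lam > 0 \<and> J u \<ge> 1 / lam" if "u \<in> ?T" for u
    proof -
      have u: "I u = 1" "1 \<le> lam * J u" using that by (simp_all add: mem_Psi_sublevel)
      then have "u \<noteq> 0" using I0 by auto
      then have "J u > 0" by (rule J_pos)
      then have "lam > 0" using u(2) by (smt (verit) mult_nonpos_nonneg)
      then show ?thesis using u(2) by (simp add: divide_le_eq mult.commute)
    qed
    then have "1 / lam > 0" using False by auto
    show ?thesis
      by (rule finitely_many_functionals[OF refl _ c potential_weakly_null[OF B_pot B0 d] T_bounded \<open>1 / lam > 0\<close>])
         (use B_op J_low that in \<open>auto simp: scaled_operator_def potential_operator_def\<close>)
  qed
  obtain n and v :: "nat \<Rightarrow> 'a" where v: "V = v ` {i. i < n}"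
    using finite_imp_nat_seg_image_inj_on[OF V(1)] by blast
  \<comment> \<open>The odd functions whose nonzero sets cover \<open>?T\<close>.\<close>
  define h where "h i = blinfun_apply (B (v i))" for i
  have h_cont: "continuous_on S (h i)" for S i unfolding h_def by (intro continuous_intros)
  have h_odd: "h i (- u) = - h i u" for i u by (simp add: h_def blinfun.minus_right)
  have h_nz: "\<exists>i<n. h i u \<noteq> 0" if "u \<in> ?T" for u
    using V(2)[OF that] by (auto simp: v h_def)
  have classify: "\<exists>f. classifying_map M f" if "M \<subseteq> ?T" "symmetric_set M" for M
    using classifying_map_exists[OF that(2), of n h] h_cont h_odd h_nz that(1) by blast
  have minimax_le: "minimax_eigenvalue I J k \<le> ereal lam" if "enat k \<le> coh_index ?T" for k
  proof -
    have "?T \<in> index_class I k"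
      using that T_sym by (auto simp: index_class_def Psi_sublevel_def)
    then have "minimax_eigenvalue I J k \<le> (SUP u\<in>?T. ereal (Psi_tilde J u))"
      unfolding minimax_eigenvalue_def by (rule INF_lower)
    also have "\<dots> \<le> ereal lam" by (rule SUP_least) (simp add: Psi_sublevel_def)
    finally show ?thesis .
  qed
  have minimax_less: "\<exists>M. M \<subseteq> ?T \<and> M \<noteq> {} \<and> symmetric_set M \<and> enat k \<le> coh_index M"
    if less: "minimax_eigenvalue I J k < ereal lam" and k: "k \<ge> 1" for k
  proof -
    obtain M where M: "M \<in> index_class I k" "(SUP u\<in>M. ereal (Psi_tilde J u)) < ereal lam"
      using less unfolding minimax_eigenvalue_def INF_less_iff by blast
    have "M \<subseteq> ?T"
    proof
      fix u assume u: "u \<in> M"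
      have "ereal (Psi_tilde J u) \<le> (SUP u\<in>M. ereal (Psi_tilde J u))" by (rule SUP_upper[OF u])
      then have "ereal (Psi_tilde J u) < ereal lam" using M(2) by (rule order.strict_trans1)
      then show "u \<in> ?T" using M(1) u by (auto simp: Psi_sublevel_def index_class_def)
    qed
    moreover have "M \<noteq> {}"
    proof
      assume "M = {}"
      then have "enat k \<le> 0" using M(1) by (simp add: index_class_def coh_index_def)
      then show False using k by (simp add: zero_enat_def)
    qed
    ultimately show ?thesis using M(1) by (auto simp: index_class_def)
  qed
  have empty: "?C l \<cong> (if l = 0 then integer_mod_group 2 else singleton_group 0)" if "?T = {}" for l
    by (rule critical_group_iso_point[OF that])
  have nonempty: "?C l \<cong> as_reduced_cohomology (int l - 1) ?top" if "?T \<noteq> {}" for l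
    by (rule critical_group_iso_reduced[OF that])
  have C_group: "Group.group (?C l)" for l
    unfolding critical_group_def by (rule group_as_cohomology)
  have T_space: "antipodal_space ?top" by (rule antipodal_space_top_of_set[OF T_sym])
  have critical_nontrivial: "\<not> trivial_group (?C (Suc k))"
    if ne: "?T \<noteq> {}" and w: "sheet_cochain ?top w"
      and null: "null_cochain ?Q (cup_power ?Q w (Suc k))" "\<not> null_cochain ?Q (cup_power ?Q w k)" for w k
  proof
    assume triv: "trivial_group (?C (Suc k))"
    have "?C (Suc k) \<cong> as_reduced_cohomology (int k) ?top" using nonempty[OF ne, of "Suc k"] by simp
    then have "trivial_group (as_reduced_cohomology (int k) ?top)"
      using triv reduced_class_hom(1)[of "int k" ?top] by (auto simp: group_hom_def intro: isomorphic_group_triviality1)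
    moreover obtain \<xi> where "\<xi> \<in> as_relcocycles (int k) ?top {}" "\<not> reduced_null ?top \<xi>"
      using transfer_nontrivial[OF T_space w null] by blast
    ultimately show False using reduced_cohomology_nontrivial by blast
  qed
  have unit_nonnull: "\<not> null_cochain ?Q (cup_power ?Q w 0)" if "?T \<noteq> {}" for w
    using unit_not_null[of ?Q] that by simp
  have index_ge_1: "enat 1 \<le> coh_index ?T" if ne: "?T \<noteq> {}"
  proof -
    obtain w where "enat 1 \<le> coh_index ?T \<longleftrightarrow> \<not> null_cochain ?Q (cup_power ?Q w (1 - 1))"
      using coh_index_sheet_cochain[OF T_sym ne classify[OF order_refl T_sym]] by (metis order_refl)
    then show ?thesis using unit_nonnull[OF ne] by simp
  qed
  have part1: "ereal lam < minimax_eigenvalue I J 1 \<longrightarrow>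
      (\<forall>l. ?C l \<cong> (if l = 0 then integer_mod_group 2 else singleton_group 0))"
  proof
    assume "ereal lam < minimax_eigenvalue I J 1"
    then have "?T = {}" using minimax_le[OF index_ge_1] by force
    then show "\<forall>l. ?C l \<cong> (if l = 0 then integer_mod_group 2 else singleton_group 0)" using empty by blast
  qed
  have part2: "minimax_eigenvalue I J 1 < ereal lam \<longrightarrow>
      (\<forall>l. ?C l \<cong> as_reduced_cohomology (int l - 1) ?top) \<and> trivial_group (?C 0)"
  proof
    assume "minimax_eigenvalue I J 1 < ereal lam"
    then have ne: "?T \<noteq> {}" using minimax_less[of 1] by blast
    have "as_reduced_cohomology (int 0 - 1) ?top \<cong> ?C 0"
      by (rule group.iso_sym[OF C_group nonempty[OF ne]])
    then have "trivial_group (?C 0)"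
      using reduced_cohomology_neg_trivial[of "int 0 - 1" ?top] C_group isomorphic_group_triviality1 by auto
    then show "(\<forall>l. ?C l \<cong> as_reduced_cohomology (int l - 1) ?top) \<and> trivial_group (?C 0)"
      using nonempty[OF ne] by blast
  qed
  have part3: "\<forall>k\<ge>1. minimax_eigenvalue I J k < ereal lam \<and> ereal lam < minimax_eigenvalue I J (k + 1) \<longrightarrow>
      \<not> trivial_group (?C k)"
  proof (intro allI impI)
    fix k :: nat assume k: "k \<ge> 1" and lam: "minimax_eigenvalue I J k < ereal lam \<and> ereal lam < minimax_eigenvalue I J (k + 1)"
    obtain M where M: "M \<subseteq> ?T" "M \<noteq> {}" "symmetric_set M" "enat k \<le> coh_index M"
      using minimax_less[of k] lam k by blast
    have ne: "?T \<noteq> {}" using M by blast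
    obtain w where w: "sheet_cochain ?top w"
      and w_index: "\<And>k. k \<ge> 1 \<Longrightarrow> enat k \<le> coh_index ?T \<longleftrightarrow> \<not> null_cochain ?Q (cup_power ?Q w (k - 1))"
      using coh_index_sheet_cochain[OF T_sym ne classify[OF order_refl T_sym]] by metis
    obtain wM where wM: "sheet_cochain (top_of_set M) wM"
      and wM_index: "\<And>k. k \<ge> 1 \<Longrightarrow> enat k \<le> coh_index M \<longleftrightarrow>
        \<not> null_cochain (antipodal_quotient (top_of_set M)) (cup_power (antipodal_quotient (top_of_set M)) wM (k - 1))"
      using coh_index_sheet_cochain[OF M(3,2) classify[OF M(1,3)]] by metis
    have "\<not> null_cochain ?Q (cup_power ?Q w (k - 1))"
      using wM_index[OF k] M(4) null_cup_power_subset[OF M(1,3) w wM] by blast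
    moreover have "null_cochain ?Q (cup_power ?Q w k)"
      using w_index[of "k + 1"] minimax_le[of "k + 1"] lam by force
    ultimately show "\<not> trivial_group (?C k)"
      using critical_nontrivial[OF ne w, of "k - 1"] k by simp
  qed
  have part4: "\<exists>l. \<not> trivial_group (?C l)"
  proof (cases "?T = {}")
    case True
    have "integer_mod_group 2 \<cong> ?C 0" using group.iso_sym[OF C_group empty[OF True, of 0]] by simp
    then have "\<not> trivial_group (?C 0)"
      using isomorphic_group_triviality[of "?C 0" "integer_mod_group 2"] group.iso_sym C_group trivial_integer_mod_group[of 2]
      by (metis group_integer_mod_group numeral_eq_one_iff semiring_norm(85))
    then show ?thesis ..
  next
    case False
    obtain w where w: "sheet_cochain ?top w"
      using coh_index_sheet_cochain[OF T_sym False classify[OF order_refl T_sym]] by metis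
    have "null_cochain ?Q (cup_power ?Q w n)"
      by (rule odd_functions_cup_power_null[OF T_space w, of n h]) (use h_cont h_odd h_nz in auto)
    \<comment> \<open>The exponent of the first vanishing power of the characteristic class is the index of \<open>?T\<close>.\<close>
    then obtain k where k: "null_cochain ?Q (cup_power ?Q w k)" "\<And>m. m < k \<Longrightarrow> \<not> null_cochain ?Q (cup_power ?Q w m)"
      using exists_least_iff[of "\<lambda>m. null_cochain ?Q (cup_power ?Q w m)"] by blast
    then have "k \<noteq> 0" using unit_nonnull[OF False] by metis
    then obtain m where "k = Suc m" using not0_implies_Suc by blast
    then have "\<not> trivial_group (?C (Suc m))" using critical_nontrivial[OF False w] k by blast
    then show ?thesis ..
  qed
  show ?thesis using part1 part2 part3 part4 by blast
qed

end
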